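(* Let $\alpha>0$, $P_0>0$, and let $\sigma_j>0$, $1\le j<\infty$, be known constants. For $\epsilon>0$ suppose one observes $y=\{y_j\}_{j=1}^\infty$ with $y_j=x_j+\epsilon\sigma_j\xi_j$, where $\xi_j$ are independent standard Gaussian random variables and $x=\{x_j\}_{j=1}^\infty$ is an unknown element of $$B(\alpha,P_0)=\Big\{x=\{x_j\}_{j=1}^\infty:\ \sup_k k^{2\alpha}\sum_{j=k}^\infty x_j^2\le P_0\Big\}.$$ Assume that (i) there is $c>0$ such that $c<\sigma_j^2<\infty$ for all $j$; (ii) there is $j_0$ such that for all $j>j_0$, $$\frac{\sigma_j^2\,j^{2\alpha+1}}{\sigma_{j-1}^2\,(j-1)^{2\alpha+1}}>1 .$$ Then the linear estimator $\hat x_\lambda=\{\lambda_j y_j\}_{j=1}^\infty$ with $$\lambda_j=\frac{2\alpha P_0 j^{-2\alpha-1}}{2\alpha P_0 j^{-2\alpha-1}+\epsilon^2\sigma_j^2}$$ is asymptotically minimax on $B(\alpha,P_0)$ in the set of all estimators, and the asymptotically minimax risk equals $$R_\epsilon=\epsilon^2\sum_{j=1}^\infty\frac{2\alpha P_0 j^{-2\alpha-1}\sigma_j^2}{2\alpha P_0 j^{-2\alpha-1}+\epsilon^2\sigma_j^2}\,(1+o(1))$$ as $\epsilon\to0$.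
   Context: For $x=\{x_j\}_{j=1}^\infty$, $\|x\|^2=\sum_{j=1}^\infty x_j^2$; $E_x$ denotes expectation when the true parameter is $x$. Let $\Psi$ be the set of all estimators (i.e. all measurable functions of the observation $y$). An estimator $\hat x_\epsilon$ (a family indexed by $\epsilon>0$) is called asymptotically minimax if $$R_\epsilon:=\sup_{x\in B(\alpha,P_0)}E_x\|\hat x_\epsilon-x\|^2=\inf_{\tilde x_\epsilon\in\Psi}\ \sup_{x\in B(\alpha,P_0)}E_x\|\tilde x_\epsilon-x\|^2\,(1+o(1))\quad\text{as }\epsilon\to0 .$$ *)

theory Defs
  imports "HOL-Probability.Probability"
begin

text \<open>
  Sequences are indexed by the positive integers, as elements of type \<^typ>\<open>nat \<Rightarrow> real\<close> whose
  entry at 0 is ignored. Where a sequence is an observation or an estimate it lies in the product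
  space over \<open>{1..}\<close>, so that entry is \<open>undefined\<close> and carries no information. Norms and
  risks take values in \<^typ>\<open>ennreal\<close>, where a divergent series has the value \<open>\<infinity>\<close>.
\<close>

definition seq_space :: "(nat \<Rightarrow> real) measure" where
  "seq_space = PiM {1..} (\<lambda>_. borel)"

definition norm_sq :: "(nat \<Rightarrow> real) \<Rightarrow> ennreal" where
  "norm_sq x = (\<Sum>j. ennreal ((x (Suc j))\<^sup>2))"

definition B :: "real \<Rightarrow> real \<Rightarrow> (nat \<Rightarrow> real) set" where
  "B \<alpha> P0 = {x. (SUP k\<in>{1..}. ennreal (real k powr (2 * \<alpha>)) * (\<Sum>i. ennreal ((x (k + i))\<^sup>2)))
                 \<le> ennreal P0}"

definition observation ::
  "(nat \<Rightarrow> 'a \<Rightarrow> real) \<Rightarrow> (nat \<Rightarrow> real) \<Rightarrow> real \<Rightarrow> (nat \<Rightarrow> real) \<Rightarrow> 'a \<Rightarrow> (nat \<Rightarrow> real)" where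
  "observation \<xi> \<sigma> \<epsilon> x \<omega> = (\<lambda>j\<in>{1..}. x j + \<epsilon> * \<sigma> j * \<xi> j \<omega>)"

definition estimators :: "((nat \<Rightarrow> real) \<Rightarrow> (nat \<Rightarrow> real)) set" where
  "estimators = measurable seq_space seq_space"

definition risk ::
  "'a measure \<Rightarrow> (nat \<Rightarrow> 'a \<Rightarrow> real) \<Rightarrow> (nat \<Rightarrow> real) \<Rightarrow> real
    \<Rightarrow> ((nat \<Rightarrow> real) \<Rightarrow> (nat \<Rightarrow> real)) \<Rightarrow> (nat \<Rightarrow> real) \<Rightarrow> ennreal" where
  "risk M \<xi> \<sigma> \<epsilon> T x =
     (\<integral>\<^sup>+ \<omega>. norm_sq (\<lambda>j. T (observation \<xi> \<sigma> \<epsilon> x \<omega>) j - x j) \<partial>M)"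

definition sup_risk ::
  "'a measure \<Rightarrow> (nat \<Rightarrow> 'a \<Rightarrow> real) \<Rightarrow> (nat \<Rightarrow> real) \<Rightarrow> real \<Rightarrow> real \<Rightarrow> real
    \<Rightarrow> ((nat \<Rightarrow> real) \<Rightarrow> (nat \<Rightarrow> real)) \<Rightarrow> ennreal" where
  "sup_risk M \<xi> \<sigma> \<alpha> P0 \<epsilon> T = (SUP x\<in>B \<alpha> P0. risk M \<xi> \<sigma> \<epsilon> T x)"

definition minimax_risk ::
  "'a measure \<Rightarrow> (nat \<Rightarrow> 'a \<Rightarrow> real) \<Rightarrow> (nat \<Rightarrow> real) \<Rightarrow> real \<Rightarrow> real \<Rightarrow> real \<Rightarrow> ennreal" where
  "minimax_risk M \<xi> \<sigma> \<alpha> P0 \<epsilon> = (INF T\<in>estimators. sup_risk M \<xi> \<sigma> \<alpha> P0 \<epsilon> T)"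

text \<open>
  \<open>f \<epsilon> = g \<epsilon> (1 + o(1))\<close> as \<open>\<epsilon>\<close> tends to 0 through positive values. The library's asymptotic
  equivalence requires a normed field, and so does not apply to \<^typ>\<open>ennreal\<close>.
\<close>

definition asymp_eq0 :: "(real \<Rightarrow> ennreal) \<Rightarrow> (real \<Rightarrow> ennreal) \<Rightarrow> bool" where
  "asymp_eq0 f g \<longleftrightarrow>
     (\<exists>\<delta> :: real \<Rightarrow> real. (\<delta> \<longlongrightarrow> 0) (at_right 0) \<and>
        (\<forall>\<^sub>F \<epsilon> in at_right 0. f \<epsilon> = g \<epsilon> * ennreal (1 + \<delta> \<epsilon>)))"

definition asymptotically_minimax ::
  "'a measure \<Rightarrow> (nat \<Rightarrow> 'a \<Rightarrow> real) \<Rightarrow> (nat \<Rightarrow> real) \<Rightarrow> real \<Rightarrow> real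
    \<Rightarrow> (real \<Rightarrow> (nat \<Rightarrow> real) \<Rightarrow> (nat \<Rightarrow> real)) \<Rightarrow> bool" where
  "asymptotically_minimax M \<xi> \<sigma> \<alpha> P0 T \<longleftrightarrow>
     (\<forall>\<epsilon>>0. T \<epsilon> \<in> estimators) \<and>
     asymp_eq0 (\<lambda>\<epsilon>. sup_risk M \<xi> \<sigma> \<alpha> P0 \<epsilon> (T \<epsilon>)) (\<lambda>\<epsilon>. minimax_risk M \<xi> \<sigma> \<alpha> P0 \<epsilon>)"

definition linear_estimator :: "(nat \<Rightarrow> real) \<Rightarrow> (nat \<Rightarrow> real) \<Rightarrow> (nat \<Rightarrow> real)" where
  "linear_estimator l y = (\<lambda>j\<in>{1..}. l j * y j)"

definition weight :: "real \<Rightarrow> real \<Rightarrow> (nat \<Rightarrow> real) \<Rightarrow> real \<Rightarrow> nat \<Rightarrow> real" where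
  "weight \<alpha> P0 \<sigma> \<epsilon> j =
     2 * \<alpha> * P0 * real j powr (- 2 * \<alpha> - 1)
       / (2 * \<alpha> * P0 * real j powr (- 2 * \<alpha> - 1) + \<epsilon>\<^sup>2 * (\<sigma> j)\<^sup>2)"

definition risk_formula :: "real \<Rightarrow> real \<Rightarrow> (nat \<Rightarrow> real) \<Rightarrow> real \<Rightarrow> ennreal" where
  "risk_formula \<alpha> P0 \<sigma> \<epsilon> =
     ennreal (\<epsilon>\<^sup>2) *
     (\<Sum>i. let j = Suc i in
        ennreal (2 * \<alpha> * P0 * real j powr (- 2 * \<alpha> - 1) * (\<sigma> j)\<^sup>2
          / (2 * \<alpha> * P0 * real j powr (- 2 * \<alpha> - 1) + \<epsilon>\<^sup>2 * (\<sigma> j)\<^sup>2)))"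

end

theory Submission imports Defs begin

text \<open>
Write \<open>s\<^sub>j = \<epsilon> \<sigma>\<^sub>j\<close>, \<open>a\<^sub>j = 2 \<alpha> P0 j powr (- 2 \<alpha> - 1)\<close> and \<open>F = \<Sum>j. a\<^sub>j s\<^sub>j\<^sup>2 / (a\<^sub>j + s\<^sub>j\<^sup>2)\<close>, so that \<open>F\<close>
is the claimed risk: the sum of the Bayes risks of independent normal priors with variances \<open>a\<^sub>j\<close>,
for which the given weights are optimal. The proof shows that the given estimator has maximal risk
at most \<open>(1 + o(1)) F\<close> and that no estimator has maximal risk below \<open>(1 - o(1)) F\<close>.

\<^emph>\<open>Upper bound.\<close> The risk at \<open>x\<close> is \<open>\<Sum>j. (1 - \<lambda>\<^sub>j)\<^sup>2 x\<^sub>j\<^sup>2 + \<lambda>\<^sub>j\<^sup>2 s\<^sub>j\<^sup>2\<close>. The ball constrains the tails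
\<open>\<Sum>j\<ge>k. x\<^sub>j\<^sup>2\<close> by \<open>P0 k powr (- 2 \<alpha>)\<close> and nothing else. The assumed monotonicity of
\<open>\<sigma>\<^sub>j\<^sup>2 j powr (2 \<alpha> + 1)\<close> makes \<open>(1 - \<lambda>\<^sub>j)\<^sup>2\<close> nondecreasing from \<open>j0\<close> on, and then summation by parts
(\<open>abel_majorization\<close>) shows that the bias is largest at the point with all tail constraints tight,
whose squared coordinates \<open>b\<^sub>j = P0 (j powr (- 2 \<alpha>) - (j + 1) powr (- 2 \<alpha>))\<close> are at most \<open>a\<^sub>j\<close>. The
coordinates before \<open>j0\<close> cost a term of order \<open>\<epsilon>\<^sup>4\<close>, which is negligible because \<open>F\<close> is at least of
order \<open>\<epsilon>\<^sup>2\<close> (\<open>linear_risk_le\<close>, \<open>bayes_sum_ge_square\<close>).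

\<^emph>\<open>Lower bound.\<close> The maximal risk is at least the Bayes risk of any prior carried by the ball. The
obvious prior, independent normal coordinates with variances slightly below \<open>b\<^sub>j\<close>, satisfies the
tail constraint at \<open>k\<close> up to a probability exponentially small in \<open>k\<close>, so it is useful only from a
large index on. Since nothing bounds the growth of \<open>\<sigma>\<^sub>j\<close>, the initial coordinates may carry almost all
of \<open>F\<close> and cannot be dropped. They get another prior. Fix a small \<open>\<eta>\<close> and let \<open>m\<close> be the first
index with \<open>s\<^sub>m\<^sup>2 \<ge> \<eta> a\<^sub>m\<close>; it tends to infinity as \<open>\<epsilon>\<close> tends to 0.

  \<^item> For \<open>j < m\<close> the noise is small compared with \<open>\<surd>b\<^sub>j\<close>. The uniform prior on \<open>[-\<surd>b\<^sub>j, \<surd>b\<^sub>j]\<close> has a Bayes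
    risk of almost \<open>s\<^sub>j\<^sup>2\<close> (\<open>uniform_bayes_efficient\<close>). It cannot violate the constraints at \<open>k < m\<close> as
    long as the one at \<open>m\<close> holds, because the \<open>b\<^sub>j\<close> telescope.

  \<^item> For \<open>j \<ge> m\<close> the normal prior is used. All its tail constraints hold simultaneously up to a
    probability exponentially small in \<open>m\<close> (\<open>prior_violation_prob\<close>). Restricting it to that event costs
    at most \<open>o(1) m powr (- 2 \<alpha>)\<close> of risk, which is negligible relative to \<open>F\<close>: by monotonicity
    \<open>s\<^sub>j\<^sup>2 \<ge> \<eta> a\<^sub>j\<close> for every \<open>j \<ge> m\<close>, so these coordinates alone contribute to \<open>F\<close> at least a fixed multiple
    of \<open>(\<Sum>j\<ge>m. b\<^sub>j) = P0 m powr (- 2 \<alpha>)\<close> (\<open>tail_bound_le_bayes_sum\<close>).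

The two parts are combined in \<open>bayes_lower_bound\<close> for finitely many coordinates, and the number of
coordinates is then sent to infinity with \<open>\<epsilon>\<close> fixed (\<open>eventually_risk_lower_bound\<close>).
\<close>

section \<open>The standard normal law\<close>

definition gauss :: "real measure" where
  "gauss = density lborel (\<lambda>z. ennreal (std_normal_density z))"

lemma sets_gauss [simp, measurable_cong]: "sets gauss = sets borel"
  by (simp add: gauss_def)

lemma prob_space_gauss: "prob_space gauss"
  unfolding gauss_def by (rule prob_space_normal_density) simp

lemma nn_integral_gauss:
  assumes [measurable]: "f \<in> borel_measurable borel"
  shows "(\<integral>\<^sup>+z. f z \<partial>gauss) = (\<integral>\<^sup>+z. ennreal (std_normal_density z) * f z \<partial>lborel)"
  unfolding gauss_def by (subst nn_integral_density) auto

text \<open>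
Substitution of \<open>y = \<mu> + s z\<close>: the noisy observation of \<open>\<mu>\<close> has density \<^term>\<open>normal_density \<mu> s\<close>.
\<close>

lemma nn_integral_gauss_affine:
  assumes [measurable]: "f \<in> borel_measurable borel" and s: "s > 0"
  shows "(\<integral>\<^sup>+z. f (\<mu> + s * z) \<partial>gauss) = (\<integral>\<^sup>+y. ennreal (normal_density \<mu> s y) * f y \<partial>lborel)"
proof -
  have "(\<integral>\<^sup>+y. ennreal (normal_density \<mu> s y) * f y \<partial>lborel)
      = ennreal \<bar>s\<bar> * (\<integral>\<^sup>+z. ennreal (normal_density \<mu> s (\<mu> + s * z)) * f (\<mu> + s * z) \<partial>lborel)"
    using s by (intro nn_integral_real_affine) auto
  also have "\<dots> = (\<integral>\<^sup>+z. ennreal \<bar>s\<bar> * (ennreal (normal_density \<mu> s (\<mu> + s * z)) * f (\<mu> + s * z)) \<partial>lborel)"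
    by (rule nn_integral_cmult [symmetric]) auto
  also have "\<dots> = (\<integral>\<^sup>+z. ennreal (std_normal_density z) * f (\<mu> + s * z) \<partial>lborel)"
  proof (intro nn_integral_cong)
    fix z
    have "\<bar>s\<bar> * normal_density \<mu> s (\<mu> + s * z) = std_normal_density z"
      using s by (simp add: normal_density_def power_mult_distrib real_sqrt_mult)
    then show "ennreal \<bar>s\<bar> * (ennreal (normal_density \<mu> s (\<mu> + s * z)) * f (\<mu> + s * z))
        = ennreal (std_normal_density z) * f (\<mu> + s * z)"
      by (metis abs_ge_zero ennreal_mult' mult.assoc)
  qed
  also have "\<dots> = (\<integral>\<^sup>+z. f (\<mu> + s * z) \<partial>gauss)"
    by (rule nn_integral_gauss [symmetric]) simp
  finally show ?thesis ..
qed

lemma nn_integral_lborel_uminus: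
  fixes f :: "real \<Rightarrow> ennreal"
  assumes [measurable]: "f \<in> borel_measurable borel"
  shows "(\<integral>\<^sup>+z. f (- z) \<partial>lborel) = (\<integral>\<^sup>+z. f z \<partial>lborel)"
  using nn_integral_real_affine [of f "-1" 0] by simp

text \<open>
Averaging the values at \<open>z\<close> and \<open>-z\<close> cancels the cross term, whatever the offset \<open>d\<close> is. Where the
posterior is symmetric, an arbitrary estimate enters only through such an offset.
\<close>

lemma symmetric_quadratic_lower:
  fixes w :: "real \<Rightarrow> ennreal"
  assumes [measurable]: "w \<in> borel_measurable borel" and even: "\<And>z. w (- z) = w z"
  shows "(\<integral>\<^sup>+z. w z * ennreal (c\<^sup>2 * z\<^sup>2) \<partial>lborel) \<le> (\<integral>\<^sup>+z. w z * ennreal ((d + c * z)\<^sup>2) \<partial>lborel)"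
    (is "?A \<le> ?B")
proof -
  have "2 * ?A = (\<integral>\<^sup>+z. 2 * (w z * ennreal (c\<^sup>2 * z\<^sup>2)) \<partial>lborel)"
    by (rule nn_integral_cmult [symmetric]) simp
  also have "\<dots> \<le> (\<integral>\<^sup>+z. w z * ennreal ((d + c * z)\<^sup>2) + w (- z) * ennreal ((d + c * (- z))\<^sup>2) \<partial>lborel)"
  proof (rule nn_integral_mono)
    fix z
    have "2 * (c\<^sup>2 * z\<^sup>2) \<le> (d + c * z)\<^sup>2 + (d + c * (- z))\<^sup>2"
      by (simp add: power2_eq_square algebra_simps)
    then have "2 * ennreal (c\<^sup>2 * z\<^sup>2) \<le> ennreal ((d + c * z)\<^sup>2) + ennreal ((d + c * (- z))\<^sup>2)"
      by (metis ennreal_leI ennreal_mult' ennreal_numeral ennreal_plus zero_le_numeral zero_le_power2)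
    then have "w z * (2 * ennreal (c\<^sup>2 * z\<^sup>2))
        \<le> w z * (ennreal ((d + c * z)\<^sup>2) + ennreal ((d + c * (- z))\<^sup>2))"
      by (rule mult_left_mono) simp
    then show "2 * (w z * ennreal (c\<^sup>2 * z\<^sup>2))
        \<le> w z * ennreal ((d + c * z)\<^sup>2) + w (- z) * ennreal ((d + c * (- z))\<^sup>2)"
      by (simp only: even distrib_left mult.left_commute)
  qed
  also have "\<dots> = ?B + (\<integral>\<^sup>+z. w (- z) * ennreal ((d + c * (- z))\<^sup>2) \<partial>lborel)"
    by (rule nn_integral_add) auto
  also have "(\<integral>\<^sup>+z. w (- z) * ennreal ((d + c * (- z))\<^sup>2) \<partial>lborel) = ?B"
    by (rule nn_integral_lborel_uminus [of "\<lambda>z. w z * ennreal ((d + c * z)\<^sup>2)"]) simp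
  finally have "2 * ?A \<le> 2 * ?B" by (simp only: mult_2)
  then show ?thesis
    by (simp add: ennreal_mult_le_mult_iff)
qed

lemma gauss_quadratic: "(\<integral>\<^sup>+z. ennreal ((p + q * z)\<^sup>2) \<partial>gauss) = ennreal (p\<^sup>2 + q\<^sup>2)"
proof -
  have 2: "has_bochner_integral lborel (\<lambda>z. std_normal_density z * z\<^sup>2) 1"
    using std_normal_moment_even [of 1] by (simp add: numeral_2_eq_2)
  have 1: "has_bochner_integral lborel (\<lambda>z. std_normal_density z * z) 0"
    using std_normal_moment_odd [of 0] by simp
  have 0: "has_bochner_integral lborel std_normal_density 1"
    using std_normal_moment_even [of 0] by simp
  have "has_bochner_integral lborel (\<lambda>z. p\<^sup>2 * std_normal_density z
      + 2 * p * q * (std_normal_density z * z) + q\<^sup>2 * (std_normal_density z * z\<^sup>2)) (p\<^sup>2 * 1 + 2 * p * q * 0 + q\<^sup>2 * 1)"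
    by (intro has_bochner_integral_add has_bochner_integral_mult_right 0 1 2)
  then have H: "has_bochner_integral lborel (\<lambda>z. std_normal_density z * (p + q * z)\<^sup>2) (p\<^sup>2 + q\<^sup>2)"
    by (simp add: power2_eq_square algebra_simps)
  have "(\<integral>\<^sup>+z. ennreal ((p + q * z)\<^sup>2) \<partial>gauss)
      = (\<integral>\<^sup>+z. ennreal (std_normal_density z * (p + q * z)\<^sup>2) \<partial>lborel)"
    by (subst nn_integral_gauss) (auto simp: ennreal_mult)
  also have "\<dots> = ennreal (p\<^sup>2 + q\<^sup>2)"
    using H by (subst nn_integral_eq_integral) (auto simp: has_bochner_integral_iff)
  finally show ?thesis .
qed

lemma gauss_fourth: "(\<integral>\<^sup>+z. ennreal (z ^ 4) \<partial>gauss) = 3"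
proof -
  have H: "has_bochner_integral lborel (\<lambda>z. std_normal_density z * z ^ 4) 3"
    using std_normal_moment_even [of 2] by (simp add: fact_numeral)
  have "(\<integral>\<^sup>+z. ennreal (z ^ 4) \<partial>gauss) = (\<integral>\<^sup>+z. ennreal (std_normal_density z * z ^ 4) \<partial>lborel)"
    by (subst nn_integral_gauss) (auto simp: ennreal_mult)
  also have "\<dots> = ennreal 3"
    using H by (subst nn_integral_eq_integral) (auto simp: has_bochner_integral_iff)
  finally show ?thesis by simp
qed

text \<open>
The integral is \<open>(1 - 2 u)\<^sup>-\<^sup>1\<^sup>/\<^sup>2\<close>, the moment generating function of a squared normal variable; a second
order bound for its logarithm is enough for the Chernoff argument below.
\<close>

lemma gauss_exp_square:
  assumes "0 \<le> u" "u \<le> 1 / 4"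
  shows "(\<integral>\<^sup>+z. ennreal (exp (u * z\<^sup>2)) \<partial>gauss) \<le> ennreal (exp (u + 4 * u\<^sup>2))"
proof -
  define v where "v = 1 - 2 * u"
  have v: "v > 0" "v \<ge> 1/2" using assms by (auto simp: v_def)
  have "(\<integral>\<^sup>+z. ennreal (exp (u * z\<^sup>2)) \<partial>gauss)
      = (\<integral>\<^sup>+z. ennreal (1 / sqrt v) * ennreal (normal_density 0 (1 / sqrt v) z) \<partial>lborel)"
  proof (subst nn_integral_gauss, simp, intro nn_integral_cong)
    fix z
    have "std_normal_density z * exp (u * z\<^sup>2) = 1 / sqrt (2 * pi) * exp (- (z\<^sup>2 / 2) + u * z\<^sup>2)"
      by (simp add: std_normal_density_def exp_add [symmetric])
    also have "- (z\<^sup>2 / 2) + u * z\<^sup>2 = - (z\<^sup>2 * v) / 2"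
      by (simp add: v_def field_simps)
    also have "1 / sqrt (2 * pi) * exp (- (z\<^sup>2 * v) / 2) = 1 / sqrt v * normal_density 0 (1 / sqrt v) z"
      using v by (simp add: normal_density_def real_sqrt_mult real_sqrt_divide power_divide)
    finally have *: "std_normal_density z * exp (u * z\<^sup>2) = 1 / sqrt v * normal_density 0 (1 / sqrt v) z" .
    then show "ennreal (std_normal_density z) * ennreal (exp (u * z\<^sup>2))
        = ennreal (1 / sqrt v) * ennreal (normal_density 0 (1 / sqrt v) z)"
      using v by (metis ennreal_mult' less_imp_le normal_density_nonneg real_sqrt_gt_zero zero_le_divide_1_iff)
  qed
  also have "\<dots> = ennreal (1 / sqrt v) * (\<integral>\<^sup>+z. ennreal (normal_density 0 (1 / sqrt v) z) \<partial>lborel)"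
    by (rule nn_integral_cmult) simp
  also have "(\<integral>\<^sup>+z. ennreal (normal_density 0 (1 / sqrt v) z) \<partial>lborel) = 1"
    using v by (subst nn_integral_eq_integral) auto
  also have "ennreal (1 / sqrt v) * 1 \<le> ennreal (exp (u + 4 * u\<^sup>2))"
  proof -
    have "- (2 * u) - 2 * (2 * u)\<^sup>2 \<le> ln v"
      unfolding v_def using assms by (intro ln_one_minus_pos_lower_bound) auto
    then have "- (ln v / 2) \<le> u + 4 * u\<^sup>2" by (simp add: power_mult_distrib)
    moreover have "1 / sqrt v = exp (- (ln v / 2))"
      using v by (simp add: exp_minus ln_sqrt[symmetric] inverse_eq_divide)
    ultimately show ?thesis by (simp add: ennreal_leI)
  qed
  finally show ?thesis .
qed

section \<open>Bayes risks in one dimension\<close>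

text \<open>
A lower bound for the Bayes risk of estimating \<open>u\<close>, distributed as \<open>\<pi>\<close>, from an observation with
noise level \<open>s\<close>. Quantifying over \<open>t\<close> avoids any reference to the Bayes estimator itself.
\<close>

definition bayes_risk_ge :: "real measure \<Rightarrow> real \<Rightarrow> real \<Rightarrow> bool" where
  "bayes_risk_ge \<pi> s \<rho> \<longleftrightarrow> (\<forall>t\<in>borel_measurable borel.
     ennreal \<rho> \<le> (\<integral>\<^sup>+u. (\<integral>\<^sup>+z. ennreal ((t (u + s * z) - u)\<^sup>2) \<partial>gauss) \<partial>\<pi>))"

definition centred_normal :: "real \<Rightarrow> real measure" where
  "centred_normal v = distr gauss borel (\<lambda>z. sqrt v * z)"

text \<open>
Bayes' formula, by completing the square in \<open>u\<close>: the posterior law of \<open>u\<close> is normal, and its variance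
\<open>w\<close> does not depend on the observation \<open>y\<close>.
\<close>

lemma normal_posterior:
  fixes v s y u :: real
  assumes "v > 0" "s > 0"
  defines "w \<equiv> v * s\<^sup>2 / (v + s\<^sup>2)"
  shows "normal_density 0 (sqrt v) u * normal_density u s y
    = normal_density 0 (sqrt (v + s\<^sup>2)) y * normal_density (v * y / (v + s\<^sup>2)) (sqrt w) u"
proof -
  have pos: "v + s\<^sup>2 > 0" "w > 0" using assms by (auto simp: w_def add_pos_pos)
  have e: "- u\<^sup>2 / (2 * v) + - (y - u)\<^sup>2 / (2 * s\<^sup>2)
      = - y\<^sup>2 / (2 * (v + s\<^sup>2)) + - (u - v * y / (v + s\<^sup>2))\<^sup>2 / (2 * w)"
  proof -
    have *: "(u - v * y / (v + s\<^sup>2)) = (u * (v + s\<^sup>2) - v * y) / (v + s\<^sup>2)"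
      using pos by (simp add: field_simps)
    have "u\<^sup>2 / v + (y - u)\<^sup>2 / s\<^sup>2 - y\<^sup>2 / (v + s\<^sup>2) = (u * (v + s\<^sup>2) - v * y)\<^sup>2 / ((v + s\<^sup>2) * (v * s\<^sup>2))"
      using assms(1,2) pos(1)
      by (simp add: divide_simps) (simp add: power2_eq_square algebra_simps)
    also have "\<dots> = (u - v * y / (v + s\<^sup>2))\<^sup>2 / w"
      unfolding * w_def using assms(1,2) pos(1) by (simp add: power_divide power2_eq_square)
    finally have "u\<^sup>2 / v + (y - u)\<^sup>2 / s\<^sup>2 - y\<^sup>2 / (v + s\<^sup>2) = (u - v * y / (v + s\<^sup>2))\<^sup>2 / w" .
    from arg_cong [OF this, of "\<lambda>a. - a / 2"] show ?thesis
      by (simp add: diff_divide_distrib add_divide_distrib ac_simps)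
  qed
  have k: "sqrt (2 * pi * v) * sqrt (2 * pi * s\<^sup>2) = sqrt (2 * pi * (v + s\<^sup>2)) * sqrt (2 * pi * w)"
  proof -
    have "2 * pi * v * (2 * pi * s\<^sup>2) = 2 * pi * (v + s\<^sup>2) * (2 * pi * w)"
      using pos(1) by (simp add: w_def)
    then show ?thesis by (metis real_sqrt_mult)
  qed
  have "normal_density 0 (sqrt v) u * normal_density u s y
      = 1 / (sqrt (2 * pi * v) * sqrt (2 * pi * s\<^sup>2)) * exp (- u\<^sup>2 / (2 * v) + - (y - u)\<^sup>2 / (2 * s\<^sup>2))"
    using assms(1) unfolding normal_density_def exp_add by simp
  also have "\<dots> = normal_density 0 (sqrt (v + s\<^sup>2)) y * normal_density (v * y / (v + s\<^sup>2)) (sqrt w) u"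
    unfolding e k unfolding normal_density_def exp_add using pos by simp
  finally show ?thesis .
qed

text \<open>
Once the posterior law is exposed by Fubini's theorem, the inner integral is the mean squared
distance of \<open>u\<close> from the number \<open>t y\<close>, which is never smaller than the posterior variance.
\<close>

lemma bayes_risk_normal:
  assumes v: "v > 0" and s: "s > 0"
  shows "bayes_risk_ge (centred_normal v) s (v * s\<^sup>2 / (v + s\<^sup>2))"
  unfolding bayes_risk_ge_def
proof
  fix t :: "real \<Rightarrow> real" assume [measurable]: "t \<in> borel_measurable borel"
  define w where "w = v * s\<^sup>2 / (v + s\<^sup>2)"
  have pos: "v + s\<^sup>2 > 0" "w > 0" using assms by (auto simp: w_def add_pos_pos)
  interpret gauss: prob_space gauss by (rule prob_space_gauss)
  let ?g = "\<lambda>u y. ennreal ((t y - u)\<^sup>2)"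
  have "(\<integral>\<^sup>+u. (\<integral>\<^sup>+z. ?g u (u + s * z) \<partial>gauss) \<partial>centred_normal v)
      = (\<integral>\<^sup>+x. (\<integral>\<^sup>+z. ?g (0 + sqrt v * x) (0 + sqrt v * x + s * z) \<partial>gauss) \<partial>gauss)"
    unfolding centred_normal_def by (subst nn_integral_distr) auto
  also have "\<dots> = (\<integral>\<^sup>+u. ennreal (normal_density 0 (sqrt v) u) * (\<integral>\<^sup>+z. ?g u (u + s * z) \<partial>gauss) \<partial>lborel)"
    using v by (subst nn_integral_gauss_affine [of _ "sqrt v" 0, symmetric]) auto
  also have "\<dots> = (\<integral>\<^sup>+u. (\<integral>\<^sup>+y. ennreal (normal_density 0 (sqrt v) u) * (ennreal (normal_density u s y) * ?g u y) \<partial>lborel) \<partial>lborel)"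
    using s by (subst nn_integral_gauss_affine) (auto simp: nn_integral_cmult)
  also have "\<dots> = (\<integral>\<^sup>+y. (\<integral>\<^sup>+u. ennreal (normal_density 0 (sqrt v) u) * (ennreal (normal_density u s y) * ?g u y) \<partial>lborel) \<partial>lborel)"
    by (rule lborel_pair.Fubini') (simp add: normal_density_def)
  also have "\<dots> = (\<integral>\<^sup>+y. ennreal (normal_density 0 (sqrt (v + s\<^sup>2)) y) *
      (\<integral>\<^sup>+u. ennreal (normal_density (v * y / (v + s\<^sup>2)) (sqrt w) u) * ?g u y \<partial>lborel) \<partial>lborel)"
    by (subst nn_integral_cmult [symmetric])
      (auto intro!: nn_integral_cong
        simp: mult.assoc[symmetric] ennreal_mult[symmetric] normal_posterior[OF v s] w_def)
  also have "\<dots> \<ge> (\<integral>\<^sup>+y. ennreal (normal_density 0 (sqrt (v + s\<^sup>2)) y) * ennreal w \<partial>lborel)"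
  proof (intro nn_integral_mono mult_left_mono)
    fix y
    define d where "d = v * y / (v + s\<^sup>2)"
    have "(\<integral>\<^sup>+u. ennreal (normal_density d (sqrt w) u) * ?g u y \<partial>lborel)
        = (\<integral>\<^sup>+z. ?g (d + sqrt w * z) y \<partial>gauss)"
      using pos by (subst nn_integral_gauss_affine) auto
    also have "\<dots> = (\<integral>\<^sup>+z. ennreal (((t y - d) + (- sqrt w) * z)\<^sup>2) \<partial>gauss)"
      by (simp add: algebra_simps)
    also have "\<dots> = ennreal ((t y - d)\<^sup>2 + w)"
      using pos by (subst gauss_quadratic) simp
    also have "\<dots> \<ge> ennreal w" by (rule ennreal_leI) simp
    finally show "ennreal w \<le> (\<integral>\<^sup>+u. ennreal (normal_density (v * y / (v + s\<^sup>2)) (sqrt w) u) * ?g u y \<partial>lborel)"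
      unfolding d_def .
  qed simp
  also have "(\<integral>\<^sup>+y. ennreal (normal_density 0 (sqrt (v + s\<^sup>2)) y) * ennreal w \<partial>lborel) = ennreal w"
    using pos by (subst nn_integral_multc) (auto simp: nn_integral_eq_integral)
  finally show "ennreal (v * s\<^sup>2 / (v + s\<^sup>2)) \<le> (\<integral>\<^sup>+u. (\<integral>\<^sup>+z. ?g u (u + s * z) \<partial>gauss) \<partial>centred_normal v)"
    unfolding w_def .
qed

lemma ennreal_diff_le_of_le_add:
  assumes "ennreal a \<le> Q + ennreal b" "b \<ge> 0"
  shows "ennreal (a - b) \<le> Q"
proof (cases Q)
  case (real q)
  then show ?thesis using assms by (auto simp: ennreal_plus[symmetric] ennreal_le_iff2 simp del: ennreal_plus)
qed simp

text \<open>
Outside \<open>[-L, L]\<close> one has \<open>z\<^sup>2 \<le> z\<^sup>4 / L\<^sup>2\<close>, and the fourth moment is 3.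
\<close>

lemma gauss_truncated_second_moment:
  assumes L: "L > 0"
  shows "ennreal (s\<^sup>2 * (1 - 3 / L\<^sup>2))
    \<le> (\<integral>\<^sup>+z. ennreal (std_normal_density z) * indicator {-L..L} z * ennreal (s\<^sup>2 * z\<^sup>2) \<partial>lborel)" (is "_ \<le> ?Q")
proof -
  have "ennreal (s\<^sup>2) = (\<integral>\<^sup>+z. ennreal ((0 + s * z)\<^sup>2) \<partial>gauss)"
    by (subst gauss_quadratic) simp
  also have "\<dots> = (\<integral>\<^sup>+z. ennreal (std_normal_density z) * ennreal (s\<^sup>2 * z\<^sup>2) \<partial>lborel)"
    by (subst nn_integral_gauss) (auto simp: power_mult_distrib)
  also have "\<dots> \<le> (\<integral>\<^sup>+z. ennreal (std_normal_density z) * indicator {-L..L} z * ennreal (s\<^sup>2 * z\<^sup>2)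
      + ennreal (s\<^sup>2 / L\<^sup>2) * (ennreal (std_normal_density z) * ennreal (z ^ 4)) \<partial>lborel)"
  proof (intro nn_integral_mono)
    fix z :: real
    show "ennreal (std_normal_density z) * ennreal (s\<^sup>2 * z\<^sup>2)
      \<le> ennreal (std_normal_density z) * indicator {-L..L} z * ennreal (s\<^sup>2 * z\<^sup>2)
      + ennreal (s\<^sup>2 / L\<^sup>2) * (ennreal (std_normal_density z) * ennreal (z ^ 4))"
    proof (cases "\<bar>z\<bar> \<le> L")
      case True
      then have "z \<in> {-L..L}" by auto
      then show ?thesis by (simp add: le_add_same_cancel1)
    next
      case False
      then have "L\<^sup>2 \<le> z\<^sup>2" using L by (metis abs_le_square_iff abs_of_pos linear)
      then have "L\<^sup>2 * z\<^sup>2 \<le> z ^ 4"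
        by (metis mult_right_mono numeral_Bit0 power_add zero_le_power2)
      then have "s\<^sup>2 * (L\<^sup>2 * z\<^sup>2) \<le> s\<^sup>2 * z ^ 4" by (intro mult_left_mono) auto
      then have "s\<^sup>2 * z\<^sup>2 \<le> s\<^sup>2 / L\<^sup>2 * z ^ 4"
        using L by (simp add: field_simps)
      then have "ennreal (s\<^sup>2 * z\<^sup>2) \<le> ennreal (s\<^sup>2 / L\<^sup>2 * z ^ 4)" by (rule ennreal_leI)
      then have "ennreal (std_normal_density z) * ennreal (s\<^sup>2 * z\<^sup>2)
          \<le> ennreal (std_normal_density z) * ennreal (s\<^sup>2 / L\<^sup>2 * z ^ 4)" by (rule mult_left_mono) simp
      also have "\<dots> = ennreal (s\<^sup>2 / L\<^sup>2) * (ennreal (std_normal_density z) * ennreal (z ^ 4))"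
        by (subst ennreal_mult') (auto simp: ac_simps)
      finally show ?thesis by (simp add: add_increasing)
    qed
  qed
  also have "\<dots> = ?Q + ennreal (s\<^sup>2 / L\<^sup>2) * (\<integral>\<^sup>+z. ennreal (std_normal_density z) * ennreal (z ^ 4) \<partial>lborel)"
    by (subst nn_integral_add) (auto simp: nn_integral_cmult)
  also have "(\<integral>\<^sup>+z. ennreal (std_normal_density z) * ennreal (z ^ 4) \<partial>lborel) = ennreal 3"
    by (subst nn_integral_gauss [symmetric]) (auto simp: gauss_fourth)
  also have "ennreal (s\<^sup>2 / L\<^sup>2) * ennreal 3 = ennreal (3 * s\<^sup>2 / L\<^sup>2)"
    by (subst ennreal_mult [symmetric]) (auto simp: ac_simps)
  finally have "ennreal (s\<^sup>2 - 3 * s\<^sup>2 / L\<^sup>2) \<le> ?Q"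
    by (rule ennreal_diff_le_of_le_add) simp
  then show ?thesis by (simp add: algebra_simps)
qed

text \<open>
If \<open>y\<close> is at distance at least \<open>L s\<close> from the ends of \<open>[-r, r]\<close>, the posterior density of \<open>u\<close> is, on
the window \<open>[y - L s, y + L s]\<close>, proportional to the noise density and hence symmetric about \<open>y\<close>.
No estimate beats the second moment of this window. The observations of that kind account for the
factor \<open>1 - L s / r\<close>.
\<close>

lemma bayes_risk_uniform:
  assumes r: "r > 0" and s: "s > 0" and L: "L > 0" "L * s \<le> r"
  shows "bayes_risk_ge (uniform_measure lborel {-r..r}) s ((1 - L * s / r) * (s\<^sup>2 * (1 - 3 / L\<^sup>2)))"
  unfolding bayes_risk_ge_def
proof
  fix t :: "real \<Rightarrow> real" assume [measurable]: "t \<in> borel_measurable borel"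
  interpret gauss: prob_space gauss by (rule prob_space_gauss)
  let ?\<phi> = "\<lambda>z. ennreal (std_normal_density z)"
  let ?Q = "\<integral>\<^sup>+z. ?\<phi> z * indicator {-L..L} z * ennreal (s\<^sup>2 * z\<^sup>2) \<partial>lborel"
  let ?g = "\<lambda>u y. ennreal ((t y - u)\<^sup>2)"
  let ?I = "(\<integral>\<^sup>+u. (\<integral>\<^sup>+z. ?g u (u + s * z) \<partial>gauss) * indicator {-r..r} u \<partial>lborel)"
  let ?R = "r - L * s"
  have "ennreal (2 * ?R) * ?Q = (\<integral>\<^sup>+y. ?Q * indicator {-?R..?R} y \<partial>lborel)"
    using L by (subst nn_integral_cmult_indicator) (auto simp: mult.commute)
  also have "\<dots> \<le> (\<integral>\<^sup>+y. (\<integral>\<^sup>+z. indicator {-?R..?R} y *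
      (?\<phi> z * indicator {-L..L} z * ?g (y - s * z) y) \<partial>lborel) \<partial>lborel)"
  proof (intro nn_integral_mono)
    fix y
    have "?Q \<le> (\<integral>\<^sup>+z. ?\<phi> z * indicator {-L..L} z * ennreal (((t y - y) + s * z)\<^sup>2) \<partial>lborel)"
      by (rule symmetric_quadratic_lower)
        (auto simp: indicator_def std_normal_density_def)
    also have "\<dots> = (\<integral>\<^sup>+z. ?\<phi> z * indicator {-L..L} z * ?g (y - s * z) y \<partial>lborel)"
      by (simp add: algebra_simps)
    finally show "?Q * indicator {-?R..?R} y \<le> (\<integral>\<^sup>+z. indicator {-?R..?R} y *
      (?\<phi> z * indicator {-L..L} z * ?g (y - s * z) y) \<partial>lborel)"
      by (subst nn_integral_cmult) (auto simp: mult.commute intro!: mult_left_mono)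
  qed
  also have "\<dots> \<le> (\<integral>\<^sup>+y. (\<integral>\<^sup>+z. ?\<phi> z * (?g (y - s * z) y * indicator {-r..r} (y - s * z)) \<partial>lborel) \<partial>lborel)"
  proof (intro nn_integral_mono)
    fix y z
    show "indicator {-?R..?R} y * (?\<phi> z * indicator {-L..L} z * ?g (y - s * z) y)
        \<le> ?\<phi> z * (?g (y - s * z) y * indicator {-r..r} (y - s * z))"
    proof (cases "y \<in> {-?R..?R} \<and> z \<in> {-L..L}")
      case True
      have "s * z \<le> s * L" "s * (- L) \<le> s * z"
        using True s mult_left_mono [of z L s] mult_left_mono [of "- L" z s] by auto
      then have "y - s * z \<in> {-r..r}" using True by (auto simp: mult.commute)
      then show ?thesis using True by simp
    qed (auto simp: indicator_def)
  qed
  also have "\<dots> = (\<integral>\<^sup>+z. (\<integral>\<^sup>+y. ?\<phi> z * (?g (y - s * z) y * indicator {-r..r} (y - s * z)) \<partial>lborel) \<partial>lborel)"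
    by (rule lborel_pair.Fubini') simp
  also have "\<dots> = (\<integral>\<^sup>+z. (\<integral>\<^sup>+u. ?\<phi> z * (?g u (u + s * z) * indicator {-r..r} u) \<partial>lborel) \<partial>lborel)"
  proof (rule nn_integral_cong)
    fix z
    show "(\<integral>\<^sup>+y. ?\<phi> z * (?g (y - s * z) y * indicator {-r..r} (y - s * z)) \<partial>lborel)
        = (\<integral>\<^sup>+u. ?\<phi> z * (?g u (u + s * z) * indicator {-r..r} u) \<partial>lborel)"
      by (subst nn_integral_real_affine [where c = 1 and t = "s * z"]) (auto simp: add.commute)
  qed
  also have "\<dots> = (\<integral>\<^sup>+u. (\<integral>\<^sup>+z. ?\<phi> z * (?g u (u + s * z) * indicator {-r..r} u) \<partial>lborel) \<partial>lborel)"
    by (rule lborel_pair.Fubini') simp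
  also have "\<dots> = ?I"
    by (intro nn_integral_cong, subst nn_integral_gauss)
       (auto simp: nn_integral_multc [symmetric] mult.assoc)
  finally have *: "ennreal (2 * ?R) * ?Q \<le> ?I" .
  have "ennreal ((1 - L * s / r) * (s\<^sup>2 * (1 - 3 / L\<^sup>2))) = ennreal (1 - L * s / r) * ennreal (s\<^sup>2 * (1 - 3 / L\<^sup>2))"
    using L r by (intro ennreal_mult') (simp add: field_simps)
  also have "\<dots> \<le> ennreal (1 - L * s / r) * ?Q"
    by (intro mult_left_mono gauss_truncated_second_moment L) simp
  also have "ennreal (1 - L * s / r) = ennreal (2 * ?R) / ennreal (2 * r)"
    using L r by (subst divide_ennreal) (auto simp: field_simps)
  also have "ennreal (2 * ?R) / ennreal (2 * r) * ?Q = ennreal (2 * ?R) * ?Q / ennreal (2 * r)"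
    by (simp only: divide_ennreal_def mult.assoc mult.commute mult.left_commute)
  also have "\<dots> \<le> ?I / ennreal (2 * r)"
    using * by (rule divide_right_mono_ennreal)
  also have "\<dots> = (\<integral>\<^sup>+u. (\<integral>\<^sup>+z. ?g u (u + s * z) \<partial>gauss) \<partial>uniform_measure lborel {-r..r})"
    using r by (subst nn_integral_uniform_measure) auto
  finally show "ennreal ((1 - L * s / r) * (s\<^sup>2 * (1 - 3 / L\<^sup>2)))
      \<le> (\<integral>\<^sup>+u. (\<integral>\<^sup>+z. ?g u (u + s * z) \<partial>gauss) \<partial>uniform_measure lborel {-r..r})" .
qed

section \<open>Product priors\<close>

definition observe :: "(nat \<Rightarrow> real) \<Rightarrow> (nat \<Rightarrow> real) \<Rightarrow> (nat \<Rightarrow> real) \<Rightarrow> (nat \<Rightarrow> real)" where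
  "observe s x z = (\<lambda>j\<in>{1..}. x j + s j * z j)"

definition noise :: "(nat \<Rightarrow> real) measure" where
  "noise = PiM {1..} (\<lambda>_. gauss)"

text \<open>
The priors below live on finitely many coordinates \<open>I\<close>; all the other coordinates of the parameter
are zero.
\<close>

definition zero_extend :: "nat set \<Rightarrow> (nat \<Rightarrow> real) \<Rightarrow> nat \<Rightarrow> real" where
  "zero_extend I x = (\<lambda>i. if i \<in> I then x i else 0)"

lemma sets_noise [measurable_cong]: "sets noise = sets (PiM {1..} (\<lambda>_. borel))"
  unfolding noise_def by (rule sets_PiM_cong) auto

lemma prob_space_noise: "prob_space noise"
  unfolding noise_def by (intro prob_space_PiM prob_space_gauss)

lemma measurable_observe [measurable]:
  "(\<lambda>z. observe s x z) \<in> measurable noise seq_space"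
  unfolding observe_def seq_space_def by measurable

lemma measurable_norm_sq_diff:
  assumes [measurable]: "T \<in> measurable seq_space seq_space"
  shows "(\<lambda>y. norm_sq (\<lambda>j. T y j - x j)) \<in> borel_measurable seq_space"
proof -
  have [measurable]: "(\<lambda>y. T y (Suc j)) \<in> borel_measurable seq_space" for j
    using assms unfolding seq_space_def
    by (rule measurable_compose) (rule measurable_component_singleton, simp)
  show ?thesis unfolding norm_sq_def by measurable
qed

lemma distr_noise:
  fixes \<xi> :: "nat \<Rightarrow> 'a \<Rightarrow> real"
  assumes "prob_space M" "prob_space.indep_vars M (\<lambda>_. borel) \<xi> {1..}"
    and dist: "\<And>j. j \<ge> 1 \<Longrightarrow> distributed M lborel (\<xi> j) (\<lambda>z. ennreal (std_normal_density z))"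
  shows "distr M (PiM {1..} (\<lambda>_. borel)) (\<lambda>\<omega>. \<lambda>j\<in>{1..}. \<xi> j \<omega>) = noise"
proof -
  interpret prob_space M by fact
  have rv: "\<xi> j \<in> borel_measurable M" if "j \<in> {1..}" for j
    using distributed_measurable [OF dist [of j]] that by simp
  have "distr M borel (\<xi> j) = gauss" if "j \<in> {1..}" for j
    using distributed_distr_eq_density [OF dist [of j]] that unfolding gauss_def
    by (metis atLeast_iff distr_cong sets_lborel)
  then have "PiM {1..} (\<lambda>j. distr M borel (\<xi> j)) = noise"
    unfolding noise_def by (intro PiM_cong) auto
  then show ?thesis
    using assms(2) rv by (subst (asm) indep_vars_iff_distr_eq_PiM') (auto simp: atLeast_def)
qed

text \<open>
The risk depends on the noise only through its law. Replacing the underlying probability space by a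
product of normal laws makes it possible to integrate one coordinate at a time.
\<close>

lemma risk_noise:
  fixes \<xi> :: "nat \<Rightarrow> 'a \<Rightarrow> real"
  assumes "prob_space M" "prob_space.indep_vars M (\<lambda>_. borel) \<xi> {1..}"
    and dist: "\<And>j. j \<ge> 1 \<Longrightarrow> distributed M lborel (\<xi> j) (\<lambda>z. ennreal (std_normal_density z))"
    and T: "T \<in> estimators"
  shows "risk M \<xi> \<sigma> \<epsilon> T x
    = (\<integral>\<^sup>+z. norm_sq (\<lambda>j. T (observe (\<lambda>j. \<epsilon> * \<sigma> j) x z) j - x j) \<partial>noise)"
proof -
  have rv: "\<xi> j \<in> borel_measurable M" if "j \<in> {1..}" for j
    using distributed_measurable [OF dist [of j]] that by simp
  have [measurable]: "(\<lambda>\<omega>. \<lambda>j\<in>{1..}. \<xi> j \<omega>) \<in> measurable M (PiM {1..} (\<lambda>_. borel))"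
    using rv by (intro measurable_restrict) auto
  have [measurable]: "(\<lambda>z. observe (\<lambda>j. \<epsilon> * \<sigma> j) x z) \<in> measurable (PiM {1..} (\<lambda>_. borel)) seq_space"
    using measurable_observe [of "\<lambda>j. \<epsilon> * \<sigma> j" x] by (subst (asm) measurable_cong_sets [OF sets_noise refl])
  have [measurable]: "(\<lambda>y. norm_sq (\<lambda>j. T y j - x j)) \<in> borel_measurable seq_space"
    using T unfolding estimators_def by (rule measurable_norm_sq_diff)
  have "observation \<xi> \<sigma> \<epsilon> x \<omega> = observe (\<lambda>j. \<epsilon> * \<sigma> j) x (\<lambda>j\<in>{1..}. \<xi> j \<omega>)" for \<omega>
    by (auto simp: observation_def observe_def)
  then have "risk M \<xi> \<sigma> \<epsilon> T x
      = (\<integral>\<^sup>+\<omega>. norm_sq (\<lambda>j. T (observe (\<lambda>j. \<epsilon> * \<sigma> j) x (\<lambda>j\<in>{1..}. \<xi> j \<omega>)) j - x j) \<partial>M)"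
    unfolding risk_def by simp
  also have "\<dots> = (\<integral>\<^sup>+z. norm_sq (\<lambda>j. T (observe (\<lambda>j. \<epsilon> * \<sigma> j) x z) j - x j)
      \<partial>distr M (PiM {1..} (\<lambda>_. borel)) (\<lambda>\<omega>. \<lambda>j\<in>{1..}. \<xi> j \<omega>))"
    by (rule nn_integral_distr [symmetric]) measurable
  also have "distr M (PiM {1..} (\<lambda>_. borel)) (\<lambda>\<omega>. \<lambda>j\<in>{1..}. \<xi> j \<omega>) = noise"
    using assms by (intro distr_noise) auto
  finally show ?thesis .
qed

lemma nn_integral_PiM_insert:
  assumes Q: "\<And>i. i \<in> insert j I \<Longrightarrow> prob_space (Q i)"
    and f [measurable]: "f \<in> borel_measurable (PiM (insert j I) Q)"
  shows "(\<integral>\<^sup>+x. f x \<partial>PiM (insert j I) Q) = (\<integral>\<^sup>+X. (\<integral>\<^sup>+u. f (X(j := u)) \<partial>Q j) \<partial>PiM I Q)"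
proof -
  interpret P: prob_space "PiM I Q" using Q by (intro prob_space_PiM) auto
  interpret Qj: prob_space "Q j" using Q by auto
  interpret pair_sigma_finite "Q j" "PiM I Q" ..
  have m [measurable]: "(\<lambda>(u, X). X(j := u)) \<in> measurable (Q j \<Otimes>\<^sub>M PiM I Q) (PiM (insert j I) Q)"
    by measurable
  have "(\<integral>\<^sup>+x. f x \<partial>PiM (insert j I) Q)
      = (\<integral>\<^sup>+x. f x \<partial>distr (Q j \<Otimes>\<^sub>M PiM I Q) (PiM (insert j I) Q) (\<lambda>(u, X). X(j := u)))"
    using Q by (subst distr_pair_PiM_eq_PiM) auto
  also have "\<dots> = (\<integral>\<^sup>+p. f ((\<lambda>(u, X). X(j := u)) p) \<partial>(Q j \<Otimes>\<^sub>M PiM I Q))"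
    by (rule nn_integral_distr) (use m f in auto)
  also have "\<dots> = (\<integral>\<^sup>+X. (\<integral>\<^sup>+u. f (X(j := u)) \<partial>Q j) \<partial>PiM I Q)"
    by (subst nn_integral_snd [symmetric]) auto
  finally show ?thesis .
qed

lemma measurable_observe_pair:
  assumes I: "I \<subseteq> {1..}" and \<pi>: "\<And>i. i \<in> I \<Longrightarrow> sets (\<pi> i) = sets borel"
  shows "(\<lambda>(x, z). observe s (zero_extend I x) z) \<in> measurable (PiM I \<pi> \<Otimes>\<^sub>M noise) seq_space"
proof -
  have [measurable_cong]: "sets (PiM I \<pi>) = sets (PiM I (\<lambda>_. borel))"
    using \<pi> by (intro sets_PiM_cong) auto
  have [measurable]: "(\<lambda>x. zero_extend I x j) \<in> borel_measurable (PiM I \<pi>)" for j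
    unfolding zero_extend_def by (cases "j \<in> I") auto
  show ?thesis unfolding observe_def seq_space_def case_prod_beta by measurable
qed

text \<open>
Under a product prior each coordinate is at least as hard to estimate as in the one-dimensional
problem: if all other coordinates of the parameter and of the noise are held fixed, \<open>\<tau>\<close> becomes an
estimator that sees only the observation number \<open>j\<close>. The weight \<open>h\<close> allows for conditioning on an
event that does not involve \<open>x j\<close>.
\<close>

lemma bayes_risk_product:
  assumes I: "I \<subseteq> {1..}" "j \<in> I"
    and \<pi>: "\<And>i. i \<in> I \<Longrightarrow> prob_space (\<pi> i)" "\<And>i. i \<in> I \<Longrightarrow> sets (\<pi> i) = sets borel"
    and \<rho>: "bayes_risk_ge (\<pi> j) (s j) \<rho>"
    and \<tau> [measurable]: "\<tau> \<in> borel_measurable seq_space"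
    and h [measurable]: "h \<in> borel_measurable (PiM I \<pi>)" and hj: "\<And>x u. h (x(j := u)) = h x"
  shows "ennreal \<rho> * (\<integral>\<^sup>+x. h x \<partial>PiM I \<pi>)
    \<le> (\<integral>\<^sup>+x. h x * (\<integral>\<^sup>+z. ennreal ((\<tau> (observe s (zero_extend I x) z) - x j)\<^sup>2) \<partial>noise) \<partial>PiM I \<pi>)"
proof -
  define I' K where "I' = I - {j}" and "K = {1..} - {j}"
  have I': "insert j I' = I" and K: "insert j K = {1..}" using I by (auto simp: I'_def K_def)
  define NK where "NK = PiM K (\<lambda>_. gauss)"
  interpret noise: prob_space noise by (rule prob_space_noise)
  interpret NK: prob_space NK unfolding NK_def by (intro prob_space_PiM prob_space_gauss)
  interpret g: prob_space gauss by (rule prob_space_gauss)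
  interpret pj: prob_space "\<pi> j" using \<pi> I by auto
  have [measurable_cong]: "sets (PiM I \<pi>) = sets (PiM I (\<lambda>_. borel))"
      "sets (PiM I' \<pi>) = sets (PiM I' (\<lambda>_. borel))" "sets NK = sets (PiM K (\<lambda>_. borel))"
      "sets (\<pi> j) = sets borel"
    using \<pi> I by (auto simp: NK_def I'_def intro!: sets_PiM_cong)
  note [measurable] = measurable_observe_pair [OF I(1) \<pi>(2)]
  let ?G = "\<lambda>x z. ennreal ((\<tau> (observe s (zero_extend I x) z) - x j)\<^sup>2)"
  have j [measurable]: "(\<lambda>x. x j) \<in> borel_measurable (PiM I \<pi>)"
    using I by measurable
  have obs [measurable]: "(\<lambda>p. observe s (zero_extend I (fst p)) (snd p)) \<in> measurable (PiM I \<pi> \<Otimes>\<^sub>M noise) seq_space"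
    using measurable_observe_pair [OF I(1) \<pi>(2)] by (simp add: case_prod_beta)
  have G: "(\<lambda>p. ?G (fst p) (snd p)) \<in> borel_measurable (PiM I \<pi> \<Otimes>\<^sub>M noise)"
    by measurable
  have split_noise: "(\<integral>\<^sup>+z. ?G x z \<partial>noise) = (\<integral>\<^sup>+Z. (\<integral>\<^sup>+v. ?G x (Z(j := v)) \<partial>gauss) \<partial>NK)"
    if "x \<in> space (PiM I \<pi>)" for x
  proof -
    have "?G x \<in> borel_measurable (PiM (insert j K) (\<lambda>_. gauss))"
      unfolding K using measurable_compose [OF measurable_Pair1' [OF that] G] by (simp add: noise_def)
    then show ?thesis
      unfolding NK_def using nn_integral_PiM_insert [of j K "\<lambda>_. gauss" "?G x"]
      by (simp add: K noise_def prob_space_gauss)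
  qed
  have inner: "ennreal \<rho> * h X \<le> (\<integral>\<^sup>+u. h (X(j := u)) * (\<integral>\<^sup>+z. ?G (X(j := u)) z \<partial>noise) \<partial>\<pi> j)"
    if X: "X \<in> space (PiM I' \<pi>)" for X
  proof -
    have up [measurable]: "(\<lambda>u. X(j := u)) \<in> measurable (\<pi> j) (PiM I \<pi>)"
      using measurable_compose [OF measurable_Pair1' [OF X] measurable_add_dim [where I = I' and M = \<pi> and i = j]] by (simp add: I')
    have sp: "X(j := u) \<in> space (PiM I \<pi>)" for u
      using measurable_space [OF up, of u] sets_eq_imp_space_eq [OF \<pi>(2) [OF I(2)]] by simp
    have upN [measurable]: "(\<lambda>p. (fst p)(j := snd p)) \<in> measurable (NK \<Otimes>\<^sub>M gauss) noise"
      using measurable_add_dim [where I = K and M = "\<lambda>_. gauss" and i = j] unfolding K NK_def noise_def by (simp add: case_prod_beta')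
    have GG: "(\<lambda>p. ?G (X(j := fst p)) ((fst (snd p))(j := snd (snd p)))) \<in> borel_measurable (\<pi> j \<Otimes>\<^sub>M (NK \<Otimes>\<^sub>M gauss))"
      using measurable_compose [OF _ G, of "\<lambda>p. (X(j := fst p), (fst (snd p))(j := snd (snd p)))"] by simp
    have GG1: "(\<lambda>((u, Z), v). ?G (X(j := u)) (Z(j := v))) \<in> borel_measurable ((\<pi> j \<Otimes>\<^sub>M NK) \<Otimes>\<^sub>M gauss)"
      using measurable_compose [OF _ GG, of "\<lambda>p. (fst (fst p), (snd (fst p), snd p))"] by (simp add: case_prod_beta')
    have GG2: "(\<lambda>(u, Z). \<integral>\<^sup>+v. ?G (X(j := u)) (Z(j := v)) \<partial>gauss) \<in> borel_measurable (\<pi> j \<Otimes>\<^sub>M NK)"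
      using g.borel_measurable_nn_integral [of "\<lambda>p v. ?G (X(j := fst p)) ((snd p)(j := v))" "\<pi> j \<Otimes>\<^sub>M NK"] GG1
      by (simp add: case_prod_beta')
    have GG3: "(\<lambda>u. \<integral>\<^sup>+Z. (\<integral>\<^sup>+v. ?G (X(j := u)) (Z(j := v)) \<partial>gauss) \<partial>NK) \<in> borel_measurable (\<pi> j)"
      by (rule NK.borel_measurable_nn_integral [OF GG2])
    interpret pair_sigma_finite "\<pi> j" NK ..
    have "(\<integral>\<^sup>+u. h (X(j := u)) * (\<integral>\<^sup>+z. ?G (X(j := u)) z \<partial>noise) \<partial>\<pi> j)
        = (\<integral>\<^sup>+u. h X * (\<integral>\<^sup>+Z. (\<integral>\<^sup>+v. ?G (X(j := u)) (Z(j := v)) \<partial>gauss) \<partial>NK) \<partial>\<pi> j)"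
      unfolding hj split_noise [OF sp] ..
    also have "\<dots> = h X * (\<integral>\<^sup>+u. (\<integral>\<^sup>+Z. (\<integral>\<^sup>+v. ?G (X(j := u)) (Z(j := v)) \<partial>gauss) \<partial>NK) \<partial>\<pi> j)"
      by (rule nn_integral_cmult [OF GG3])
    finally have eq: "(\<integral>\<^sup>+u. h (X(j := u)) * (\<integral>\<^sup>+z. ?G (X(j := u)) z \<partial>noise) \<partial>\<pi> j)
        = h X * (\<integral>\<^sup>+u. (\<integral>\<^sup>+Z. (\<integral>\<^sup>+v. ?G (X(j := u)) (Z(j := v)) \<partial>gauss) \<partial>NK) \<partial>\<pi> j)" .
    have "(\<integral>\<^sup>+u. (\<integral>\<^sup>+Z. (\<integral>\<^sup>+v. ?G (X(j := u)) (Z(j := v)) \<partial>gauss) \<partial>NK) \<partial>\<pi> j)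
        = (\<integral>\<^sup>+Z. (\<integral>\<^sup>+u. (\<integral>\<^sup>+v. ?G (X(j := u)) (Z(j := v)) \<partial>gauss) \<partial>\<pi> j) \<partial>NK)"
      by (rule Fubini' [OF GG2, symmetric])
    also have "\<dots> \<ge> (\<integral>\<^sup>+Z. ennreal \<rho> \<partial>NK)"
    proof (rule nn_integral_mono)
      fix Z assume "Z \<in> space NK"
      define w where "w = observe s (zero_extend I X) Z"
      define t where "t = (\<lambda>y. \<tau> (w(j := y)))"
      have obs_upd: "observe s (zero_extend I (X(j := u))) (Z(j := v)) = w(j := u + s j * v)" for u v
        using I by (auto simp: observe_def w_def zero_extend_def fun_eq_iff restrict_def)
      have "w \<in> space seq_space"
        unfolding w_def observe_def seq_space_def by (simp add: space_PiM)
      then have "(\<lambda>y. w(j := y)) \<in> measurable borel seq_space"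
        unfolding seq_space_def using I by (intro measurable_fun_upd [where J = "{1..}"]) auto
      then have "t \<in> borel_measurable borel"
        unfolding t_def by measurable
      then have "ennreal \<rho> \<le> (\<integral>\<^sup>+u. (\<integral>\<^sup>+v. ennreal ((t (u + s j * v) - u)\<^sup>2) \<partial>gauss) \<partial>\<pi> j)"
        using \<rho> by (simp add: bayes_risk_ge_def)
      also have "\<dots> = (\<integral>\<^sup>+u. (\<integral>\<^sup>+v. ?G (X(j := u)) (Z(j := v)) \<partial>gauss) \<partial>\<pi> j)"
        by (simp add: obs_upd t_def)
      finally show "ennreal \<rho> \<le> (\<integral>\<^sup>+u. (\<integral>\<^sup>+v. ?G (X(j := u)) (Z(j := v)) \<partial>gauss) \<partial>\<pi> j)" .
    qed
    finally have "ennreal \<rho> \<le> (\<integral>\<^sup>+u. (\<integral>\<^sup>+Z. (\<integral>\<^sup>+v. ?G (X(j := u)) (Z(j := v)) \<partial>gauss) \<partial>NK) \<partial>\<pi> j)"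
      by (simp only: nn_integral_const NK.emeasure_space_1 mult_1_right)
    then show ?thesis unfolding eq by (subst mult.commute) (rule mult_left_mono, simp_all only: zero_le)
  qed
  have Gx [measurable]: "(\<lambda>x. \<integral>\<^sup>+z. ?G x z \<partial>noise) \<in> borel_measurable (PiM I \<pi>)"
    using G by (intro noise.borel_measurable_nn_integral) (simp add: case_prod_beta')
  have "ennreal \<rho> * (\<integral>\<^sup>+x. h x \<partial>PiM I \<pi>) = (\<integral>\<^sup>+x. ennreal \<rho> * h x \<partial>PiM (insert j I') \<pi>)"
    unfolding I' by (rule nn_integral_cmult [symmetric]) measurable
  also have "\<dots> = (\<integral>\<^sup>+X. (\<integral>\<^sup>+u. ennreal \<rho> * h (X(j := u)) \<partial>\<pi> j) \<partial>PiM I' \<pi>)"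
    using \<pi>(1) by (subst nn_integral_PiM_insert) (auto simp: I')
  also have "\<dots> = (\<integral>\<^sup>+X. ennreal \<rho> * h X \<partial>PiM I' \<pi>)"
    by (simp add: hj pj.emeasure_space_1)
  also have "\<dots> \<le> (\<integral>\<^sup>+X. (\<integral>\<^sup>+u. h (X(j := u)) * (\<integral>\<^sup>+z. ?G (X(j := u)) z \<partial>noise) \<partial>\<pi> j) \<partial>PiM I' \<pi>)"
    by (rule nn_integral_mono) (rule inner)
  also have "\<dots> = (\<integral>\<^sup>+x. h x * (\<integral>\<^sup>+z. ?G x z \<partial>noise) \<partial>PiM (insert j I') \<pi>)"
    using \<pi>(1) by (subst nn_integral_PiM_insert) (auto simp: I')
  finally show ?thesis unfolding I' .
qed

section \<open>The ball and its extremal point\<close>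

definition spectrum :: "real \<Rightarrow> real \<Rightarrow> nat \<Rightarrow> real" where
  "spectrum \<alpha> P0 j = 2 * \<alpha> * P0 * real j powr (- 2 * \<alpha> - 1)"

definition tail_bound :: "real \<Rightarrow> real \<Rightarrow> nat \<Rightarrow> real" where
  "tail_bound \<alpha> P0 k = P0 * real k powr (- 2 * \<alpha>)"

text \<open>
The squared coordinates of the point of the ball at which every tail constraint is an equality.
They agree with \<^const>\<open>spectrum\<close> to leading order, but telescope exactly.
\<close>

definition extremal :: "real \<Rightarrow> real \<Rightarrow> nat \<Rightarrow> real" where
  "extremal \<alpha> P0 j = tail_bound \<alpha> P0 j - tail_bound \<alpha> P0 (Suc j)"

lemma extremal_mvt:
  assumes "\<alpha> > 0" "P0 > 0" "j \<ge> 1"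
  obtains z where "real j < z" "z < real j + 1" "extremal \<alpha> P0 j = 2 * \<alpha> * P0 * z powr (- 2 * \<alpha> - 1)"
proof -
  have "\<exists>z. real j < z \<and> z < real j + 1 \<and>
      (real j + 1) powr (- 2 * \<alpha>) - real j powr (- 2 * \<alpha>) = (real j + 1 - real j) * ((- 2 * \<alpha>) * z powr (- 2 * \<alpha> - 1))"
  proof (rule MVT2)
    fix x assume "real j \<le> x" "x \<le> real j + 1"
    then have "x > 0" using assms by linarith
    then show "((\<lambda>x. x powr (- 2 * \<alpha>)) has_real_derivative (- 2 * \<alpha>) * x powr (- 2 * \<alpha> - 1)) (at x)"
      by (rule has_real_derivative_powr)
  qed simp
  then obtain z where z: "real j < z" "z < real j + 1"
    "(real j + 1) powr (- 2 * \<alpha>) - real j powr (- 2 * \<alpha>) = (- 2 * \<alpha>) * z powr (- 2 * \<alpha> - 1)" by auto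
  have "extremal \<alpha> P0 j = - P0 * ((real j + 1) powr (- 2 * \<alpha>) - real j powr (- 2 * \<alpha>))"
    by (simp add: extremal_def tail_bound_def algebra_simps)
  also have "\<dots> = 2 * \<alpha> * P0 * z powr (- 2 * \<alpha> - 1)" unfolding z(3) by simp
  finally show ?thesis using that z by blast
qed

lemma spectrum_pos: "\<alpha> > 0 \<Longrightarrow> P0 > 0 \<Longrightarrow> j \<ge> 1 \<Longrightarrow> spectrum \<alpha> P0 j > 0"
  by (simp add: spectrum_def)

lemma extremal_pos:
  assumes "\<alpha> > 0" "P0 > 0" "j \<ge> 1"
  shows "extremal \<alpha> P0 j > 0"
  using assms by (rule extremal_mvt) (use assms in auto)

lemma extremal_le_spectrum:
  assumes "\<alpha> > 0" "P0 > 0" "j \<ge> 1"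
  shows "extremal \<alpha> P0 j \<le> spectrum \<alpha> P0 j"
proof -
  obtain z where z: "real j < z" "z < real j + 1" "extremal \<alpha> P0 j = 2 * \<alpha> * P0 * z powr (- 2 * \<alpha> - 1)"
    using extremal_mvt assms by blast
  have "z powr (- 2 * \<alpha> - 1) \<le> real j powr (- 2 * \<alpha> - 1)"
    using z assms by (intro powr_mono2') auto
  then show ?thesis using assms by (simp add: z(3) spectrum_def)
qed

lemma extremal_ge_spectrum:
  assumes "\<alpha> > 0" "P0 > 0" "j \<ge> 1"
  shows "spectrum \<alpha> P0 j * (1 + 1 / real j) powr (- 2 * \<alpha> - 1) \<le> extremal \<alpha> P0 j"
proof -
  obtain z where z: "real j < z" "z < real j + 1" "extremal \<alpha> P0 j = 2 * \<alpha> * P0 * z powr (- 2 * \<alpha> - 1)"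
    using extremal_mvt assms by blast
  have "real j powr (- 2 * \<alpha> - 1) * (1 + 1 / real j) powr (- 2 * \<alpha> - 1) = (real j + 1) powr (- 2 * \<alpha> - 1)"
  proof -
    have "real j + 1 = real j * (1 + 1 / real j)" using assms by (simp add: distrib_left)
    then show ?thesis by (simp only: powr_mult)
  qed
  also have "\<dots> \<le> z powr (- 2 * \<alpha> - 1)"
    using z assms by (intro powr_mono2') auto
  finally show ?thesis using assms by (simp add: z(3) spectrum_def mult.assoc)
qed

lemma extremal_ge_half_power:
  assumes "\<alpha> > 0" "P0 > 0" "j \<ge> 1"
  shows "spectrum \<alpha> P0 j * 2 powr (- 2 * \<alpha> - 1) \<le> extremal \<alpha> P0 j"
proof -
  have "2 powr (- 2 * \<alpha> - 1) \<le> (1 + 1 / real j) powr (- 2 * \<alpha> - 1)"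
    using assms by (intro powr_mono2') (auto simp: add_pos_nonneg)
  then have "spectrum \<alpha> P0 j * 2 powr (- 2 * \<alpha> - 1) \<le> spectrum \<alpha> P0 j * (1 + 1 / real j) powr (- 2 * \<alpha> - 1)"
    using spectrum_pos [OF assms] by (intro mult_left_mono) auto
  then show ?thesis using extremal_ge_spectrum [OF assms] by linarith
qed

lemma eventually_extremal_ge:
  assumes "\<alpha> > 0" "P0 > 0" "\<kappa> > 0"
  shows "\<forall>\<^sub>F j in sequentially. (1 - \<kappa>) * spectrum \<alpha> P0 j \<le> extremal \<alpha> P0 j"
proof -
  have "(\<lambda>j. (1 + 1 / real j) powr (- 2 * \<alpha> - 1)) \<longlonglongrightarrow> (1 + 0) powr (- 2 * \<alpha> - 1)"
    by (intro tendsto_intros lim_1_over_n) auto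
  then have "\<forall>\<^sub>F j in sequentially. (1 + 1 / real j) powr (- 2 * \<alpha> - 1) > 1 - \<kappa>"
    by (rule order_tendstoD) (use assms in auto)
  moreover have "\<forall>\<^sub>F j in sequentially. j \<ge> (1::nat)" by (rule eventually_ge_at_top)
  ultimately show ?thesis
  proof eventually_elim
    case (elim j)
    have "spectrum \<alpha> P0 j * (1 - \<kappa>) \<le> spectrum \<alpha> P0 j * (1 + 1 / real j) powr (- 2 * \<alpha> - 1)"
      using elim spectrum_pos [of \<alpha> P0 j] assms by (intro mult_left_mono) auto
    then show ?case using extremal_ge_spectrum [of \<alpha> P0 j] assms elim by (simp add: mult.commute)
  qed
qed

lemma tail_bound_pos: "P0 > 0 \<Longrightarrow> k \<ge> 1 \<Longrightarrow> tail_bound \<alpha> P0 k > 0"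
  by (simp add: tail_bound_def)

lemma sum_extremal:
  "k \<le> N \<Longrightarrow> (\<Sum>j=k..<N. extremal \<alpha> P0 j) = tail_bound \<alpha> P0 k - tail_bound \<alpha> P0 N"
  unfolding extremal_def using sum_Suc_diff' [of k N "tail_bound \<alpha> P0"]
  by (simp add: sum_subtractf)

lemma tail_bound_tendsto:
  assumes "\<alpha> > 0" shows "tail_bound \<alpha> P0 \<longlonglongrightarrow> 0"
proof -
  have "(\<lambda>k. real k powr (- 2 * \<alpha>)) \<longlonglongrightarrow> 0"
    using assms by (intro tendsto_neg_powr filterlim_real_sequentially) auto
  then show ?thesis unfolding tail_bound_def by (rule tendsto_mult_right_zero)
qed

lemma B_memI:
  assumes "P0 > 0"
    and zero: "\<And>j. j > J \<Longrightarrow> x j = 0"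
    and tail: "\<And>k. 1 \<le> k \<Longrightarrow> k \<le> J \<Longrightarrow> (\<Sum>j=k..J. (x j)\<^sup>2) \<le> tail_bound \<alpha> P0 k"
  shows "x \<in> B \<alpha> P0"
  unfolding B_def mem_Collect_eq
proof (rule SUP_least)
  fix k :: nat assume k: "k \<in> {1..}"
  have "(\<Sum>i. ennreal ((x (k + i))\<^sup>2)) = (\<Sum>i<Suc J - k. ennreal ((x (k + i))\<^sup>2))"
    by (rule suminf_finite) (auto simp: zero)
  also have "\<dots> = ennreal (\<Sum>i<Suc J - k. (x (k + i))\<^sup>2)"
    by (simp add: sum_ennreal)
  also have "(\<Sum>i<Suc J - k. (x (k + i))\<^sup>2) = (\<Sum>j=k..J. (x j)\<^sup>2)"
    by (rule sum.reindex_bij_witness [of _ "\<lambda>j. j - k" "\<lambda>i. k + i"]) auto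
  finally have *: "(\<Sum>i. ennreal ((x (k + i))\<^sup>2)) = ennreal (\<Sum>j=k..J. (x j)\<^sup>2)" .
  have "(\<Sum>j=k..J. (x j)\<^sup>2) \<le> tail_bound \<alpha> P0 k"
    using tail k tail_bound_pos [OF \<open>P0 > 0\<close>, of k \<alpha>] by (cases "k \<le> J") auto
  then have "real k powr (2 * \<alpha>) * (\<Sum>j=k..J. (x j)\<^sup>2) \<le> real k powr (2 * \<alpha>) * tail_bound \<alpha> P0 k"
    by (intro mult_left_mono) auto
  also have "\<dots> = P0" using k by (simp add: tail_bound_def powr_minus)
  finally show "ennreal (real k powr (2 * \<alpha>)) * (\<Sum>i. ennreal ((x (k + i))\<^sup>2)) \<le> ennreal P0"
    unfolding * by (simp add: ennreal_mult' [symmetric] ennreal_leI)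
qed

lemma B_tail_le:
  assumes "P0 > 0" "x \<in> B \<alpha> P0" "k \<ge> 1"
  shows "(\<Sum>j=k..N. (x j)\<^sup>2) \<le> tail_bound \<alpha> P0 k"
proof -
  have "ennreal (\<Sum>j=k..N. (x j)\<^sup>2) = (\<Sum>i<Suc N - k. ennreal ((x (k + i))\<^sup>2))"
    by (subst sum_ennreal, simp, rule arg_cong [where f = ennreal],
        rule sum.reindex_bij_witness [of _ "\<lambda>i. k + i" "\<lambda>j. j - k"]) auto
  also have "\<dots> \<le> (\<Sum>i. ennreal ((x (k + i))\<^sup>2))"
    by (intro sum_le_suminf) auto
  finally have "ennreal (real k powr (2 * \<alpha>)) * ennreal (\<Sum>j=k..N. (x j)\<^sup>2)
      \<le> ennreal (real k powr (2 * \<alpha>)) * (\<Sum>i. ennreal ((x (k + i))\<^sup>2))"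
    by (rule mult_left_mono) simp
  also have "\<dots> \<le> ennreal P0"
    using assms(2,3) unfolding B_def mem_Collect_eq SUP_le_iff by auto
  finally have "real k powr (2 * \<alpha>) * (\<Sum>j=k..N. (x j)\<^sup>2) \<le> P0"
    using \<open>P0 > 0\<close> by (simp add: ennreal_mult' [symmetric])
  then show ?thesis using assms(3) by (simp add: tail_bound_def powr_minus field_simps)
qed

text \<open>
A nonnegative nondecreasing weight is a nonnegative combination of the indicators of the tails
\<open>{i..N}\<close>, and on these \<open>u\<close> is dominated by \<open>v\<close>.
\<close>

lemma abel_majorization:
  fixes u v w :: "nat \<Rightarrow> real"
  assumes "k \<le> N"
    and w: "w k \<ge> 0" "\<And>j. k \<le> j \<Longrightarrow> j < N \<Longrightarrow> w j \<le> w (Suc j)"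
    and tail: "\<And>i. k \<le> i \<Longrightarrow> i \<le> N \<Longrightarrow> (\<Sum>j=i..N. u j) \<le> (\<Sum>j=i..N. v j)"
  shows "(\<Sum>j=k..N. w j * u j) \<le> (\<Sum>j=k..N. w j * v j)"
proof -
  have "w k * (\<Sum>j=k..N. v j - u j) \<le> (\<Sum>j=k..N. w j * (v j - u j))"
    using \<open>k \<le> N\<close> w(2) tail
  proof (induction k rule: inc_induct)
    case (step k)
    let ?D = "\<Sum>j=Suc k..N. v j - u j"
    have "?D \<ge> 0" using step.prems(2) [of "Suc k"] step.hyps by (simp add: sum_subtractf)
    then have "w k * ?D \<le> w (Suc k) * ?D" using step.prems(1) [of k] step.hyps by (intro mult_right_mono) auto
    also have "\<dots> \<le> (\<Sum>j=Suc k..N. w j * (v j - u j))" using step by auto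
    finally show ?case using step.hyps by (simp add: sum.atLeast_Suc_atMost distrib_left)
  qed simp
  moreover have "0 \<le> w k * (\<Sum>j=k..N. v j - u j)"
    using w(1) tail [of k] \<open>k \<le> N\<close> by (simp add: sum_subtractf)
  ultimately show ?thesis by (simp add: right_diff_distrib sum_subtractf)
qed

section \<open>Energy of independent normal coordinates\<close>

lemma sets_centred_normal [simp, measurable_cong]: "sets (centred_normal v) = sets borel"
  by (simp add: centred_normal_def)

lemma prob_space_centred_normal: "prob_space (centred_normal v)"
  unfolding centred_normal_def by (intro prob_space.prob_space_distr prob_space_gauss) simp

lemma nn_integral_centred_normal:
  assumes [measurable]: "f \<in> borel_measurable borel"
  shows "(\<integral>\<^sup>+u. f u \<partial>centred_normal v) = (\<integral>\<^sup>+z. f (sqrt v * z) \<partial>gauss)"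
  unfolding centred_normal_def by (subst nn_integral_distr) auto

lemma centred_normal_exp_square:
  assumes "0 \<le> v" "0 \<le> t" "t * v \<le> 1 / 4"
  shows "(\<integral>\<^sup>+u. ennreal (exp (t * u\<^sup>2)) \<partial>centred_normal v) \<le> ennreal (exp (t * v + 4 * t\<^sup>2 * v\<^sup>2))"
proof -
  have "(\<integral>\<^sup>+u. ennreal (exp (t * u\<^sup>2)) \<partial>centred_normal v) = (\<integral>\<^sup>+z. ennreal (exp (t * v * z\<^sup>2)) \<partial>gauss)"
    using assms by (subst nn_integral_centred_normal) (auto simp: power_mult_distrib mult.assoc)
  also have "\<dots> \<le> ennreal (exp (t * v + 4 * (t * v)\<^sup>2))"
    using assms by (intro gauss_exp_square) auto
  finally show ?thesis by (simp add: power_mult_distrib mult.assoc)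
qed

lemma centred_normal_fourth:
  assumes "0 \<le> v"
  shows "(\<integral>\<^sup>+u. ennreal (u ^ 4) \<partial>centred_normal v) = ennreal (3 * v\<^sup>2)"
proof -
  have "sqrt v ^ 4 = v\<^sup>2" using assms by (simp add: power4_eq_xxxx power2_eq_square)
  then have "(\<integral>\<^sup>+u. ennreal (u ^ 4) \<partial>centred_normal v) = (\<integral>\<^sup>+z. ennreal (v\<^sup>2) * ennreal (z ^ 4) \<partial>gauss)"
    using assms by (subst nn_integral_centred_normal) (auto simp: power_mult_distrib ennreal_mult)
  also have "\<dots> = ennreal (v\<^sup>2) * ennreal 3"
    by (subst nn_integral_cmult) (auto simp: gauss_fourth)
  finally show ?thesis by (simp add: ennreal_mult [symmetric] mult.commute del: ennreal_numeral)
qed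

lemma nn_integral_PiM_component:
  assumes "\<And>i. i \<in> I \<Longrightarrow> prob_space (\<pi> i)" "i \<in> I" "f \<in> borel_measurable (\<pi> i)"
  shows "(\<integral>\<^sup>+x. f (x i) \<partial>PiM I \<pi>) = (\<integral>\<^sup>+u. f u \<partial>\<pi> i)"
proof -
  have "(\<integral>\<^sup>+u. f u \<partial>distr (PiM I \<pi>) (\<pi> i) (\<lambda>x. x i)) = (\<integral>\<^sup>+x. f (x i) \<partial>PiM I \<pi>)"
    using assms by (intro nn_integral_distr) auto
  then show ?thesis using assms by (simp add: distr_PiM_component)
qed

text \<open>
Markov's inequality for \<open>exp (t S)\<close>, where \<open>S\<close> is the weighted chi-square sum. The exponential moment
factorises over the coordinates.
\<close>

lemma chernoff_weighted_chi_square: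
  assumes I: "finite I" "K \<subseteq> I"
    and \<pi>: "\<And>i. i \<in> I \<Longrightarrow> prob_space (\<pi> i)" "\<And>i. i \<in> I \<Longrightarrow> sets (\<pi> i) = sets borel"
    and K: "\<And>i. i \<in> K \<Longrightarrow> \<pi> i = centred_normal (v i)" "\<And>i. i \<in> K \<Longrightarrow> 0 \<le> v i"
    and t: "0 \<le> t" "\<And>i. i \<in> K \<Longrightarrow> t * v i \<le> 1 / 4"
  shows "emeasure (PiM I \<pi>) {x \<in> space (PiM I \<pi>). c < (\<Sum>i\<in>K. (x i)\<^sup>2)}
    \<le> ennreal (exp (t * (\<Sum>i\<in>K. v i) + 4 * t\<^sup>2 * (\<Sum>i\<in>K. (v i)\<^sup>2) - t * c))"
proof -
  \<comment> \<open>The product lemma asks for a measure at every index, also outside \<open>I\<close>.\<close>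
  define \<pi>' where "\<pi>' i = (if i \<in> I then \<pi> i else gauss)" for i
  have "prob_space (\<pi>' i)" for i
    using \<pi>(1) [of i] prob_space_gauss by (simp add: \<pi>'_def)
  then interpret product_sigma_finite \<pi>'
    unfolding product_sigma_finite_def by (blast intro: prob_space_imp_sigma_finite)
  have W: "PiM I \<pi> = PiM I \<pi>'" by (intro PiM_cong) (auto simp: \<pi>'_def)
  have "finite K" using I finite_subset by blast
  have [measurable_cong]: "sets (PiM I \<pi>) = sets (PiM I (\<lambda>_. borel))"
    using \<pi> by (intro sets_PiM_cong) auto
  have [measurable]: "(\<lambda>x. x i) \<in> borel_measurable (PiM I \<pi>)" if "i \<in> K" for i
  proof -
    have "i \<in> I" using that I by auto
    then show ?thesis by measurable
  qed
  define f where "f i u = (if i \<in> K then ennreal (exp (t * u\<^sup>2)) else 1)" for i and u :: real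
  have "emeasure (PiM I \<pi>) {x \<in> space (PiM I \<pi>). c < (\<Sum>i\<in>K. (x i)\<^sup>2)}
      = (\<integral>\<^sup>+x. indicator {x \<in> space (PiM I \<pi>). c < (\<Sum>i\<in>K. (x i)\<^sup>2)} x \<partial>PiM I \<pi>)"
    by (rule nn_integral_indicator [symmetric]) measurable
  also have "\<dots> \<le> (\<integral>\<^sup>+x. ennreal (exp (- t * c)) * (\<Prod>i\<in>I. f i (x i)) \<partial>PiM I \<pi>)"
  proof (intro nn_integral_mono)
    fix x
    have "(\<Prod>i\<in>I. f i (x i)) = (\<Prod>i\<in>K. ennreal (exp (t * (x i)\<^sup>2)))"
      unfolding f_def using I by (subst prod.If_cases) (auto simp: Int_absorb1)
    also have "\<dots> = ennreal (\<Prod>i\<in>K. exp (t * (x i)\<^sup>2))"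
      by (simp add: prod_ennreal)
    also have "(\<Prod>i\<in>K. exp (t * (x i)\<^sup>2)) = exp (t * (\<Sum>i\<in>K. (x i)\<^sup>2))"
      using \<open>finite K\<close> by (simp add: exp_sum sum_distrib_left)
    finally have "ennreal (exp (- t * c)) * (\<Prod>i\<in>I. f i (x i)) = ennreal (exp (t * ((\<Sum>i\<in>K. (x i)\<^sup>2) - c)))"
      by (simp add: ennreal_mult [symmetric] exp_add [symmetric] algebra_simps)
    moreover have "1 \<le> exp (t * ((\<Sum>i\<in>K. (x i)\<^sup>2) - c))" if "c < (\<Sum>i\<in>K. (x i)\<^sup>2)"
      using that t by simp
    ultimately show "indicator {x \<in> space (PiM I \<pi>). c < (\<Sum>i\<in>K. (x i)\<^sup>2)} x
        \<le> ennreal (exp (- t * c)) * (\<Prod>i\<in>I. f i (x i))"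
      by (auto simp: indicator_def simp flip: ennreal_1)
  qed
  also have "\<dots> = ennreal (exp (- t * c)) * (\<integral>\<^sup>+x. (\<Prod>i\<in>I. f i (x i)) \<partial>PiM I \<pi>')"
    unfolding W [symmetric]
  proof (rule nn_integral_cmult)
    have "(\<lambda>x. f i (x i)) \<in> borel_measurable (PiM I \<pi>)" if "i \<in> I" for i
      by (cases "i \<in> K") (simp_all add: f_def)
    then show "(\<lambda>x. \<Prod>i\<in>I. f i (x i)) \<in> borel_measurable (PiM I \<pi>)" by measurable
  qed
  also have "(\<integral>\<^sup>+x. (\<Prod>i\<in>I. f i (x i)) \<partial>PiM I \<pi>') = (\<Prod>i\<in>I. \<integral>\<^sup>+u. f i u \<partial>\<pi>' i)"
  proof (rule product_nn_integral_prod)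
    fix i assume "i \<in> I"
    then have "sets (\<pi>' i) = sets borel" by (simp add: \<pi>'_def \<pi>)
    then show "f i \<in> borel_measurable (\<pi>' i)"
      unfolding measurable_cong_sets [OF \<open>sets (\<pi>' i) = sets borel\<close> refl]
      by (cases "i \<in> K") (simp_all add: f_def [abs_def])
  qed fact
  also have "\<dots> \<le> (\<Prod>i\<in>I. if i \<in> K then ennreal (exp (t * v i + 4 * t\<^sup>2 * (v i)\<^sup>2)) else 1)"
  proof (rule prod_mono_ennreal)
    fix i assume i: "i \<in> I"
    show "(\<integral>\<^sup>+u. f i u \<partial>\<pi>' i) \<le> (if i \<in> K then ennreal (exp (t * v i + 4 * t\<^sup>2 * (v i)\<^sup>2)) else 1)"
    proof (cases "i \<in> K")
      case True
      then show ?thesis using i K t centred_normal_exp_square [of "v i" t] by (simp add: f_def \<pi>'_def)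
    next
      case False
      then show ?thesis using i prob_space.emeasure_space_1 [OF \<pi>(1) [OF i]] by (simp add: f_def \<pi>'_def)
    qed
  qed
  also have "\<dots> = (\<Prod>i\<in>K. ennreal (exp (t * v i + 4 * t\<^sup>2 * (v i)\<^sup>2)))"
    using I by (subst prod.If_cases) (auto simp: Int_absorb1)
  also have "\<dots> = ennreal (exp (\<Sum>i\<in>K. t * v i + 4 * t\<^sup>2 * (v i)\<^sup>2))"
    using \<open>finite K\<close> by (simp add: prod_ennreal exp_sum)
  finally show ?thesis
    by (simp add: mult_left_mono ennreal_mult [symmetric] exp_add [symmetric] sum.distrib sum_distrib_left)
qed

text \<open>
A rare event carries only a small part of the expected energy: if \<open>S\<close> is the energy, this is the
Cauchy-Schwarz inequality, used in the linearised form \<open>2 S \<le> \<theta> S\<^sup>2 / V + V / \<theta>\<close> with \<open>\<theta> = \<surd>p\<close>; a second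
application bounds \<open>S\<^sup>2\<close> by fourth powers of the coordinates.
\<close>

lemma energy_on_rare_event:
  assumes I: "finite I" "K \<subseteq> I"
    and \<pi>: "\<And>i. i \<in> I \<Longrightarrow> prob_space (\<pi> i)" "\<And>i. i \<in> I \<Longrightarrow> sets (\<pi> i) = sets borel"
    and K: "\<And>i. i \<in> K \<Longrightarrow> \<pi> i = centred_normal (v i)" "\<And>i. i \<in> K \<Longrightarrow> 0 < v i"
    and V: "(\<Sum>i\<in>K. v i) \<le> V" "V > 0"
    and h [measurable]: "h \<in> borel_measurable (PiM I \<pi>)" and h1: "\<And>x. h x \<le> 1"
    and p: "(\<integral>\<^sup>+x. h x \<partial>PiM I \<pi>) \<le> ennreal p" "p > 0"
  shows "(\<integral>\<^sup>+x. h x * ennreal (\<Sum>i\<in>K. (x i)\<^sup>2) \<partial>PiM I \<pi>) \<le> ennreal (2 * sqrt p * V)"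
proof -
  have "finite K" using I finite_subset by blast
  have [measurable_cong]: "sets (PiM I \<pi>) = sets (PiM I (\<lambda>_. borel))"
    using \<pi> by (intro sets_PiM_cong) auto
  have [measurable]: "(\<lambda>x. x i) \<in> borel_measurable (PiM I \<pi>)" if "i \<in> K" for i
  proof -
    have "i \<in> I" using that I by auto
    then show ?thesis by measurable
  qed
  define \<theta> where "\<theta> = sqrt p"
  have \<theta>: "\<theta> > 0" "\<theta> * \<theta> = p" using p by (auto simp: \<theta>_def)
  have pt: "h x * ennreal (\<Sum>i\<in>K. (x i)\<^sup>2)
      \<le> (\<Sum>i\<in>K. ennreal (\<theta> / (2 * v i)) * ennreal ((x i) ^ 4)) + ennreal (V / (2 * \<theta>)) * h x" for x
  proof -
    define S where "S = (\<Sum>i\<in>K. (x i)\<^sup>2)"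
    define F where "F = (\<Sum>i\<in>K. (x i) ^ 4 / v i)"
    have "S = (\<Sum>i\<in>K. sqrt (v i) * ((x i)\<^sup>2 / sqrt (v i)))"
      unfolding S_def
    proof (rule sum.cong)
      show "(x i)\<^sup>2 = sqrt (v i) * ((x i)\<^sup>2 / sqrt (v i))" if "i \<in> K" for i
        using K(2) [OF that] by simp
    qed simp
    then have "S\<^sup>2 \<le> (\<Sum>i\<in>K. (sqrt (v i))\<^sup>2) * (\<Sum>i\<in>K. ((x i)\<^sup>2 / sqrt (v i))\<^sup>2)"
      by (metis Cauchy_Schwarz_ineq_sum)
    also have "\<dots> = (\<Sum>i\<in>K. v i) * F"
      unfolding F_def using K(2) by (auto simp: power_divide less_imp_le intro!: arg_cong2 [where f = "(*)"] sum.cong)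
    also have "\<dots> \<le> V * F"
      using V K(2) unfolding F_def by (intro mult_right_mono sum_nonneg) (auto simp: less_imp_le)
    finally have SF: "S\<^sup>2 \<le> V * F" .
    have F0: "F \<ge> 0" unfolding F_def using K(2) by (intro sum_nonneg) (auto simp: less_imp_le)
    have "2 * (\<theta> * V) * S \<le> (\<theta> * \<theta>) * S\<^sup>2 + V\<^sup>2"
      using zero_le_power2 [of "\<theta> * S - V"] by (simp add: power2_eq_square algebra_simps)
    also have "\<dots> \<le> (\<theta> * \<theta>) * (V * F) + V\<^sup>2" using SF \<theta> by (intro add_right_mono mult_left_mono) auto
    finally have "2 * (\<theta> * V) * S \<le> 2 * (\<theta> * V) * (\<theta> / 2 * F + V / (2 * \<theta>))"
      using \<theta>(1) by (simp add: power2_eq_square algebra_simps)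
    then have main: "S \<le> \<theta> / 2 * F + V / (2 * \<theta>)"
      using \<theta>(1) V(2) mult_le_cancel_left_pos [of "2 * (\<theta> * V)"] by simp
    have eq: "(\<Sum>i\<in>K. ennreal (\<theta> / (2 * v i)) * ennreal ((x i) ^ 4)) = ennreal (\<theta> / 2 * F)"
    proof -
      have "(\<Sum>i\<in>K. ennreal (\<theta> / (2 * v i)) * ennreal ((x i) ^ 4)) = (\<Sum>i\<in>K. ennreal (\<theta> / 2 * ((x i) ^ 4 / v i)))"
        using \<theta>(1) K(2) by (intro sum.cong) (auto simp: ennreal_mult'' [symmetric])
      also have "\<dots> = ennreal (\<theta> / 2 * F)"
        using \<theta>(1) K(2) unfolding F_def sum_distrib_left by (intro sum_ennreal) (auto simp: less_imp_le)
      finally show ?thesis .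
    qed
    have "h x * ennreal S \<le> h x * (ennreal (\<theta> / 2 * F) + ennreal (V / (2 * \<theta>)))"
      using main \<theta>(1) V(2) F0 by (intro mult_left_mono) (auto simp: ennreal_plus [symmetric] ennreal_leI simp del: ennreal_plus)
    also have "\<dots> = h x * ennreal (\<theta> / 2 * F) + ennreal (V / (2 * \<theta>)) * h x"
      by (simp add: distrib_left mult.commute)
    also have "\<dots> \<le> 1 * ennreal (\<theta> / 2 * F) + ennreal (V / (2 * \<theta>)) * h x"
      using h1 by (intro add_right_mono mult_right_mono) auto
    finally show ?thesis unfolding eq S_def by simp
  qed
  have "(\<integral>\<^sup>+x. h x * ennreal (\<Sum>i\<in>K. (x i)\<^sup>2) \<partial>PiM I \<pi>)
      \<le> (\<integral>\<^sup>+x. (\<Sum>i\<in>K. ennreal (\<theta> / (2 * v i)) * ennreal ((x i) ^ 4)) + ennreal (V / (2 * \<theta>)) * h x \<partial>PiM I \<pi>)"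
    by (intro nn_integral_mono pt)
  also have "\<dots> = (\<integral>\<^sup>+x. (\<Sum>i\<in>K. ennreal (\<theta> / (2 * v i)) * ennreal ((x i) ^ 4)) \<partial>PiM I \<pi>)
      + (\<integral>\<^sup>+x. ennreal (V / (2 * \<theta>)) * h x \<partial>PiM I \<pi>)"
    by (rule nn_integral_add) measurable
  also have "\<dots> = (\<Sum>i\<in>K. ennreal (\<theta> / (2 * v i)) * (\<integral>\<^sup>+x. ennreal ((x i) ^ 4) \<partial>PiM I \<pi>))
      + ennreal (V / (2 * \<theta>)) * (\<integral>\<^sup>+x. h x \<partial>PiM I \<pi>)"
    by (subst nn_integral_sum) (auto simp: nn_integral_cmult)
  also have "\<dots> \<le> (\<Sum>i\<in>K. ennreal (\<theta> / (2 * v i)) * ennreal (3 * (v i)\<^sup>2)) + ennreal (V / (2 * \<theta>)) * ennreal p"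
  proof (intro add_mono sum_mono mult_left_mono)
    fix i assume i: "i \<in> K"
    have "(\<lambda>u. ennreal (u ^ 4)) \<in> borel_measurable (\<pi> i)"
      unfolding K(1) [OF i] measurable_cong_sets [OF sets_centred_normal refl] by simp
    then have "(\<integral>\<^sup>+x. ennreal ((x i) ^ 4) \<partial>PiM I \<pi>) = (\<integral>\<^sup>+u. ennreal (u ^ 4) \<partial>\<pi> i)"
      using i I \<pi>(1) by (intro nn_integral_PiM_component) auto
    then show "(\<integral>\<^sup>+x. ennreal ((x i) ^ 4) \<partial>PiM I \<pi>) \<le> ennreal (3 * (v i)\<^sup>2)"
      using K i centred_normal_fourth [of "v i"] by (simp add: less_imp_le)
  qed (use p in auto)
  also have "(\<Sum>i\<in>K. ennreal (\<theta> / (2 * v i)) * ennreal (3 * (v i)\<^sup>2)) = (\<Sum>i\<in>K. ennreal (3 * \<theta> / 2 * v i))"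
  proof (rule sum.cong)
    show "ennreal (\<theta> / (2 * v i)) * ennreal (3 * (v i)\<^sup>2) = ennreal (3 * \<theta> / 2 * v i)" if "i \<in> K" for i
      using K(2) [OF that] by (simp add: ennreal_mult'' [symmetric] power2_eq_square ac_simps)
  qed simp
  also have "\<dots> = ennreal (3 * \<theta> / 2 * (\<Sum>i\<in>K. v i))"
    using \<theta> K(2) unfolding sum_distrib_left by (intro sum_ennreal) (auto simp: less_imp_le)
  also have "ennreal (V / (2 * \<theta>)) * ennreal p = ennreal (V / 2 * \<theta>)"
    using \<theta> V p by (subst ennreal_mult [symmetric]) (auto simp: \<theta>(2) [symmetric])
  also have "ennreal (3 * \<theta> / 2 * (\<Sum>i\<in>K. v i)) + ennreal (V / 2 * \<theta>) = ennreal (3 * \<theta> / 2 * (\<Sum>i\<in>K. v i) + V / 2 * \<theta>)"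
    using \<theta> V K(2) by (intro ennreal_plus [symmetric] mult_nonneg_nonneg sum_nonneg) (auto simp: less_imp_le)
  also have "\<dots> \<le> ennreal (2 * sqrt p * V)"
  proof (rule ennreal_leI)
    have "3 * \<theta> / 2 * (\<Sum>i\<in>K. v i) \<le> 3 * \<theta> / 2 * V" using V \<theta> by (intro mult_left_mono) auto
    then show "3 * \<theta> / 2 * (\<Sum>i\<in>K. v i) + V / 2 * \<theta> \<le> 2 * sqrt p * V"
      by (simp add: \<theta>_def algebra_simps)
  qed
  finally show ?thesis .
qed

section \<open>The least favourable prior\<close>

text \<open>
Below \<open>m\<close> the prior must satisfy the constraints surely, above \<open>m\<close> only with high probability; the
factor \<open>1 - \<delta>\<close> creates the room for random fluctuations of the tails.
\<close>

definition prior :: "real \<Rightarrow> real \<Rightarrow> real \<Rightarrow> nat \<Rightarrow> nat \<Rightarrow> real measure" where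
  "prior \<alpha> P0 \<delta> m j =
    (if j < m then uniform_measure lborel {- sqrt (extremal \<alpha> P0 j)..sqrt (extremal \<alpha> P0 j)}
     else centred_normal ((1 - \<delta>) * extremal \<alpha> P0 j))"

text \<open>
The geometric series \<open>\<Sum>\<^sub>k\<^sub>\<ge>\<^sub>m exp (- \<gamma> k)\<close> with \<open>\<gamma> = \<delta>\<^sup>2 / (32 \<alpha>)\<close>, which is the rate in
\<open>tail_exceeds_prob\<close>.
\<close>

definition violation_bound :: "real \<Rightarrow> real \<Rightarrow> nat \<Rightarrow> real" where
  "violation_bound \<alpha> \<delta> m = exp (- (\<delta>\<^sup>2 / (32 * \<alpha>))) ^ m / (1 - exp (- (\<delta>\<^sup>2 / (32 * \<alpha>))))"

definition tails_within :: "real \<Rightarrow> real \<Rightarrow> nat \<Rightarrow> nat \<Rightarrow> (nat \<Rightarrow> real) \<Rightarrow> bool" where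
  "tails_within \<alpha> P0 m J x \<longleftrightarrow> (\<forall>k\<in>{m..J}. (\<Sum>j=k..J. (x j)\<^sup>2) \<le> tail_bound \<alpha> P0 k)"

lemma sets_prior [simp, measurable_cong]: "sets (prior \<alpha> P0 \<delta> m j) = sets borel"
  by (simp add: prior_def)

lemma prob_space_prior:
  assumes "\<alpha> > 0" "P0 > 0" "j \<ge> 1"
  shows "prob_space (prior \<alpha> P0 \<delta> m j)"
proof (cases "j < m")
  case True
  have "sqrt (extremal \<alpha> P0 j) > 0" using extremal_pos [OF assms] by simp
  then have "prob_space (uniform_measure lborel {- sqrt (extremal \<alpha> P0 j)..sqrt (extremal \<alpha> P0 j)})"
    by (intro prob_space_uniform_measure) auto
  then show ?thesis using True by (simp add: prior_def)
next
  case False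
  then show ?thesis by (simp add: prior_def prob_space_centred_normal)
qed

lemma AE_prior_bounded:
  assumes "\<alpha> > 0" "P0 > 0" "j \<ge> 1" "j < m"
  shows "AE u in prior \<alpha> P0 \<delta> m j. u\<^sup>2 \<le> extremal \<alpha> P0 j"
proof -
  define r where "r = sqrt (extremal \<alpha> P0 j)"
  have r: "r\<^sup>2 = extremal \<alpha> P0 j" using extremal_pos [OF assms(1-3)] by (simp add: r_def)
  have "AE u in uniform_measure lborel {- r..r}. u\<^sup>2 \<le> r\<^sup>2"
  proof (rule AE_uniform_measureI)
    show "AE u in lborel. u \<in> {- r..r} \<longrightarrow> u\<^sup>2 \<le> r\<^sup>2"
    proof (intro AE_I2 impI)
      fix u :: real assume "u \<in> {- r..r}"
      then have "\<bar>u\<bar> \<le> \<bar>r\<bar>" by auto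
      then show "u\<^sup>2 \<le> r\<^sup>2" by (simp add: abs_le_square_iff)
    qed
  qed simp
  moreover have "prior \<alpha> P0 \<delta> m j = uniform_measure lborel {- r..r}"
    using assms(4) by (simp add: prior_def r_def)
  ultimately show ?thesis by (simp only: r)
qed

lemma spectrum_eq_tail_bound:
  "k \<ge> 1 \<Longrightarrow> spectrum \<alpha> P0 k = 2 * \<alpha> * tail_bound \<alpha> P0 k / real k"
  by (simp add: spectrum_def tail_bound_def powr_diff)

lemma spectrum_antimono:
  assumes "\<alpha> > 0" "P0 > 0" "1 \<le> i" "i \<le> j"
  shows "spectrum \<alpha> P0 j \<le> spectrum \<alpha> P0 i"
  unfolding spectrum_def using assms by (intro mult_left_mono powr_mono2') auto

lemma sum_extremal_le:
  assumes "P0 > 0"  "1 \<le> k" "k \<le> J"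
  shows "(\<Sum>j=k..J. extremal \<alpha> P0 j) \<le> tail_bound \<alpha> P0 k"
  using sum_extremal [of k "Suc J" \<alpha> P0] tail_bound_pos [OF assms(1), of "Suc J" \<alpha>] assms
  by (simp add: atLeastLessThanSuc_atLeastAtMost)

text \<open>
The tail from \<open>k\<close> has mean at most \<open>(1 - \<delta>) b\<close>, where \<open>b\<close> is the allowed value, and each of its
variances is at most of order \<open>b / k\<close>. It therefore behaves like an average of about \<open>k\<close> terms and exceeds its
mean by the fraction \<open>\<delta>\<close> with probability exponentially small in \<open>k\<close>.
\<close>

lemma tail_exceeds_prob:
  assumes "\<alpha> > 0" "P0 > 0" "0 < \<delta>" "\<delta> < 1" "1 \<le> m" "m \<le> k" "k \<le> J"
  defines "W \<equiv> PiM {1..J} (prior \<alpha> P0 \<delta> m)"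
  shows "emeasure W {x \<in> space W. tail_bound \<alpha> P0 k < (\<Sum>j=k..J. (x j)\<^sup>2)}
    \<le> ennreal (exp (- (\<delta>\<^sup>2 / (32 * \<alpha>))) ^ k)"
proof -
  define v where "v j = (1 - \<delta>) * extremal \<alpha> P0 j" for j
  define b where "b = tail_bound \<alpha> P0 k"
  define \<kappa> where "\<kappa> = \<delta> / (16 * \<alpha>)"
  \<comment> \<open>The exponent is \<open>- \<delta> (t b) + 8 \<alpha> (t b)\<^sup>2 / k\<close>, which is minimal at \<open>t b = \<kappa> k\<close>.\<close>
  define t where "t = \<kappa> * real k / b"
  have k: "1 \<le> k" "real k > 0" using assms by auto
  have b: "b > 0" unfolding b_def using assms k by (intro tail_bound_pos) auto
  have t0: "t > 0" unfolding t_def \<kappa>_def using assms b k by auto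
  have tb: "t * b = \<kappa> * real k" using b by (simp add: t_def)
  have ext: "0 < extremal \<alpha> P0 j" "extremal \<alpha> P0 j \<le> 2 * \<alpha> * b / real k" if "j \<in> {k..J}" for j
    using extremal_pos [of \<alpha> P0 j] extremal_le_spectrum [of \<alpha> P0 j] spectrum_antimono [of \<alpha> P0 k j] spectrum_eq_tail_bound [of k \<alpha> P0]
      that assms k by (auto simp: b_def)
  have v: "0 < v j" "v j \<le> 2 * \<alpha> * b / real k" if "j \<in> {k..J}" for j
  proof -
    show "0 < v j" using ext [OF that] assms by (simp add: v_def)
    have "v j \<le> 1 * extremal \<alpha> P0 j" unfolding v_def using ext [OF that] assms by (intro mult_right_mono) auto
    then show "v j \<le> 2 * \<alpha> * b / real k" using ext [OF that] by simp
  qed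
  have sv: "(\<Sum>j=k..J. v j) \<le> (1 - \<delta>) * b"
    unfolding v_def sum_distrib_left [symmetric] b_def using assms k by (intro mult_left_mono sum_extremal_le) auto
  have "(1 - \<delta>) * b \<le> 1 * b" using assms b by (intro mult_right_mono) auto
  have "(\<Sum>j=k..J. (v j)\<^sup>2) \<le> (\<Sum>j=k..J. 2 * \<alpha> * b / real k * v j)"
    unfolding power2_eq_square using v by (intro sum_mono mult_right_mono) (auto simp: less_imp_le)
  also have "\<dots> = 2 * \<alpha> * b / real k * (\<Sum>j=k..J. v j)" by (simp add: sum_distrib_left)
  also have "\<dots> \<le> 2 * \<alpha> * b / real k * b"
    using order_trans [OF sv \<open>(1 - \<delta>) * b \<le> 1 * b\<close>] assms b k by (intro mult_left_mono) auto
  finally have sv2: "(\<Sum>j=k..J. (v j)\<^sup>2) \<le> 2 * \<alpha> * b / real k * b" .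
  have "emeasure W {x \<in> space W. b < (\<Sum>j\<in>{k..J}. (x j)\<^sup>2)}
    \<le> ennreal (exp (t * (\<Sum>j\<in>{k..J}. v j) + 4 * t\<^sup>2 * (\<Sum>j\<in>{k..J}. (v j)\<^sup>2) - t * b))"
    unfolding W_def
  proof (rule chernoff_weighted_chi_square)
    show "prior \<alpha> P0 \<delta> m i = centred_normal (v i)" if "i \<in> {k..J}" for i
      using that assms by (simp add: prior_def v_def)
    show "t * v i \<le> 1 / 4" if "i \<in> {k..J}" for i
    proof -
      have "t * v i \<le> t * (2 * \<alpha> * b / real k)" using v [OF that] t0 by (intro mult_left_mono) auto
      also have "\<dots> = \<delta> / 8" using b k assms by (simp add: t_def \<kappa>_def)
      finally show ?thesis using assms by simp
    qed
  qed (use assms v t0 k in \<open>auto intro!: prob_space_prior simp: less_imp_le\<close>)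
  also have "\<dots> \<le> ennreal (exp (real k * (- (\<delta>\<^sup>2 / (32 * \<alpha>)))))"
  proof (intro ennreal_leI exp_mono)
    have "t * (\<Sum>j\<in>{k..J}. v j) + 4 * t\<^sup>2 * (\<Sum>j\<in>{k..J}. (v j)\<^sup>2) - t * b
        \<le> t * ((1 - \<delta>) * b) + 4 * t\<^sup>2 * (2 * \<alpha> * b / real k * b) - t * b"
      using sv sv2 t0 by (intro diff_right_mono add_mono mult_left_mono) auto
    also have "\<dots> = - \<delta> * (t * b) + 8 * \<alpha> * (t * b)\<^sup>2 / real k"
      by (simp add: power2_eq_square algebra_simps)
    also have "\<dots> = real k * (- (\<delta>\<^sup>2 / (32 * \<alpha>)))"
      unfolding tb \<kappa>_def using assms k by (simp add: power2_eq_square field_simps)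
    finally show "t * (\<Sum>j\<in>{k..J}. v j) + 4 * t\<^sup>2 * (\<Sum>j\<in>{k..J}. (v j)\<^sup>2) - t * b
        \<le> real k * (- (\<delta>\<^sup>2 / (32 * \<alpha>)))" .
  qed
  also have "exp (real k * (- (\<delta>\<^sup>2 / (32 * \<alpha>)))) = exp (- (\<delta>\<^sup>2 / (32 * \<alpha>))) ^ k"
    by (rule exp_of_nat_mult)
  finally show ?thesis unfolding b_def .
qed

text \<open>
The union bound over \<open>k\<close> loses nothing essential because the probabilities decay geometrically;
in particular the bound is uniform in \<open>J\<close>.
\<close>

lemma prior_violation_prob:
  fixes J :: nat
  assumes "\<alpha> > 0" "P0 > 0" "0 < \<delta>" "\<delta> < 1" "1 \<le> m"
  defines "W \<equiv> PiM {1..J} (prior \<alpha> P0 \<delta> m)"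
  shows "emeasure W {x \<in> space W. \<not> tails_within \<alpha> P0 m J x} \<le> ennreal (violation_bound \<alpha> \<delta> m)"
proof -
  define q where "q = exp (- (\<delta>\<^sup>2 / (32 * \<alpha>)))"
  have q: "0 < q" "q < 1" using assms by (auto simp: q_def)
  have [measurable_cong]: "sets W = sets (PiM {1..J} (\<lambda>_. borel))"
    unfolding W_def by (intro sets_PiM_cong) auto
  have sets: "{x \<in> space W. tail_bound \<alpha> P0 k < (\<Sum>j=k..J. (x j)\<^sup>2)} \<in> sets W" if "k \<in> {m..J}" for k
  proof -
    have "(\<lambda>x. \<Sum>j=k..J. (x j)\<^sup>2) \<in> borel_measurable W"
    proof (intro borel_measurable_sum borel_measurable_power)
      fix j assume "j \<in> {k..J}"
      then have "j \<in> {1..J}" using that assms by auto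
      then show "(\<lambda>x. x j) \<in> borel_measurable W" by measurable
    qed
    then show ?thesis by measurable
  qed
  have "{x \<in> space W. \<not> tails_within \<alpha> P0 m J x} = (\<Union>k\<in>{m..J}. {x \<in> space W. tail_bound \<alpha> P0 k < (\<Sum>j=k..J. (x j)\<^sup>2)})"
    by (auto simp: tails_within_def not_le)
  then have "emeasure W {x \<in> space W. \<not> tails_within \<alpha> P0 m J x}
      \<le> (\<Sum>k\<in>{m..J}. emeasure W {x \<in> space W. tail_bound \<alpha> P0 k < (\<Sum>j=k..J. (x j)\<^sup>2)})"
    using sets by (auto intro!: emeasure_subadditive_finite)
  also have "\<dots> \<le> (\<Sum>k\<in>{m..J}. ennreal (q ^ k))"
    unfolding W_def q_def using assms by (intro sum_mono tail_exceeds_prob) auto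
  also have "\<dots> = ennreal (\<Sum>k\<in>{m..J}. q ^ k)"
    using q by (intro sum_ennreal) auto
  also have "\<dots> \<le> ennreal (violation_bound \<alpha> \<delta> m)"
  proof (rule ennreal_leI)
    show "(\<Sum>k\<in>{m..J}. q ^ k) \<le> violation_bound \<alpha> \<delta> m"
    proof (cases "m \<le> J")
      case True
      have "(\<Sum>k=m..J. q ^ k) = (q ^ m - q ^ Suc J) / (1 - q)"
        using sum_gp [of q m J] True q by simp
      also have "\<dots> \<le> q ^ m / (1 - q)" using q by (intro divide_right_mono) auto
      finally show ?thesis by (simp add: violation_bound_def q_def)
    next
      case False
      then show ?thesis using q by (simp add: violation_bound_def q_def)
    qed
  qed
  finally show ?thesis .
qed

lemma violation_bound_tendsto:
  assumes "\<alpha> > 0" "\<delta> > 0" shows "violation_bound \<alpha> \<delta> \<longlonglongrightarrow> 0"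
proof -
  have "(\<lambda>m. exp (- (\<delta>\<^sup>2 / (32 * \<alpha>))) ^ m) \<longlonglongrightarrow> 0"
    using assms by (intro LIMSEQ_power_zero) auto
  then show ?thesis unfolding violation_bound_def [abs_def] by (rule tendsto_divide_zero)
qed

section \<open>The Bayes lower bound on the ball\<close>

lemma norm_sq_ge_sum: "(\<Sum>j\<in>{1..J}. ennreal ((x j)\<^sup>2)) \<le> norm_sq x"
proof -
  have "(\<Sum>j\<in>{1..J}. ennreal ((x j)\<^sup>2)) = (\<Sum>j<J. ennreal ((x (Suc j))\<^sup>2))"
    by (rule sum.reindex_bij_witness [of _ Suc "\<lambda>j. j - 1"]) auto
  also have "\<dots> \<le> norm_sq x"
    unfolding norm_sq_def by (intro sum_le_suminf) auto
  finally show ?thesis .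
qed

lemma measurable_estimator_component:
  "T \<in> measurable seq_space seq_space \<Longrightarrow> j \<ge> 1 \<Longrightarrow> (\<lambda>y. T y j) \<in> borel_measurable seq_space"
  unfolding seq_space_def by (rule measurable_compose [OF _ measurable_component_singleton]) auto

text \<open>
If \<open>t\<close> is more than twice as long as \<open>x\<close> is allowed to be, then 0 is at least as close to \<open>x\<close> as \<open>t\<close> is. Setting
such values to 0 plays the role of a projection onto the ball and needs only
\<open>t\<^sup>2 \<le> 2 (t - x)\<^sup>2 + 2 x\<^sup>2\<close>.
\<close>

lemma truncation_reduces_loss:
  fixes t x :: "nat \<Rightarrow> real" and K :: "nat set"
  assumes x: "(\<Sum>j\<in>K. (x j)\<^sup>2) \<le> V"
  defines "t' j \<equiv> if (\<Sum>i\<in>K. (t i)\<^sup>2) \<le> 4 * V then t j else 0"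
  shows "(\<Sum>j\<in>K. (t' j - x j)\<^sup>2) \<le> (\<Sum>j\<in>K. (t j - x j)\<^sup>2)"
proof (cases "(\<Sum>i\<in>K. (t i)\<^sup>2) \<le> 4 * V")
  case False
  have "(t j)\<^sup>2 \<le> 2 * (t j - x j)\<^sup>2 + 2 * (x j)\<^sup>2" for j
    using zero_le_power2 [of "t j - 2 * x j"] by (simp add: power2_eq_square algebra_simps)
  then have "(\<Sum>j\<in>K. (t j)\<^sup>2) \<le> (\<Sum>j\<in>K. 2 * (t j - x j)\<^sup>2 + 2 * (x j)\<^sup>2)"
    by (rule sum_mono)
  also have "\<dots> = 2 * (\<Sum>j\<in>K. (t j - x j)\<^sup>2) + 2 * (\<Sum>j\<in>K. (x j)\<^sup>2)"
    by (simp add: sum.distrib sum_distrib_left)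
  finally have "(\<Sum>j\<in>K. (x j)\<^sup>2) \<le> (\<Sum>j\<in>K. (t j - x j)\<^sup>2)" using x False by linarith
  then show ?thesis using False by (simp add: t'_def)
qed (simp add: t'_def)

lemma truncated_loss_le:
  fixes t x :: "nat \<Rightarrow> real" and K :: "nat set"
  assumes "V \<ge> 0"
  defines "t' j \<equiv> if (\<Sum>i\<in>K. (t i)\<^sup>2) \<le> 4 * V then t j else 0"
  shows "(\<Sum>j\<in>K. (t' j - x j)\<^sup>2) \<le> 8 * V + 2 * (\<Sum>j\<in>K. (x j)\<^sup>2)"
proof -
  have "(t' j - x j)\<^sup>2 \<le> 2 * (t' j)\<^sup>2 + 2 * (x j)\<^sup>2" for j
    using zero_le_power2 [of "t' j + x j"] by (simp add: power2_eq_square algebra_simps)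
  then have "(\<Sum>j\<in>K. (t' j - x j)\<^sup>2) \<le> (\<Sum>j\<in>K. 2 * (t' j)\<^sup>2 + 2 * (x j)\<^sup>2)"
    by (rule sum_mono)
  also have "\<dots> = 2 * (\<Sum>j\<in>K. (t' j)\<^sup>2) + 2 * (\<Sum>j\<in>K. (x j)\<^sup>2)"
    by (simp add: sum.distrib sum_distrib_left)
  also have "(\<Sum>j\<in>K. (t' j)\<^sup>2) \<le> 4 * V"
    using assms(1) by (cases "(\<Sum>i\<in>K. (t i)\<^sup>2) \<le> 4 * V") (simp_all add: t'_def)
  finally show ?thesis by simp
qed

text \<open>
The maximal risk is at least the integral of the risk over the part of the prior that satisfies the
tail constraints from \<open>m\<close> on. For the coordinates before \<open>m\<close> this restriction is an independent event
and multiplies the Bayes risks by its probability, at least \<open>1 - p\<close>. For the coordinates from \<open>m\<close> on,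
the restricted integral is the full one minus the loss on the complementary event. That loss is
small because the estimator may be truncated at a length of order \<open>\<surd>V\<close> without increasing its risk
on the ball, where \<open>V\<close> is the allowed tail from \<open>m\<close>; what remains is covered by
\<open>energy_on_rare_event\<close>.
\<close>

lemma bayes_lower_bound:
  fixes T :: "(nat \<Rightarrow> real) \<Rightarrow> nat \<Rightarrow> real" and J :: nat
  assumes \<alpha>: "\<alpha> > 0" "P0 > 0" and \<delta>: "0 < \<delta>" "\<delta> < 1" and m: "1 \<le> m" "m \<le> J"
    and T: "T \<in> measurable seq_space seq_space"
    and \<rho>: "\<And>j. 1 \<le> j \<Longrightarrow> bayes_risk_ge (prior \<alpha> P0 \<delta> m j) (s j) (\<rho> j)" "\<And>j. 1 \<le> j \<Longrightarrow> 0 \<le> \<rho> j"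
    and p: "violation_bound \<alpha> \<delta> m \<le> p" "0 < p" "p \<le> 1"
    and R: "\<And>x. x \<in> B \<alpha> P0 \<Longrightarrow> (\<integral>\<^sup>+z. norm_sq (\<lambda>j. T (observe s x z) j - x j) \<partial>noise) \<le> R"
  shows "ennreal ((1 - p) * (\<Sum>j\<in>{1..J}. \<rho> j)) \<le> R + ennreal (12 * sqrt p * tail_bound \<alpha> P0 m)"
proof -
  define I where "I = {1..J}"
  define K where "K = {m..J}"
  define L where "L = {1..<m}"
  have IJ: "I = L \<union> K" "L \<inter> K = {}" "finite I" "finite L" "finite K" "I \<subseteq> {1..}" "K \<subseteq> I" "L \<subseteq> I"
    using m by (auto simp: I_def K_def L_def)
  define V where "V = tail_bound \<alpha> P0 m"
  have V: "V > 0" unfolding V_def using \<alpha> m by (intro tail_bound_pos) auto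
  define \<pi> where "\<pi> = prior \<alpha> P0 \<delta> m"
  have \<pi>: "\<And>i. i \<in> I \<Longrightarrow> prob_space (\<pi> i)" "\<And>i. i \<in> I \<Longrightarrow> sets (\<pi> i) = sets borel"
    unfolding \<pi>_def I_def using \<alpha> by (auto intro!: prob_space_prior)
  define W where "W = PiM I \<pi>"
  interpret W: prob_space W unfolding W_def by (intro prob_space_PiM \<pi>)
  interpret noise: prob_space noise by (rule prob_space_noise)
  have setsW [measurable_cong]: "sets W = sets (PiM I (\<lambda>_. borel))"
    unfolding W_def using \<pi> by (intro sets_PiM_cong) auto
  have comp: "(\<lambda>x. x i) \<in> borel_measurable W" if "i \<in> I" for i
    using that by measurable
  have energy [measurable]: "(\<lambda>x. \<Sum>j\<in>A. (x j)\<^sup>2) \<in> borel_measurable W" if "A \<subseteq> I" for A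
    using that comp by (intro borel_measurable_sum borel_measurable_power) auto
  define obs where "obs x z = observe s (zero_extend I x) z" for x z
  have obs2: "(\<lambda>(x, z). obs x z) \<in> measurable (W \<Otimes>\<^sub>M noise) seq_space"
    unfolding obs_def W_def by (rule measurable_observe_pair) (use IJ \<pi> in auto)
  have obs1: "obs x \<in> measurable noise seq_space" for x
    unfolding obs_def by (rule measurable_observe)
  define C where "C \<tau> j x = (\<integral>\<^sup>+z. ennreal ((\<tau> (obs x z) - x j)\<^sup>2) \<partial>noise)"
    for \<tau> :: "(nat \<Rightarrow> real) \<Rightarrow> real" and j x
  have C_meas: "C \<tau> j \<in> borel_measurable W" if [measurable]: "\<tau> \<in> borel_measurable seq_space" and "j \<in> I" for \<tau> j
  proof -
    note [measurable] = obs2 comp [OF \<open>j \<in> I\<close>]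
    have [measurable]: "(\<lambda>p. obs (fst p) (snd p)) \<in> measurable (W \<Otimes>\<^sub>M noise) seq_space"
      using obs2 by (simp add: case_prod_beta')
    have "(\<lambda>p. ennreal ((\<tau> (obs (fst p) (snd p)) - fst p j)\<^sup>2)) \<in> borel_measurable (W \<Otimes>\<^sub>M noise)"
      by measurable
    then show ?thesis
      unfolding C_def [abs_def] by (intro noise.borel_measurable_nn_integral) (simp add: case_prod_beta')
  qed
  have C_sum: "(\<Sum>j\<in>A. C (\<tau> j) j x) = (\<integral>\<^sup>+z. ennreal (\<Sum>j\<in>A. (\<tau> j (obs x z) - x j)\<^sup>2) \<partial>noise)"
    if \<tau>: "\<And>j. j \<in> A \<Longrightarrow> \<tau> j \<in> borel_measurable seq_space" for \<tau> A x
  proof -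
    have "(\<Sum>j\<in>A. C (\<tau> j) j x) = (\<integral>\<^sup>+z. (\<Sum>j\<in>A. ennreal ((\<tau> j (obs x z) - x j)\<^sup>2)) \<partial>noise)"
      unfolding C_def
    proof (rule nn_integral_sum [symmetric])
      fix j assume "j \<in> A"
      then have [measurable]: "(\<lambda>z. \<tau> j (obs x z)) \<in> borel_measurable noise"
        using measurable_compose [OF obs1 \<tau>] by simp
      show "(\<lambda>z. ennreal ((\<tau> j (obs x z) - x j)\<^sup>2)) \<in> borel_measurable noise" by measurable
    qed
    then show ?thesis by simp
  qed
  have C_bayes: "ennreal (\<rho> j) * (\<integral>\<^sup>+x. f x \<partial>W) \<le> (\<integral>\<^sup>+x. f x * C \<tau> j x \<partial>W)"
    if "j \<in> I" "\<tau> \<in> borel_measurable seq_space" "f \<in> borel_measurable W" "\<And>x u. f (x(j := u)) = f x" for f \<tau> j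
    unfolding C_def obs_def W_def
  proof (rule bayes_risk_product [OF IJ(6) that(1) \<pi> _ that(2)])
    show "bayes_risk_ge (\<pi> j) (s j) (\<rho> j)" using \<rho>(1) that(1) by (simp add: \<pi>_def I_def)
    show "f \<in> borel_measurable (PiM I \<pi>)" using that(3) by (simp add: W_def)
    show "f (x(j := u)) = f x" for x u by (rule that(4))
  qed
  \<comment> \<open>Defined on all sequences, and not only on the sample space, so that updating a coordinate below
    \<open>m\<close> literally leaves the value unchanged.\<close>
  define h :: "(nat \<Rightarrow> real) \<Rightarrow> ennreal" where "h x = (if tails_within \<alpha> P0 m J x then 1 else 0)" for x
  define g :: "(nat \<Rightarrow> real) \<Rightarrow> ennreal" where "g x = (if tails_within \<alpha> P0 m J x then 0 else 1)" for x
  have within_meas [measurable]: "Measurable.pred W (tails_within \<alpha> P0 m J)"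
  proof -
    have "Measurable.pred W (\<lambda>x. (\<Sum>j\<in>{k..J}. (x j)\<^sup>2) \<le> tail_bound \<alpha> P0 k)" if "k \<in> {m..J}" for k
    proof -
      have [measurable]: "(\<lambda>x. \<Sum>j\<in>{k..J}. (x j)\<^sup>2) \<in> borel_measurable W"
        using that m by (intro energy) (auto simp: I_def)
      show ?thesis by measurable
    qed
    then show ?thesis unfolding tails_within_def [abs_def] by (intro pred_intros_finite) auto
  qed
  have [measurable]: "h \<in> borel_measurable W" "g \<in> borel_measurable W"
    unfolding h_def [abs_def] g_def [abs_def] by measurable
  have hg: "h x + g x = 1" for x by (simp add: h_def g_def)
  have int_g: "(\<integral>\<^sup>+x. g x \<partial>W) \<le> ennreal p"
  proof -
    have "(\<integral>\<^sup>+x. g x \<partial>W) = (\<integral>\<^sup>+x. indicator {x \<in> space W. \<not> tails_within \<alpha> P0 m J x} x \<partial>W)"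
      by (rule nn_integral_cong) (auto simp: g_def indicator_def)
    also have "\<dots> = emeasure W {x \<in> space W. \<not> tails_within \<alpha> P0 m J x}"
      by (rule nn_integral_indicator) measurable
    also have "\<dots> \<le> ennreal (violation_bound \<alpha> \<delta> m)"
      unfolding W_def \<pi>_def I_def using \<alpha> \<delta> m by (intro prior_violation_prob)
    finally show ?thesis using p by (meson ennreal_leI order_trans)
  qed
  have int_h: "ennreal (1 - p) \<le> (\<integral>\<^sup>+x. h x \<partial>W)"
  proof (rule ennreal_diff_le_of_le_add)
    have "ennreal 1 = (\<integral>\<^sup>+x. h x + g x \<partial>W)" by (simp add: hg W.emeasure_space_1)
    also have "\<dots> = (\<integral>\<^sup>+x. h x \<partial>W) + (\<integral>\<^sup>+x. g x \<partial>W)" by (rule nn_integral_add) measurable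
    also have "\<dots> \<le> (\<integral>\<^sup>+x. h x \<partial>W) + ennreal p" by (rule add_left_mono [OF int_g])
    finally show "ennreal 1 \<le> (\<integral>\<^sup>+x. h x \<partial>W) + ennreal p" .
  qed (use p in simp)
  define \<tau> where "\<tau> j y = T y j" for j y
  have \<tau>: "\<tau> j \<in> borel_measurable seq_space" if "j \<in> I" for j
    using measurable_estimator_component [OF T, of j] that unfolding \<tau>_def [abs_def] I_def by simp
  \<comment> \<open>Truncation at twice the allowed length, which is \<open>4 V\<close> for the squares.\<close>
  define \<tau>' where "\<tau>' j y = (if (\<Sum>i\<in>K. (\<tau> i y)\<^sup>2) \<le> 4 * V then \<tau> j y else 0)" for j y
  have \<tau>': "\<tau>' j \<in> borel_measurable seq_space" if "j \<in> K" for j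
  proof -
    have [measurable]: "(\<lambda>y. \<Sum>i\<in>K. (\<tau> i y)\<^sup>2) \<in> borel_measurable seq_space"
      using \<tau> IJ by (intro borel_measurable_sum borel_measurable_power) auto
    have [measurable]: "\<tau> j \<in> borel_measurable seq_space" using \<tau> IJ that by auto
    show ?thesis unfolding \<tau>'_def [abs_def] by measurable
  qed
  have [measurable]: "(\<lambda>x. \<Sum>j\<in>K. C (\<tau> j) j x) \<in> borel_measurable W"
      "(\<lambda>x. \<Sum>j\<in>L. C (\<tau> j) j x) \<in> borel_measurable W" "(\<lambda>x. \<Sum>j\<in>K. C (\<tau>' j) j x) \<in> borel_measurable W"
    using C_meas \<tau> \<tau>' IJ by (auto intro!: borel_measurable_sum)
  have A: "(\<integral>\<^sup>+x. h x * (\<Sum>j\<in>I. C (\<tau> j) j x) \<partial>W) \<le> R"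
  proof -
    have "AE x in W. \<forall>j\<in>L. (x j)\<^sup>2 \<le> extremal \<alpha> P0 j"
    proof (rule AE_finite_allI)
      fix j assume j: "j \<in> L"
      have "AE u in \<pi> j. u\<^sup>2 \<le> extremal \<alpha> P0 j"
        unfolding \<pi>_def using j \<alpha> by (intro AE_prior_bounded) (auto simp: L_def)
      then show "AE x in W. (x j)\<^sup>2 \<le> extremal \<alpha> P0 j"
        unfolding W_def using \<pi> j IJ by (intro AE_PiM_component) auto
    qed (use IJ in simp)
    then have "AE x in W. h x * (\<Sum>j\<in>I. C (\<tau> j) j x) \<le> R"
    proof eventually_elim
      case (elim x)
      show ?case
      proof (cases "tails_within \<alpha> P0 m J x")
        case True
        let ?x = "zero_extend I x"
        have "?x \<in> B \<alpha> P0"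
        proof (rule B_memI)
          fix k assume k: "1 \<le> k" "k \<le> J"
          have eq: "(\<Sum>j=k..J. (?x j)\<^sup>2) = (\<Sum>j=k..J. (x j)\<^sup>2)"
            using k by (intro sum.cong) (auto simp: zero_extend_def I_def)
          show "(\<Sum>j=k..J. (?x j)\<^sup>2) \<le> tail_bound \<alpha> P0 k"
          proof (cases "m \<le> k")
            case True
            then show ?thesis using \<open>tails_within \<alpha> P0 m J x\<close> k unfolding eq tails_within_def by auto
          next
            case False
            \<comment> \<open>The allowance at \<open>k\<close> is the one at \<open>m\<close> plus the extremal coordinates in between.\<close>
            have "{k..J} = {k..<m} \<union> {m..J}" using False m k by auto
            then have "(\<Sum>j=k..J. (x j)\<^sup>2) = (\<Sum>j=k..<m. (x j)\<^sup>2) + (\<Sum>j=m..J. (x j)\<^sup>2)"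
              by (simp add: sum.union_disjoint ivl_disj_int)
            also have "\<dots> \<le> (\<Sum>j=k..<m. extremal \<alpha> P0 j) + tail_bound \<alpha> P0 m"
              using elim \<open>tails_within \<alpha> P0 m J x\<close> m k unfolding tails_within_def by (intro add_mono sum_mono) (auto simp: L_def)
            also have "\<dots> = tail_bound \<alpha> P0 k"
              using False by (subst sum_extremal) auto
            finally show ?thesis unfolding eq .
          qed
        qed (use \<alpha> in \<open>auto simp: zero_extend_def I_def\<close>)
        have "(\<Sum>j\<in>I. C (\<tau> j) j x) = (\<integral>\<^sup>+z. ennreal (\<Sum>j\<in>I. (\<tau> j (obs x z) - x j)\<^sup>2) \<partial>noise)"
          by (rule C_sum) (rule \<tau>)
        also have "\<dots> \<le> (\<integral>\<^sup>+z. norm_sq (\<lambda>j. T (observe s ?x z) j - ?x j) \<partial>noise)"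
        proof (rule nn_integral_mono)
          fix z
          have "ennreal (\<Sum>j\<in>I. (\<tau> j (obs x z) - x j)\<^sup>2) = (\<Sum>j\<in>{1..J}. ennreal ((T (observe s ?x z) j - ?x j)\<^sup>2))"
            by (subst sum_ennreal) (auto simp: \<tau>_def obs_def zero_extend_def I_def intro!: sum.cong arg_cong [where f = ennreal])
          also have "\<dots> \<le> norm_sq (\<lambda>j. T (observe s ?x z) j - ?x j)"
            by (rule norm_sq_ge_sum)
          finally show "ennreal (\<Sum>j\<in>I. (\<tau> j (obs x z) - x j)\<^sup>2) \<le> norm_sq (\<lambda>j. T (observe s ?x z) j - ?x j)" .
        qed
        also have "\<dots> \<le> R" using \<open>?x \<in> B \<alpha> P0\<close> by (rule R)
        finally show ?thesis using True by (simp add: h_def)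
      qed (simp add: h_def)
    qed
    then have "(\<integral>\<^sup>+x. h x * (\<Sum>j\<in>I. C (\<tau> j) j x) \<partial>W) \<le> (\<integral>\<^sup>+x. R \<partial>W)"
      by (rule nn_integral_mono_AE)
    then show ?thesis by (simp add: W.emeasure_space_1)
  qed
  have split: "(\<integral>\<^sup>+x. h x * (\<Sum>j\<in>I. C (\<tau> j) j x) \<partial>W)
      = (\<integral>\<^sup>+x. h x * (\<Sum>j\<in>L. C (\<tau> j) j x) \<partial>W) + (\<integral>\<^sup>+x. h x * (\<Sum>j\<in>K. C (\<tau> j) j x) \<partial>W)"
  proof -
    have "(\<Sum>j\<in>I. C (\<tau> j) j x) = (\<Sum>j\<in>L. C (\<tau> j) j x) + (\<Sum>j\<in>K. C (\<tau> j) j x)" for x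
      unfolding IJ(1) using IJ by (intro sum.union_disjoint) auto
    then show ?thesis by (simp add: distrib_left nn_integral_add)
  qed
  have low: "ennreal ((1 - p) * (\<Sum>j\<in>L. \<rho> j)) \<le> (\<integral>\<^sup>+x. h x * (\<Sum>j\<in>L. C (\<tau> j) j x) \<partial>W)"
  proof -
    have "ennreal ((1 - p) * (\<Sum>j\<in>L. \<rho> j)) = (\<Sum>j\<in>L. ennreal (\<rho> j)) * ennreal (1 - p)"
      using \<rho>(2) p by (subst sum_ennreal) (auto simp: L_def ennreal_mult' mult.commute [of _ "ennreal (1 - p)"])
    also have "\<dots> \<le> (\<Sum>j\<in>L. ennreal (\<rho> j)) * (\<integral>\<^sup>+x. h x \<partial>W)"
      by (intro mult_left_mono int_h) simp
    also have "\<dots> \<le> (\<Sum>j\<in>L. \<integral>\<^sup>+x. h x * C (\<tau> j) j x \<partial>W)"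
      unfolding sum_distrib_right
    proof (rule sum_mono)
      fix j assume j: "j \<in> L"
      show "ennreal (\<rho> j) * (\<integral>\<^sup>+x. h x \<partial>W) \<le> (\<integral>\<^sup>+x. h x * C (\<tau> j) j x \<partial>W)"
      proof (rule C_bayes)
        show "h (x(j := u)) = h x" for x u
          using j by (auto simp: h_def tails_within_def L_def intro!: sum.cong)
      qed (use j IJ \<tau> in auto)
    qed
    also have "\<dots> = (\<integral>\<^sup>+x. h x * (\<Sum>j\<in>L. C (\<tau> j) j x) \<partial>W)"
      unfolding sum_distrib_left using IJ C_meas \<tau> by (intro nn_integral_sum [symmetric]) auto
    finally show ?thesis .
  qed
  have "ennreal (\<Sum>j\<in>K. \<rho> j) \<le> (\<integral>\<^sup>+x. (\<Sum>j\<in>K. C (\<tau>' j) j x) \<partial>W)"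
  proof -
    have "ennreal (\<Sum>j\<in>K. \<rho> j) = (\<Sum>j\<in>K. ennreal (\<rho> j))"
      using \<rho>(2) m by (intro sum_ennreal [symmetric]) (auto simp: K_def)
    also have "\<dots> \<le> (\<Sum>j\<in>K. \<integral>\<^sup>+x. C (\<tau>' j) j x \<partial>W)"
    proof (rule sum_mono)
      fix j assume "j \<in> K"
      then show "ennreal (\<rho> j) \<le> (\<integral>\<^sup>+x. C (\<tau>' j) j x \<partial>W)"
        using C_bayes [of j "\<tau>' j" "\<lambda>_. 1"] \<tau>' IJ by (auto simp: W.emeasure_space_1)
    qed
    also have "\<dots> = (\<integral>\<^sup>+x. (\<Sum>j\<in>K. C (\<tau>' j) j x) \<partial>W)"
      using IJ C_meas \<tau>' by (intro nn_integral_sum [symmetric]) auto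
    finally show ?thesis .
  qed
  also have "\<dots> = (\<integral>\<^sup>+x. h x * (\<Sum>j\<in>K. C (\<tau>' j) j x) + g x * (\<Sum>j\<in>K. C (\<tau>' j) j x) \<partial>W)"
    unfolding distrib_right [symmetric] hg by simp
  also have "\<dots> = (\<integral>\<^sup>+x. h x * (\<Sum>j\<in>K. C (\<tau>' j) j x) \<partial>W) + (\<integral>\<^sup>+x. g x * (\<Sum>j\<in>K. C (\<tau>' j) j x) \<partial>W)"
    by (rule nn_integral_add) measurable
  also have "\<dots> \<le> (\<integral>\<^sup>+x. h x * (\<Sum>j\<in>K. C (\<tau> j) j x) \<partial>W) + ennreal (12 * sqrt p * V)"
  proof (rule add_mono)
    show "(\<integral>\<^sup>+x. h x * (\<Sum>j\<in>K. C (\<tau>' j) j x) \<partial>W) \<le> (\<integral>\<^sup>+x. h x * (\<Sum>j\<in>K. C (\<tau> j) j x) \<partial>W)"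
    proof (rule nn_integral_mono)
      fix x
      show "h x * (\<Sum>j\<in>K. C (\<tau>' j) j x) \<le> h x * (\<Sum>j\<in>K. C (\<tau> j) j x)"
      proof (cases "tails_within \<alpha> P0 m J x")
        case True
        then have "(\<Sum>j\<in>K. (x j)\<^sup>2) \<le> V" using m by (auto simp: tails_within_def K_def V_def)
        then have "(\<Sum>j\<in>K. (\<tau>' j y - x j)\<^sup>2) \<le> (\<Sum>j\<in>K. (\<tau> j y - x j)\<^sup>2)" for y
          unfolding \<tau>'_def by (rule truncation_reduces_loss)
        then have "(\<Sum>j\<in>K. C (\<tau>' j) j x) \<le> (\<Sum>j\<in>K. C (\<tau> j) j x)"
          using \<tau> \<tau>' IJ by (subst (1 2) C_sum) (auto intro!: nn_integral_mono ennreal_leI)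
        then show ?thesis by (rule mult_left_mono) simp
      qed (simp add: h_def)
    qed
    have "(\<integral>\<^sup>+x. g x * (\<Sum>j\<in>K. C (\<tau>' j) j x) \<partial>W)
        \<le> (\<integral>\<^sup>+x. ennreal (8 * V) * g x + 2 * (g x * ennreal (\<Sum>j\<in>K. (x j)\<^sup>2)) \<partial>W)"
    proof (rule nn_integral_mono)
      fix x
      have "(\<Sum>j\<in>K. C (\<tau>' j) j x) = (\<integral>\<^sup>+z. ennreal (\<Sum>j\<in>K. (\<tau>' j (obs x z) - x j)\<^sup>2) \<partial>noise)"
        by (rule C_sum) (rule \<tau>')
      also have "\<dots> \<le> (\<integral>\<^sup>+z. ennreal (8 * V + 2 * (\<Sum>j\<in>K. (x j)\<^sup>2)) \<partial>noise)"
        unfolding \<tau>'_def using V by (intro nn_integral_mono ennreal_leI truncated_loss_le) auto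
      also have "\<dots> = ennreal (8 * V) + 2 * ennreal (\<Sum>j\<in>K. (x j)\<^sup>2)"
        using V by (simp add: noise.emeasure_space_1 ennreal_plus ennreal_mult' sum_nonneg)
      finally have "g x * (\<Sum>j\<in>K. C (\<tau>' j) j x) \<le> g x * (ennreal (8 * V) + 2 * ennreal (\<Sum>j\<in>K. (x j)\<^sup>2))"
        by (rule mult_left_mono) simp
      then show "g x * (\<Sum>j\<in>K. C (\<tau>' j) j x) \<le> ennreal (8 * V) * g x + 2 * (g x * ennreal (\<Sum>j\<in>K. (x j)\<^sup>2))"
        by (simp only: distrib_left mult.commute mult.left_commute)
    qed
    also have "\<dots> = ennreal (8 * V) * (\<integral>\<^sup>+x. g x \<partial>W) + 2 * (\<integral>\<^sup>+x. g x * ennreal (\<Sum>j\<in>K. (x j)\<^sup>2) \<partial>W)"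
    proof -
      have [measurable]: "(\<lambda>x. \<Sum>j\<in>K. (x j)\<^sup>2) \<in> borel_measurable W" using IJ by (intro energy) auto
      show ?thesis by (simp add: nn_integral_add nn_integral_cmult)
    qed
    also have "\<dots> \<le> ennreal (8 * V) * ennreal p + 2 * ennreal (2 * sqrt p * V)"
    proof (intro add_mono mult_left_mono int_g)
      show "(\<integral>\<^sup>+x. g x * ennreal (\<Sum>j\<in>K. (x j)\<^sup>2) \<partial>W) \<le> ennreal (2 * sqrt p * V)"
        unfolding W_def
      proof (rule energy_on_rare_event [where v = "\<lambda>j. (1 - \<delta>) * extremal \<alpha> P0 j"])
        show "0 < (1 - \<delta>) * extremal \<alpha> P0 i" if "i \<in> K" for i
          using that m \<alpha> \<delta> extremal_pos [of \<alpha> P0 i] by (auto simp: K_def)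
        have "(\<Sum>i\<in>K. (1 - \<delta>) * extremal \<alpha> P0 i) = (1 - \<delta>) * (\<Sum>i\<in>K. extremal \<alpha> P0 i)"
          by (simp add: sum_distrib_left)
        also have "\<dots> \<le> (1 - \<delta>) * V"
          unfolding K_def V_def using \<alpha> \<delta> m by (intro mult_left_mono sum_extremal_le) auto
        also have "\<dots> \<le> 1 * V" using V \<delta> by (intro mult_right_mono) auto
        finally show "(\<Sum>i\<in>K. (1 - \<delta>) * extremal \<alpha> P0 i) \<le> V" by simp
        show "\<pi> i = centred_normal ((1 - \<delta>) * extremal \<alpha> P0 i)" if "i \<in> K" for i
          using that by (simp add: \<pi>_def prior_def K_def)
        show "g \<in> borel_measurable (PiM I \<pi>)" unfolding W_def [symmetric] by measurable
        show "(\<integral>\<^sup>+x. g x \<partial>PiM I \<pi>) \<le> ennreal p" using int_g by (simp add: W_def)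
      qed (use IJ \<pi> V p in \<open>auto simp: g_def\<close>)
    qed auto
    also have "\<dots> = ennreal (8 * p * V + 4 * sqrt p * V)"
      using V p by (simp add: ennreal_mult' [symmetric] ennreal_plus [symmetric] ac_simps
        flip: ennreal_numeral del: ennreal_plus)
    also have "\<dots> \<le> ennreal (12 * sqrt p * V)"
    proof (rule ennreal_leI)
      have "p \<le> sqrt p" using p by (metis real_le_rsqrt power2_eq_square mult_left_le less_imp_le)
      then have "8 * p * V \<le> 8 * sqrt p * V" using V by (intro mult_right_mono) auto
      then show "8 * p * V + 4 * sqrt p * V \<le> 12 * sqrt p * V"
        by (simp add: algebra_simps)
    qed
    finally show "(\<integral>\<^sup>+x. g x * (\<Sum>j\<in>K. C (\<tau>' j) j x) \<partial>W) \<le> ennreal (12 * sqrt p * V)" .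
  qed
  finally have high: "ennreal (\<Sum>j\<in>K. \<rho> j) \<le> (\<integral>\<^sup>+x. h x * (\<Sum>j\<in>K. C (\<tau> j) j x) \<partial>W) + ennreal (12 * sqrt p * V)" .
  have nn: "0 \<le> (\<Sum>j\<in>K. \<rho> j)" "0 \<le> (\<Sum>j\<in>L. \<rho> j)"
    using \<rho>(2) m by (auto simp: K_def L_def intro!: sum_nonneg)
  have "ennreal ((1 - p) * (\<Sum>j\<in>{1..J}. \<rho> j)) \<le> ennreal ((1 - p) * (\<Sum>j\<in>L. \<rho> j) + (\<Sum>j\<in>K. \<rho> j))"
  proof (rule ennreal_leI)
    have "(\<Sum>j\<in>{1..J}. \<rho> j) = (\<Sum>j\<in>L. \<rho> j) + (\<Sum>j\<in>K. \<rho> j)"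
      using IJ sum.union_disjoint [of L K \<rho>] by (simp add: I_def)
    moreover have "(1 - p) * (\<Sum>j\<in>K. \<rho> j) \<le> 1 * (\<Sum>j\<in>K. \<rho> j)"
      using nn p by (intro mult_right_mono) auto
    ultimately show "(1 - p) * (\<Sum>j\<in>{1..J}. \<rho> j) \<le> (1 - p) * (\<Sum>j\<in>L. \<rho> j) + (\<Sum>j\<in>K. \<rho> j)"
      by (simp add: distrib_left)
  qed
  also have "\<dots> = ennreal ((1 - p) * (\<Sum>j\<in>L. \<rho> j)) + ennreal (\<Sum>j\<in>K. \<rho> j)"
    using nn p by (intro ennreal_plus) auto
  also have "\<dots> \<le> (\<integral>\<^sup>+x. h x * (\<Sum>j\<in>L. C (\<tau> j) j x) \<partial>W)
      + ((\<integral>\<^sup>+x. h x * (\<Sum>j\<in>K. C (\<tau> j) j x) \<partial>W) + ennreal (12 * sqrt p * V))"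
    by (rule add_mono [OF low high])
  also have "\<dots> = (\<integral>\<^sup>+x. h x * (\<Sum>j\<in>I. C (\<tau> j) j x) \<partial>W) + ennreal (12 * sqrt p * V)"
    by (simp add: split add.assoc)
  also have "\<dots> \<le> R + ennreal (12 * sqrt p * V)" using A by (rule add_right_mono)
  finally show ?thesis unfolding V_def .
qed

section \<open>Risk of the linear estimator\<close>

lemma nn_integral_linear_loss:
  "(\<integral>\<^sup>+z. norm_sq (\<lambda>j. linear_estimator l (observe s x z) j - x j) \<partial>noise)
    = (\<Sum>i. ennreal ((1 - l (Suc i))\<^sup>2 * (x (Suc i))\<^sup>2 + (l (Suc i))\<^sup>2 * (s (Suc i))\<^sup>2))"
proof -
  have eq: "linear_estimator l (observe s x z) (Suc i) - x (Suc i)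
      = - ((1 - l (Suc i)) * x (Suc i)) + l (Suc i) * s (Suc i) * z (Suc i)" for z i
    by (simp add: linear_estimator_def observe_def algebra_simps)
  have gm: "(\<lambda>u. ennreal ((p + q * u)\<^sup>2)) \<in> borel_measurable gauss" for p q :: real
    by measurable
  have [measurable]: "(\<lambda>z. z (Suc i)) \<in> borel_measurable noise" for i by measurable
  have "(\<integral>\<^sup>+z. norm_sq (\<lambda>j. linear_estimator l (observe s x z) j - x j) \<partial>noise)
      = (\<Sum>i. \<integral>\<^sup>+z. ennreal ((- ((1 - l (Suc i)) * x (Suc i)) + l (Suc i) * s (Suc i) * z (Suc i))\<^sup>2) \<partial>noise)"
    unfolding norm_sq_def eq by (rule nn_integral_suminf) measurable
  also have "\<dots> = (\<Sum>i. ennreal ((1 - l (Suc i))\<^sup>2 * (x (Suc i))\<^sup>2 + (l (Suc i))\<^sup>2 * (s (Suc i))\<^sup>2))"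
  proof (rule arg_cong [where f = suminf], rule ext)
    fix i
    have "(\<integral>\<^sup>+z. ennreal ((- ((1 - l (Suc i)) * x (Suc i)) + l (Suc i) * s (Suc i) * z (Suc i))\<^sup>2) \<partial>noise)
      = (\<integral>\<^sup>+u. ennreal ((- ((1 - l (Suc i)) * x (Suc i)) + l (Suc i) * s (Suc i) * u)\<^sup>2) \<partial>gauss)"
      unfolding noise_def
      by (rule nn_integral_PiM_component [OF prob_space_gauss _ gm]) simp
    then show "(\<integral>\<^sup>+z. ennreal ((- ((1 - l (Suc i)) * x (Suc i)) + l (Suc i) * s (Suc i) * z (Suc i))\<^sup>2) \<partial>noise)
      = ennreal ((1 - l (Suc i))\<^sup>2 * (x (Suc i))\<^sup>2 + (l (Suc i))\<^sup>2 * (s (Suc i))\<^sup>2)"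
      unfolding gauss_quadratic by (simp only: power_mult_distrib power2_minus)
  qed
  finally show ?thesis .
qed

lemma linear_estimator_measurable: "linear_estimator l \<in> measurable seq_space seq_space"
  unfolding linear_estimator_def seq_space_def by measurable

lemma suminf_ennreal_le_of_partial_sums:
  fixes g e :: "nat \<Rightarrow> real"
  assumes g: "\<And>i. g i \<ge> 0" and le: "\<And>N. N \<ge> N0 \<Longrightarrow> (\<Sum>i<N. g i) \<le> c + e N" and e: "e \<longlonglongrightarrow> 0"
  shows "(\<Sum>i. ennreal (g i)) \<le> ennreal c"
proof (rule suminf_le_const)
  fix n
  have "(\<Sum>i<n. g i) \<le> c + 0"
  proof (rule LIMSEQ_le_const)
    show "(\<lambda>N. c + e N) \<longlonglongrightarrow> c + 0" by (intro tendsto_intros e)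
    have "(\<Sum>i<n. g i) \<le> c + e N" if "N \<ge> max n N0" for N
      using sum_mono2 [of "{..<N}" "{..<n}" g] g le [of N] that by fastforce
    then show "\<exists>M. \<forall>N\<ge>M. (\<Sum>i<n. g i) \<le> c + e N" by blast
  qed
  then show "(\<Sum>i<n. ennreal (g i)) \<le> ennreal c"
    using g by (simp add: sum_ennreal ennreal_leI)
qed simp

text \<open>
The assumptions on the noise levels, with names for the two constants whose existence is assumed.
\<close>

locale inverse_problem =
  fixes \<alpha> P0 :: real and \<sigma> :: "nat \<Rightarrow> real" and c :: real and j0 :: nat
  assumes \<alpha>: "\<alpha> > 0" and P0: "P0 > 0"
    and \<sigma>: "\<And>j. j \<ge> 1 \<Longrightarrow> \<sigma> j > 0"
    and c: "c > 0" "\<And>j. j \<ge> 1 \<Longrightarrow> c < (\<sigma> j)\<^sup>2"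
    and j0: "j0 \<ge> 1"
    and ratio: "\<And>j. j > j0 \<Longrightarrow> (\<sigma> j)\<^sup>2 * real j powr (2 * \<alpha> + 1)
             / ((\<sigma> (j - 1))\<^sup>2 * real (j - 1) powr (2 * \<alpha> + 1)) > 1"
begin

abbreviation a :: "nat \<Rightarrow> real" where "a \<equiv> spectrum \<alpha> P0"

text \<open>
\<open>\<epsilon>\<^sup>2\<close> times this quantity is the noise-to-signal ratio of coordinate \<open>j\<close>. By assumption it is
nondecreasing from \<open>j0\<close> on.
\<close>

definition noise_ratio :: "nat \<Rightarrow> real" where "noise_ratio j = (\<sigma> j)\<^sup>2 / a j"

text \<open>
The Bayes risk for the normal prior with variance \<^term>\<open>a j\<close>; it is also the contribution of
coordinate \<open>j\<close> to the claimed minimax risk.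
\<close>

definition bayes_term :: "real \<Rightarrow> nat \<Rightarrow> real" where
  "bayes_term \<epsilon> j = a j * (\<epsilon> * \<sigma> j)\<^sup>2 / (a j + (\<epsilon> * \<sigma> j)\<^sup>2)"

definition bayes_sum :: "real \<Rightarrow> real" where "bayes_sum \<epsilon> = (\<Sum>i. bayes_term \<epsilon> (Suc i))"

lemma a_pos: "j \<ge> 1 \<Longrightarrow> a j > 0"
  using spectrum_pos \<alpha> P0 by blast

lemma noise_ratio_eq: "j \<ge> 1 \<Longrightarrow> noise_ratio j = (\<sigma> j)\<^sup>2 * real j powr (2 * \<alpha> + 1) / (2 * \<alpha> * P0)"
  using powr_minus_divide [of "real j" "2 * \<alpha> + 1"] by (simp add: noise_ratio_def spectrum_def mult.commute)

lemma noise_ratio_Suc: "j \<ge> j0 \<Longrightarrow> noise_ratio j \<le> noise_ratio (Suc j)"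
proof -
  assume j: "j \<ge> j0"
  have pos: "(\<sigma> j)\<^sup>2 * real j powr (2 * \<alpha> + 1) > 0" using \<sigma> [of j] j j0 by simp
  have "(\<sigma> (Suc j))\<^sup>2 * real (Suc j) powr (2 * \<alpha> + 1) / ((\<sigma> j)\<^sup>2 * real j powr (2 * \<alpha> + 1)) > 1"
    using ratio [of "Suc j"] j by simp
  then have "(\<sigma> j)\<^sup>2 * real j powr (2 * \<alpha> + 1) \<le> (\<sigma> (Suc j))\<^sup>2 * real (Suc j) powr (2 * \<alpha> + 1)"
    using pos by (simp add: less_divide_eq)
  then show ?thesis
    using j j0 \<alpha> P0 unfolding noise_ratio_eq [of j, OF order_trans [OF j0 j]] noise_ratio_eq [of "Suc j", simplified]
    by (intro divide_right_mono) auto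
qed

lemma noise_ratio_mono:
  assumes "j0 \<le> i" "i \<le> j" shows "noise_ratio i \<le> noise_ratio j"
  using assms(2,1)
proof (induction j rule: dec_induct)
  case (step n)
  then show ?case using noise_ratio_Suc [of n] by linarith
qed simp

lemma noise_ratio_pos: "j \<ge> 1 \<Longrightarrow> noise_ratio j > 0"
  using a_pos [of j] \<sigma> [of j] by (simp add: noise_ratio_def)

text \<open>
Here the lower bound on the noise levels is used: the powers of \<open>j\<close> alone force the ratio to
infinity.
\<close>

lemma noise_ratio_unbounded: "\<exists>j\<ge>1. K \<le> noise_ratio j"
proof -
  define j where "j = max 1 (nat \<lceil>K * (2 * \<alpha> * P0) / c\<rceil>)"
  have j: "j \<ge> 1" "K * (2 * \<alpha> * P0) / c \<le> real j"
    unfolding j_def by linarith+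
  have "K * (2 * \<alpha> * P0) \<le> c * real j powr 1"
    using j c(1) by (simp add: divide_le_eq mult.commute)
  also have "\<dots> \<le> (\<sigma> j)\<^sup>2 * real j powr (2 * \<alpha> + 1)"
    using c(2) [of j] c(1) j \<alpha> by (intro mult_mono powr_mono) auto
  finally have "K \<le> noise_ratio j"
    using \<alpha> P0 by (simp add: noise_ratio_eq [OF j(1)] le_divide_eq)
  then show ?thesis using j by blast
qed

lemma bayes_term_nonneg: "j \<ge> 1 \<Longrightarrow> bayes_term \<epsilon> j \<ge> 0"
  using a_pos [of j] by (simp add: bayes_term_def)

lemma bayes_term_le_spectrum:
  assumes "j \<ge> 1" shows "bayes_term \<epsilon> j \<le> a j"
proof -
  have "a j + (\<epsilon> * \<sigma> j)\<^sup>2 > 0" using a_pos [OF assms] by (intro add_pos_nonneg) auto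
  then show ?thesis using a_pos [OF assms] by (simp add: bayes_term_def divide_le_eq)
qed

lemma bayes_term_le_noise:
  assumes "j \<ge> 1" shows "bayes_term \<epsilon> j \<le> (\<epsilon> * \<sigma> j)\<^sup>2"
proof -
  have "a j + (\<epsilon> * \<sigma> j)\<^sup>2 > 0" using a_pos [OF assms] by (intro add_pos_nonneg) auto
  then show ?thesis by (simp add: bayes_term_def divide_le_eq distrib_left mult.commute)
qed

lemma summable_bayes_term: "summable (\<lambda>i. bayes_term \<epsilon> (Suc i))"
proof (rule summable_comparison_test')
  have "summable (\<lambda>i. real i powr (- 2 * \<alpha> - 1))" using \<alpha> by (simp add: summable_real_powr_iff)
  then have "summable (\<lambda>i. real (Suc i) powr (- 2 * \<alpha> - 1))" by (subst summable_Suc_iff)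
  then show "summable (\<lambda>i. a (Suc i))" unfolding spectrum_def by (rule summable_mult)
  show "norm (bayes_term \<epsilon> (Suc i)) \<le> a (Suc i)" for i
    using bayes_term_nonneg [of "Suc i" \<epsilon>] bayes_term_le_spectrum [of "Suc i" \<epsilon>] by simp
qed

lemma partial_sum_le_bayes_sum: "(\<Sum>j\<in>{1..N}. bayes_term \<epsilon> j) \<le> bayes_sum \<epsilon>"
proof -
  have "(\<Sum>j\<in>{1..N}. bayes_term \<epsilon> j) = (\<Sum>i<N. bayes_term \<epsilon> (Suc i))"
    by (rule sum.reindex_bij_witness [of _ Suc "\<lambda>j. j - 1"]) auto
  also have "\<dots> \<le> bayes_sum \<epsilon>"
    unfolding bayes_sum_def using bayes_term_nonneg by (intro sum_le_suminf summable_bayes_term) auto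
  finally show ?thesis .
qed

lemma bayes_sum_tendsto: "(\<lambda>N. \<Sum>j\<in>{1..N}. bayes_term \<epsilon> j) \<longlonglongrightarrow> bayes_sum \<epsilon>"
proof -
  have "(\<Sum>j\<in>{1..N}. bayes_term \<epsilon> j) = (\<Sum>i<N. bayes_term \<epsilon> (Suc i))" for N
    by (rule sum.reindex_bij_witness [of _ Suc "\<lambda>j. j - 1"]) auto
  then show ?thesis
    unfolding bayes_sum_def using summable_LIMSEQ [OF summable_bayes_term] by simp
qed

lemma risk_formula_eq: "risk_formula \<alpha> P0 \<sigma> \<epsilon> = ennreal (bayes_sum \<epsilon>)"
proof -
  have "risk_formula \<alpha> P0 \<sigma> \<epsilon> = (\<Sum>i. ennreal (\<epsilon>\<^sup>2) * ennreal (a (Suc i) * (\<sigma> (Suc i))\<^sup>2 / (a (Suc i) + \<epsilon>\<^sup>2 * (\<sigma> (Suc i))\<^sup>2)))"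
    unfolding risk_formula_def Let_def spectrum_def by (rule ennreal_suminf_cmult [symmetric])
  also have "\<dots> = (\<Sum>i. ennreal (bayes_term \<epsilon> (Suc i)))"
    by (rule arg_cong [where f = suminf], rule ext)
       (simp add: ennreal_mult' [symmetric] bayes_term_def power_mult_distrib ac_simps)
  also have "\<dots> = ennreal (bayes_sum \<epsilon>)"
    unfolding bayes_sum_def using bayes_term_nonneg by (intro suminf_ennreal2 summable_bayes_term) auto
  finally show ?thesis .
qed

lemma weight_eq: "weight \<alpha> P0 \<sigma> \<epsilon> j = a j / (a j + (\<epsilon> * \<sigma> j)\<^sup>2)"
  by (simp add: weight_def spectrum_def power_mult_distrib)

lemma one_minus_weight:
  assumes "j \<ge> 1" shows "1 - weight \<alpha> P0 \<sigma> \<epsilon> j = (\<epsilon> * \<sigma> j)\<^sup>2 / (a j + (\<epsilon> * \<sigma> j)\<^sup>2)"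
  using a_pos [OF assms] by (simp add: weight_eq divide_simps add_pos_nonneg less_imp_neq [symmetric])

text \<open>
The constant in front of \<open>\<epsilon>\<^sup>4\<close> in the bound for the bias of the coordinates before \<open>j0\<close>.
\<close>

definition low_frequency_bias :: real where "low_frequency_bias = P0 * (\<Sum>j\<in>{1..<j0}. (noise_ratio j)\<^sup>2)"

text \<open>
From \<open>j0\<close> on the squared bias factors \<open>w j\<close> are nondecreasing, so \<open>abel_majorization\<close> replaces
\<open>(x j)\<^sup>2\<close> by the extremal point; there bias and variance add up to \<^const>\<open>bayes_term\<close>. Before \<open>j0\<close> the
factors are of order \<open>\<epsilon>\<^sup>4\<close>.
\<close>

lemma linear_loss_le:
  assumes \<epsilon>: "\<epsilon> > 0" and x: "x \<in> B \<alpha> P0" and N: "N \<ge> j0"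
  defines "l \<equiv> weight \<alpha> P0 \<sigma> \<epsilon>"
  shows "(\<Sum>j\<in>{1..N}. (1 - l j)\<^sup>2 * (x j)\<^sup>2 + (l j)\<^sup>2 * (\<epsilon> * \<sigma> j)\<^sup>2)
    \<le> bayes_sum \<epsilon> + \<epsilon> ^ 4 * low_frequency_bias + tail_bound \<alpha> P0 (Suc N)"
proof -
  define u where "u j = (\<epsilon> * \<sigma> j)\<^sup>2" for j
  define w where "w j = (1 - l j)\<^sup>2" for j
  have u: "u j > 0" if "j \<ge> 1" for j using \<sigma> [OF that] \<epsilon> by (simp add: u_def)
  have l1: "1 - l j = u j / (a j + u j)" if "j \<ge> 1" for j
    unfolding l_def u_def by (rule one_minus_weight [OF that])
  have l2: "l j = a j / (a j + u j)" for j unfolding l_def u_def by (rule weight_eq)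
  have l01: "0 \<le> 1 - l j" "1 - l j \<le> 1" if "j \<ge> 1" for j
    using u [OF that] a_pos [OF that] by (auto simp: l1 [OF that] divide_le_eq)
  have l3: "1 - l j = 1 - 1 / (1 + \<epsilon>\<^sup>2 * noise_ratio j)" if "j \<ge> 1" for j
    using u [OF that] a_pos [OF that] unfolding l2 u_def noise_ratio_def
    by (simp add: power_mult_distrib divide_simps add_pos_nonneg less_imp_neq [symmetric])
  have w01: "0 \<le> w j" "w j \<le> 1" if "j \<ge> 1" for j
    using l01 [OF that] by (auto simp: w_def power_le_one)
  have wmono: "w j \<le> w (Suc j)" if "j \<ge> j0" for j
  proof -
    have j: "j \<ge> 1" using that j0 by simp
    have "1 / (1 + \<epsilon>\<^sup>2 * noise_ratio (Suc j)) \<le> 1 / (1 + \<epsilon>\<^sup>2 * noise_ratio j)"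
      using noise_ratio_pos [OF j] noise_ratio_Suc [OF that] \<epsilon> by (intro divide_left_mono) (auto intro!: add_mono mult_left_mono mult_pos_pos add_pos_pos)
    then have "1 - l j \<le> 1 - l (Suc j)" using l3 j by simp
    then show ?thesis unfolding w_def using l01 [OF j] by (intro power_mono) auto
  qed
  have fw: "w j * a j + (l j)\<^sup>2 * u j = bayes_term \<epsilon> j" if "j \<ge> 1" for j
  proof -
    have "a j + u j \<noteq> 0" using u [OF that] a_pos [OF that] by simp
    moreover have "w j * a j + (l j)\<^sup>2 * u j = ((u j)\<^sup>2 * a j + (a j)\<^sup>2 * u j) / (a j + u j)\<^sup>2"
      unfolding w_def l1 [OF that] unfolding l2 by (simp add: power_divide add_divide_distrib)
    moreover have "(u j)\<^sup>2 * a j + (a j)\<^sup>2 * u j = a j * u j * (a j + u j)"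
      by (simp add: power2_eq_square algebra_simps)
    moreover have "bayes_term \<epsilon> j = a j * u j / (a j + u j)" by (simp add: bayes_term_def u_def)
    ultimately show ?thesis by (simp add: power2_eq_square)
  qed
  have low: "(\<Sum>j\<in>{1..<j0}. w j * (x j)\<^sup>2) \<le> \<epsilon> ^ 4 * low_frequency_bias"
  proof -
    have "(\<Sum>j\<in>{1..<j0}. w j * (x j)\<^sup>2) \<le> (\<Sum>j\<in>{1..<j0}. (\<epsilon> ^ 4 * (noise_ratio j)\<^sup>2) * P0)"
    proof (rule sum_mono)
      fix j assume "j \<in> {1..<j0}"
      then have j: "j \<ge> 1" by simp
      have "(x j)\<^sup>2 \<le> tail_bound \<alpha> P0 j" using B_tail_le [OF P0 x j, of j] by simp
      also have "\<dots> \<le> P0"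
      proof -
        have "real j powr (- 2 * \<alpha>) \<le> 1 powr (- 2 * \<alpha>)" using j \<alpha> by (intro powr_mono2') auto
        then show ?thesis using P0 by (simp add: tail_bound_def)
      qed
      finally have x2: "(x j)\<^sup>2 \<le> P0" .
      have "u j / (a j + u j) \<le> u j / a j" using u [OF j] a_pos [OF j] by (intro divide_left_mono) auto
      also have "\<dots> = \<epsilon>\<^sup>2 * noise_ratio j" by (simp add: u_def noise_ratio_def power_mult_distrib)
      finally have "1 - l j \<le> \<epsilon>\<^sup>2 * noise_ratio j" using l1 [OF j] by simp
      then have "w j \<le> (\<epsilon>\<^sup>2 * noise_ratio j)\<^sup>2" unfolding w_def using l01 [OF j] by (intro power_mono) auto
      then have "w j \<le> \<epsilon> ^ 4 * (noise_ratio j)\<^sup>2" by (simp add: power_mult_distrib flip: power_mult)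
      then show "w j * (x j)\<^sup>2 \<le> (\<epsilon> ^ 4 * (noise_ratio j)\<^sup>2) * P0" using x2 w01 [OF j] by (intro mult_mono) auto
    qed
    then show ?thesis by (simp add: low_frequency_bias_def sum_distrib_left sum_distrib_right ac_simps)
  qed
  \<comment> \<open>The mass of the extremal point beyond \<open>N\<close> is moved to \<open>N\<close>, so that its tails up to \<open>N\<close> still dominate.\<close>
  define v where "v j = extremal \<alpha> P0 j + (if j = N then tail_bound \<alpha> P0 (Suc N) else 0)" for j
  have "(\<Sum>j\<in>{j0..N}. w j * (x j)\<^sup>2) \<le> (\<Sum>j\<in>{j0..N}. w j * v j)"
  proof (rule abel_majorization [OF N])
    fix i assume i: "j0 \<le> i" "i \<le> N"
    have "(\<Sum>j=i..N. v j) = (\<Sum>j=i..N. extremal \<alpha> P0 j) + tail_bound \<alpha> P0 (Suc N)"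
      using i by (simp add: v_def sum.distrib)
    also have "(\<Sum>j=i..N. extremal \<alpha> P0 j) = tail_bound \<alpha> P0 i - tail_bound \<alpha> P0 (Suc N)"
      using sum_extremal [of i "Suc N" \<alpha> P0] i by (simp add: atLeastLessThanSuc_atLeastAtMost)
    finally show "(\<Sum>j=i..N. (x j)\<^sup>2) \<le> (\<Sum>j=i..N. v j)"
      using B_tail_le [OF P0 x, of i N] i j0 by simp
  qed (use w01 wmono j0 in auto)
  also have "\<dots> = (\<Sum>j\<in>{j0..N}. w j * extremal \<alpha> P0 j) + w N * tail_bound \<alpha> P0 (Suc N)"
  proof -
    have "w j * v j = w j * extremal \<alpha> P0 j + (if j = N then w N * tail_bound \<alpha> P0 (Suc N) else 0)" for j
      by (simp add: v_def distrib_left)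
    then show ?thesis using N by (simp add: sum.distrib)
  qed
  also have "\<dots> \<le> (\<Sum>j\<in>{j0..N}. w j * a j) + 1 * tail_bound \<alpha> P0 (Suc N)"
    using w01 extremal_le_spectrum [OF \<alpha> P0] j0 N tail_bound_pos [OF P0, of "Suc N" \<alpha>]
    by (intro add_mono sum_mono mult_left_mono mult_right_mono) auto
  also have "(\<Sum>j\<in>{j0..N}. w j * a j) \<le> (\<Sum>j\<in>{1..N}. w j * a j)"
    using w01 a_pos [THEN less_imp_le] j0 by (intro sum_mono2) auto
  finally have high: "(\<Sum>j\<in>{j0..N}. w j * (x j)\<^sup>2) \<le> (\<Sum>j\<in>{1..N}. w j * a j) + tail_bound \<alpha> P0 (Suc N)"
    by simp
  have "{1..N} = {1..<j0} \<union> {j0..N}" using j0 N by auto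
  then have "(\<Sum>j\<in>{1..N}. w j * (x j)\<^sup>2) = (\<Sum>j\<in>{1..<j0}. w j * (x j)\<^sup>2) + (\<Sum>j\<in>{j0..N}. w j * (x j)\<^sup>2)"
    by (simp add: sum.union_disjoint ivl_disj_int)
  also have "\<dots> \<le> \<epsilon> ^ 4 * low_frequency_bias + ((\<Sum>j\<in>{1..N}. w j * a j) + tail_bound \<alpha> P0 (Suc N))"
    by (rule add_mono [OF low high])
  finally have "(\<Sum>j\<in>{1..N}. w j * (x j)\<^sup>2 + (l j)\<^sup>2 * u j)
      \<le> (\<Sum>j\<in>{1..N}. w j * a j + (l j)\<^sup>2 * u j) + \<epsilon> ^ 4 * low_frequency_bias + tail_bound \<alpha> P0 (Suc N)"
    by (simp add: sum.distrib)
  also have "(\<Sum>j\<in>{1..N}. w j * a j + (l j)\<^sup>2 * u j) = (\<Sum>j\<in>{1..N}. bayes_term \<epsilon> j)"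
    by (intro sum.cong fw) auto
  also have "\<dots> \<le> bayes_sum \<epsilon>" by (rule partial_sum_le_bayes_sum)
  finally show ?thesis by (simp add: w_def u_def)
qed

lemma linear_risk_le:
  assumes "\<epsilon> > 0" and x: "x \<in> B \<alpha> P0"
  shows "(\<integral>\<^sup>+z. norm_sq (\<lambda>j. linear_estimator (weight \<alpha> P0 \<sigma> \<epsilon>) (observe (\<lambda>j. \<epsilon> * \<sigma> j) x z) j - x j) \<partial>noise)
    \<le> ennreal (bayes_sum \<epsilon> + \<epsilon> ^ 4 * low_frequency_bias)"
  unfolding nn_integral_linear_loss
proof (rule suminf_ennreal_le_of_partial_sums)
  fix N assume N: "N \<ge> j0"
  let ?l = "weight \<alpha> P0 \<sigma> \<epsilon>"
  have "(\<Sum>i<N. (1 - ?l (Suc i))\<^sup>2 * (x (Suc i))\<^sup>2 + (?l (Suc i))\<^sup>2 * (\<epsilon> * \<sigma> (Suc i))\<^sup>2)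
      = (\<Sum>j\<in>{1..N}. (1 - ?l j)\<^sup>2 * (x j)\<^sup>2 + (?l j)\<^sup>2 * (\<epsilon> * \<sigma> j)\<^sup>2)"
    by (rule sum.reindex_bij_witness [of _ "\<lambda>j. j - 1" Suc]) auto
  also have "\<dots> \<le> (bayes_sum \<epsilon> + \<epsilon> ^ 4 * low_frequency_bias) + tail_bound \<alpha> P0 (Suc N)"
    by (rule linear_loss_le [OF assms N])
  finally show "(\<Sum>i<N. (1 - ?l (Suc i))\<^sup>2 * (x (Suc i))\<^sup>2 + (?l (Suc i))\<^sup>2 * (\<epsilon> * \<sigma> (Suc i))\<^sup>2)
      \<le> (bayes_sum \<epsilon> + \<epsilon> ^ 4 * low_frequency_bias) + tail_bound \<alpha> P0 (Suc N)" .
next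
  show "(\<lambda>N. tail_bound \<alpha> P0 (Suc N)) \<longlonglongrightarrow> 0"
    using tail_bound_tendsto [OF \<alpha>] by (rule LIMSEQ_Suc)
qed simp

text \<open>
The first coordinate alone suffices to dominate errors of order \<open>\<epsilon>\<^sup>4\<close>.
\<close>

lemma bayes_sum_ge_square:
  assumes "0 < \<epsilon>" "\<epsilon> \<le> 1"
  shows "\<epsilon>\<^sup>2 * bayes_term 1 1 \<le> bayes_sum \<epsilon>"
proof -
  have a1: "a 1 > 0" by (rule a_pos) simp
  have "\<epsilon>\<^sup>2 * bayes_term 1 1 = a 1 * (\<epsilon> * \<sigma> 1)\<^sup>2 / (a 1 + (\<sigma> 1)\<^sup>2)"
    by (simp add: bayes_term_def power_mult_distrib ac_simps)
  also have "\<dots> \<le> bayes_term \<epsilon> 1"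
    unfolding bayes_term_def
  proof (rule divide_left_mono)
    have "\<epsilon>\<^sup>2 * (\<sigma> 1)\<^sup>2 \<le> 1 * (\<sigma> 1)\<^sup>2" using assms by (intro mult_right_mono) (auto simp: power_le_one)
    then show "a 1 + (\<epsilon> * \<sigma> 1)\<^sup>2 \<le> a 1 + (\<sigma> 1)\<^sup>2" by (simp add: power_mult_distrib)
  qed (use a1 in \<open>auto intro!: mult_pos_pos add_pos_nonneg\<close>)
  also have "\<dots> \<le> bayes_sum \<epsilon>" using partial_sum_le_bayes_sum [of \<epsilon> 1] by simp
  finally show ?thesis .
qed

lemma bayes_term_one_pos: "bayes_term 1 1 > 0"
  using a_pos [of 1] \<sigma> [of 1] by (simp add: bayes_term_def add_pos_pos)

end

section \<open>The asymptotic lower bound\<close>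

lemma bayes_risk_ge_mono:
  "bayes_risk_ge \<pi> s \<rho> \<Longrightarrow> \<rho>' \<le> \<rho> \<Longrightarrow> bayes_risk_ge \<pi> s \<rho>'"
  unfolding bayes_risk_ge_def by (meson ennreal_leI order_trans)

text \<open>
If the prior interval is long compared with the noise level, the restriction to it is worth
almost nothing to the estimator.
\<close>

lemma uniform_bayes_efficient:
  assumes r: "r > 0" and s: "s > 0" and \<kappa>: "0 < \<kappa>" "\<kappa> < 1"
    and snr: "24 * s\<^sup>2 \<le> \<kappa> ^ 3 * r\<^sup>2"
  shows "bayes_risk_ge (uniform_measure lborel {-r..r}) s ((1 - \<kappa>) * s\<^sup>2)"
proof -
  \<comment> \<open>With this window both losses, \<open>3 / L\<^sup>2\<close> and \<open>L s / r\<close>, are at most \<open>\<kappa> / 2\<close>.\<close>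
  define L where "L = sqrt (6 / \<kappa>)"
  have L: "L > 0" "L\<^sup>2 = 6 / \<kappa>" using \<kappa> by (auto simp: L_def)
  have "(L * s)\<^sup>2 = 6 * s\<^sup>2 / \<kappa>" by (simp add: power_mult_distrib L)
  also have "\<dots> \<le> (\<kappa> / 2 * r)\<^sup>2"
    using snr \<kappa> by (simp add: divide_le_eq power_mult_distrib power_divide power2_eq_square power3_eq_cube algebra_simps)
  finally have Ls: "L * s \<le> \<kappa> / 2 * r"
    using \<kappa> r by (intro power2_le_imp_le [of "L * s"]) auto
  then have Lr: "L * s / r \<le> \<kappa> / 2" using r by (simp add: divide_le_eq)
  have "\<kappa> / 2 * r \<le> 1 * r" using \<kappa> r by (intro mult_right_mono) auto
  then have "bayes_risk_ge (uniform_measure lborel {-r..r}) s ((1 - L * s / r) * (s\<^sup>2 * (1 - 3 / L\<^sup>2)))"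
    using r s L order_trans [OF Ls] by (intro bayes_risk_uniform) auto
  moreover have "(1 - \<kappa>) * s\<^sup>2 \<le> (1 - L * s / r) * (s\<^sup>2 * (1 - 3 / L\<^sup>2))"
  proof -
    have e: "1 - 3 / L\<^sup>2 = 1 - \<kappa> / 2" using \<kappa> by (simp add: L)
    have "1 - \<kappa> \<le> (1 - \<kappa> / 2) * (1 - \<kappa> / 2)" by (simp add: algebra_simps)
    also have "\<dots> \<le> (1 - L * s / r) * (1 - \<kappa> / 2)" using Lr \<kappa> by (intro mult_right_mono) auto
    finally have "(1 - \<kappa>) * s\<^sup>2 \<le> (1 - L * s / r) * (1 - \<kappa> / 2) * s\<^sup>2" by (rule mult_right_mono) simp
    then show ?thesis unfolding e by (simp add: ac_simps)
  qed
  ultimately show ?thesis by (rule bayes_risk_ge_mono)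
qed

text \<open>
The Bayes risk of a normal prior is increasing and concave in the variance, so shrinking the variance
by a factor \<open>1 - \<kappa>\<close> costs at most that factor.
\<close>

lemma normal_bayes_efficient:
  fixes s a v \<kappa> :: real
  assumes s: "s > 0" and a: "a > 0" and \<kappa>: "0 < \<kappa>" "\<kappa> < 1" and v: "(1 - \<kappa>) * a \<le> v"
  shows "bayes_risk_ge (centred_normal v) s ((1 - \<kappa>) * (a * s\<^sup>2 / (a + s\<^sup>2)))"
proof -
  have v0: "v > 0" using v a \<kappa> by (intro less_le_trans [OF _ v]) auto
  have s2: "s\<^sup>2 > 0" using s by simp
  have "(1 - \<kappa>) * (a * s\<^sup>2 / (a + s\<^sup>2)) \<le> v * s\<^sup>2 / (v + s\<^sup>2)"
  proof -
    have pos: "a + s\<^sup>2 > 0" "v + s\<^sup>2 > 0" using add_pos_pos [OF a s2] add_pos_pos [OF v0 s2] .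
    have "(1 - \<kappa>) * a * (v + s\<^sup>2) \<le> v * (a + s\<^sup>2)"
    proof -
      have "(1 - \<kappa>) * a * v \<le> 1 * a * v" using \<kappa> a v0 by (intro mult_right_mono) auto
      moreover have "(1 - \<kappa>) * a * s\<^sup>2 \<le> v * s\<^sup>2" using v s2 by (intro mult_right_mono) auto
      ultimately show ?thesis by (simp add: algebra_simps)
    qed
    then have "(1 - \<kappa>) * a / (a + s\<^sup>2) \<le> v / (v + s\<^sup>2)"
      using pos by (simp add: divide_le_eq le_divide_eq)
    then have "(1 - \<kappa>) * a / (a + s\<^sup>2) * s\<^sup>2 \<le> v / (v + s\<^sup>2) * s\<^sup>2" using s2 by (intro mult_right_mono) auto
    then show ?thesis by simp
  qed
  with bayes_risk_normal [OF v0 s] show ?thesis by (rule bayes_risk_ge_mono)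
qed

context inverse_problem
begin

text \<open>
Where the noise is not small compared with the signal, each term of the sum is a fixed fraction of
the prior variance, so the sum controls the whole allowed tail.
\<close>

lemma tail_bound_le_bayes_sum:
  assumes m: "m \<ge> 1" and \<eta>: "\<eta> > 0" and noisy: "\<And>j. j \<ge> m \<Longrightarrow> \<eta> * a j \<le> (\<epsilon> * \<sigma> j)\<^sup>2"
  shows "\<eta> / (1 + \<eta>) * tail_bound \<alpha> P0 m \<le> bayes_sum \<epsilon>"
proof -
  have coordinate: "\<eta> / (1 + \<eta>) * extremal \<alpha> P0 j \<le> bayes_term \<epsilon> j" if "j \<ge> m" for j
  proof -
    have j: "j \<ge> 1" using that m by simp
    have pos: "a j > 0" "a j + (\<epsilon> * \<sigma> j)\<^sup>2 > 0" using a_pos [OF j] by (auto intro: add_pos_nonneg)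
    have "\<eta> * (a j + (\<epsilon> * \<sigma> j)\<^sup>2) \<le> (\<epsilon> * \<sigma> j)\<^sup>2 * (1 + \<eta>)"
      using noisy [OF that] by (simp add: algebra_simps)
    then have "\<eta> / (1 + \<eta>) \<le> (\<epsilon> * \<sigma> j)\<^sup>2 / (a j + (\<epsilon> * \<sigma> j)\<^sup>2)"
      using pos \<eta> by (simp add: divide_le_eq le_divide_eq)
    then have "\<eta> / (1 + \<eta>) * a j \<le> (\<epsilon> * \<sigma> j)\<^sup>2 / (a j + (\<epsilon> * \<sigma> j)\<^sup>2) * a j"
      using pos by (intro mult_right_mono) auto
    moreover have "\<eta> / (1 + \<eta>) * extremal \<alpha> P0 j \<le> \<eta> / (1 + \<eta>) * a j"
      using extremal_le_spectrum [OF \<alpha> P0 j] \<eta> by (intro mult_left_mono) auto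
    ultimately show ?thesis by (simp add: bayes_term_def mult.commute)
  qed
  have "\<eta> / (1 + \<eta>) * (tail_bound \<alpha> P0 m - tail_bound \<alpha> P0 N) \<le> bayes_sum \<epsilon>" if N: "N \<ge> m" for N
  proof -
    have "\<eta> / (1 + \<eta>) * (tail_bound \<alpha> P0 m - tail_bound \<alpha> P0 N) = (\<Sum>j=m..<N. \<eta> / (1 + \<eta>) * extremal \<alpha> P0 j)"
      by (simp only: sum_extremal [OF N, symmetric] sum_distrib_left)
    also have "\<dots> \<le> (\<Sum>j=m..<N. bayes_term \<epsilon> j)" by (intro sum_mono coordinate) auto
    also have "\<dots> \<le> (\<Sum>j\<in>{1..N}. bayes_term \<epsilon> j)" using m bayes_term_nonneg by (intro sum_mono2) auto
    also have "\<dots> \<le> bayes_sum \<epsilon>" by (rule partial_sum_le_bayes_sum)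
    finally show ?thesis .
  qed
  moreover have "(\<lambda>N. \<eta> / (1 + \<eta>) * (tail_bound \<alpha> P0 m - tail_bound \<alpha> P0 N)) \<longlonglongrightarrow> \<eta> / (1 + \<eta>) * (tail_bound \<alpha> P0 m - 0)"
    by (intro tendsto_intros tail_bound_tendsto \<alpha>)
  ultimately show ?thesis by (intro LIMSEQ_le_const2 [of _ "\<eta> / (1 + \<eta>) * tail_bound \<alpha> P0 m"]) auto
qed

lemma eventually_signal_dominates:
  assumes "\<eta> > 0"
  shows "\<forall>\<^sub>F \<epsilon> in at_right 0. \<forall>j\<in>{1..<M}. (\<epsilon> * \<sigma> j)\<^sup>2 < \<eta> * a j"
proof (rule eventually_ball_finite)
  show "\<forall>j\<in>{1..<M}. \<forall>\<^sub>F \<epsilon> in at_right 0. (\<epsilon> * \<sigma> j)\<^sup>2 < \<eta> * a j"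
  proof
    fix j assume "j \<in> {1..<M}"
    then have "0 < \<eta> * a j" using a_pos [of j] assms by auto
    moreover have "((\<lambda>\<epsilon>. (\<epsilon> * \<sigma> j)\<^sup>2) \<longlongrightarrow> (0 * \<sigma> j)\<^sup>2) (at_right 0)"
      by (intro tendsto_intros)
    ultimately show "\<forall>\<^sub>F \<epsilon> in at_right 0. (\<epsilon> * \<sigma> j)\<^sup>2 < \<eta> * a j"
      by (intro order_tendstoD(2)) auto
  qed
qed simp

text \<open>
Monotonicity of the noise-to-signal ratio separates the coordinates into an initial segment with
ratio below \<open>\<eta>\<close> and a remainder with ratio at least \<open>\<eta>\<close>. Indices below \<open>j0\<close>, where monotonicity may
fail, are harmless: by assumption they lie in the segment with ratio below \<open>\<eta>\<close>.
\<close>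

lemma crossover:
  assumes \<epsilon>: "\<epsilon> > 0" and "M \<ge> j0" and low: "\<forall>j\<in>{1..<M}. (\<epsilon> * \<sigma> j)\<^sup>2 < \<eta> * a j"
  obtains m where "m \<ge> M" "\<And>j. 1 \<le> j \<Longrightarrow> j < m \<Longrightarrow> (\<epsilon> * \<sigma> j)\<^sup>2 < \<eta> * a j"
    "\<And>j. j \<ge> m \<Longrightarrow> \<eta> * a j \<le> (\<epsilon> * \<sigma> j)\<^sup>2"
proof -
  have iff: "\<eta> * a j \<le> (\<epsilon> * \<sigma> j)\<^sup>2 \<longleftrightarrow> \<eta> / \<epsilon>\<^sup>2 \<le> noise_ratio j" if "j \<ge> 1" for j
    using a_pos [OF that] \<epsilon> by (simp add: noise_ratio_def power_mult_distrib divide_le_eq le_divide_eq mult.commute)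
  let ?P = "\<lambda>j. 1 \<le> j \<and> \<eta> * a j \<le> (\<epsilon> * \<sigma> j)\<^sup>2"
  define m where "m = (LEAST j. ?P j)"
  have "\<exists>j. ?P j" using noise_ratio_unbounded [of "\<eta> / \<epsilon>\<^sup>2"] iff by blast
  then have m: "?P m" unfolding m_def by (rule LeastI_ex)
  have mM: "m \<ge> M" using m low by (meson atLeastLessThan_iff not_le)
  show ?thesis
  proof (rule that [of m])
    show "(\<epsilon> * \<sigma> j)\<^sup>2 < \<eta> * a j" if "1 \<le> j" "j < m" for j
      using not_less_Least [of j ?P] that unfolding m_def by auto
    show "\<eta> * a j \<le> (\<epsilon> * \<sigma> j)\<^sup>2" if "j \<ge> m" for j
    proof -
      have "noise_ratio m \<le> noise_ratio j" using that mM \<open>M \<ge> j0\<close> by (intro noise_ratio_mono) auto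
      then show ?thesis using m iff [of m] iff [of j] that by auto
    qed
  qed (rule mM)
qed

text \<open>
The constants are chosen in the order \<open>\<delta>\<close>, \<open>\<eta>\<close>, \<open>p\<close>, \<open>M\<close>, before \<open>\<epsilon>\<close>: \<open>\<delta>\<close> and \<open>\<eta>\<close> make the priors
efficient up to the factor \<open>1 - \<kappa>\<close>, and \<open>p\<close> makes the restriction error at most \<open>\<kappa>\<close> times the sum. From
\<open>M\<close> on, \<open>b\<^sub>j\<close> is close to \<open>a\<^sub>j\<close> and the constraints are violated with probability below \<open>p\<close>. The bound
must be uniform over the estimators because the minimax risk at a given \<open>\<epsilon>\<close> ranges over all of them.
\<close>

lemma eventually_risk_lower_bound:
  assumes \<kappa>: "0 < \<kappa>" "\<kappa> < 1"
  shows "\<forall>\<^sub>F \<epsilon> in at_right 0. \<forall>T\<in>measurable seq_space seq_space. \<forall>R.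
    (\<forall>x\<in>B \<alpha> P0. (\<integral>\<^sup>+z. norm_sq (\<lambda>j. T (observe (\<lambda>j. \<epsilon> * \<sigma> j) x z) j - x j) \<partial>noise) \<le> R)
      \<longrightarrow> ennreal ((1 - 3 * \<kappa>) * bayes_sum \<epsilon>) \<le> R"
proof -
  define \<delta> where "\<delta> = \<kappa> / 2"
  define \<eta> where "\<eta> = \<kappa> ^ 3 / 24 * 2 powr (- 2 * \<alpha> - 1)"
  define \<theta> where "\<theta> = \<kappa> * \<eta> / (12 * (1 + \<eta>))"
  define p where "p = \<theta>\<^sup>2"
  have \<delta>: "0 < \<delta>" "\<delta> < 1" using \<kappa> by (auto simp: \<delta>_def)
  have \<eta>: "\<eta> > 0" using \<kappa> by (simp add: \<eta>_def)
  have \<theta>: "\<theta> > 0" using \<kappa> \<eta> by (simp add: \<theta>_def)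
  have "\<kappa> * \<eta> \<le> \<kappa> * (12 * (1 + \<eta>))" using \<kappa> \<eta> by (intro mult_left_mono) auto
  then have "\<theta> \<le> \<kappa>" using \<eta> unfolding \<theta>_def by (simp add: divide_le_eq)
  then have "\<theta> * \<theta> \<le> \<kappa> * 1" using \<theta> \<kappa> by (intro mult_mono) auto
  then have p: "0 < p" "p \<le> \<kappa>" "p \<le> 1" "sqrt p = \<theta>" using \<theta> \<kappa> by (auto simp: p_def power2_eq_square)
  obtain M1 where M1: "\<And>j. j \<ge> M1 \<Longrightarrow> (1 - \<delta>) * a j \<le> extremal \<alpha> P0 j"
    using eventually_extremal_ge [OF \<alpha> P0 \<delta>(1)] unfolding eventually_sequentially by auto
  have "\<forall>\<^sub>F m in sequentially. violation_bound \<alpha> \<delta> m < p"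
    using violation_bound_tendsto [OF \<alpha> \<delta>(1)] p(1) by (rule order_tendstoD)
  then obtain M2 where M2: "\<And>m. m \<ge> M2 \<Longrightarrow> violation_bound \<alpha> \<delta> m < p"
    unfolding eventually_sequentially by auto
  define M where "M = max (max j0 M1) M2"
  have M: "M \<ge> j0" "M \<ge> M1" "M \<ge> M2" by (auto simp: M_def)
  have "\<forall>\<^sub>F \<epsilon> in at_right 0. (\<forall>j\<in>{1..<M}. (\<epsilon> * \<sigma> j)\<^sup>2 < \<eta> * a j) \<and> \<epsilon> > 0"
    by (intro eventually_conj eventually_signal_dominates \<eta> eventually_at_right_less)
  then show ?thesis
  proof eventually_elim
    case (elim \<epsilon>)
    then have \<epsilon>: "\<epsilon> > 0" and low: "\<forall>j\<in>{1..<M}. (\<epsilon> * \<sigma> j)\<^sup>2 < \<eta> * a j" by auto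
    obtain m where m: "m \<ge> M" and quiet: "\<And>j. 1 \<le> j \<Longrightarrow> j < m \<Longrightarrow> (\<epsilon> * \<sigma> j)\<^sup>2 < \<eta> * a j"
      and noisy: "\<And>j. j \<ge> m \<Longrightarrow> \<eta> * a j \<le> (\<epsilon> * \<sigma> j)\<^sup>2"
      using crossover [OF \<epsilon> M(1) low] by blast
    have m1: "m \<ge> 1" using m M(1) j0 by simp
    have bayes: "bayes_risk_ge (prior \<alpha> P0 \<delta> m j) (\<epsilon> * \<sigma> j) ((1 - \<kappa>) * bayes_term \<epsilon> j)" if j: "1 \<le> j" for j
    proof -
      have s: "\<epsilon> * \<sigma> j > 0" using \<epsilon> \<sigma> [OF j] by simp
      have ext: "extremal \<alpha> P0 j > 0" using extremal_pos [OF \<alpha> P0 j] .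
      show ?thesis
      proof (cases "j < m")
        case True
        have "24 * (\<epsilon> * \<sigma> j)\<^sup>2 \<le> \<kappa> ^ 3 * (a j * 2 powr (- 2 * \<alpha> - 1))"
          using quiet [OF j True] by (simp add: \<eta>_def algebra_simps)
        also have "\<dots> \<le> \<kappa> ^ 3 * (sqrt (extremal \<alpha> P0 j))\<^sup>2"
          using extremal_ge_half_power [OF \<alpha> P0 j] ext \<kappa> by (intro mult_left_mono) auto
        finally have "bayes_risk_ge (prior \<alpha> P0 \<delta> m j) (\<epsilon> * \<sigma> j) ((1 - \<kappa>) * (\<epsilon> * \<sigma> j)\<^sup>2)"
          using True ext s \<kappa> by (simp only: prior_def if_True) (intro uniform_bayes_efficient, auto)
        moreover have "(1 - \<kappa>) * bayes_term \<epsilon> j \<le> (1 - \<kappa>) * (\<epsilon> * \<sigma> j)\<^sup>2"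
          using bayes_term_le_noise [OF j] \<kappa> by (intro mult_left_mono) auto
        ultimately show ?thesis by (rule bayes_risk_ge_mono)
      next
        case False
        have "(1 - \<kappa>) * a j \<le> (1 - \<delta>) * ((1 - \<delta>) * a j)"
        proof -
          have "1 - \<kappa> \<le> (1 - \<delta>) * (1 - \<delta>)" by (simp add: \<delta>_def algebra_simps)
          then have "(1 - \<kappa>) * a j \<le> (1 - \<delta>) * (1 - \<delta>) * a j" using a_pos [OF j] by (intro mult_right_mono) auto
          then show ?thesis by (simp add: mult.assoc)
        qed
        also have "\<dots> \<le> (1 - \<delta>) * extremal \<alpha> P0 j"
          using M1 [of j] False m M \<delta> by (intro mult_left_mono) auto
        finally have "bayes_risk_ge (centred_normal ((1 - \<delta>) * extremal \<alpha> P0 j)) (\<epsilon> * \<sigma> j)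
            ((1 - \<kappa>) * (a j * (\<epsilon> * \<sigma> j)\<^sup>2 / (a j + (\<epsilon> * \<sigma> j)\<^sup>2)))"
          using s a_pos [OF j] \<kappa> by (intro normal_bayes_efficient) auto
        then show ?thesis using False by (simp add: prior_def bayes_term_def)
      qed
    qed
    have F0: "bayes_sum \<epsilon> \<ge> 0" using partial_sum_le_bayes_sum [of \<epsilon> 0] by simp
    have err: "12 * sqrt p * tail_bound \<alpha> P0 m \<le> \<kappa> * bayes_sum \<epsilon>"
    proof -
      have "12 * sqrt p * tail_bound \<alpha> P0 m = \<kappa> * (\<eta> / (1 + \<eta>) * tail_bound \<alpha> P0 m)"
        unfolding p(4) \<theta>_def using \<eta> by (simp add: field_simps)
      also have "\<dots> \<le> \<kappa> * bayes_sum \<epsilon>"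
        using \<kappa> tail_bound_le_bayes_sum [OF m1 \<eta> noisy] by (intro mult_left_mono) auto
      finally show ?thesis .
    qed
    show ?case
    proof (intro ballI allI impI)
      fix T R assume T: "T \<in> measurable seq_space seq_space"
        and R: "\<forall>x\<in>B \<alpha> P0. (\<integral>\<^sup>+z. norm_sq (\<lambda>j. T (observe (\<lambda>j. \<epsilon> * \<sigma> j) x z) j - x j) \<partial>noise) \<le> R"
      have "ennreal ((1 - p) * (\<Sum>j\<in>{1..J}. (1 - \<kappa>) * bayes_term \<epsilon> j)) \<le> R + ennreal (\<kappa> * bayes_sum \<epsilon>)" if "J \<ge> m" for J
      proof -
        have "ennreal ((1 - p) * (\<Sum>j\<in>{1..J}. (1 - \<kappa>) * bayes_term \<epsilon> j)) \<le> R + ennreal (12 * sqrt p * tail_bound \<alpha> P0 m)"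
          using R M2 [of m] m M p \<kappa> bayes_term_nonneg
          by (intro bayes_lower_bound [OF \<alpha> P0 \<delta> m1 that T bayes]) auto
        also have "\<dots> \<le> R + ennreal (\<kappa> * bayes_sum \<epsilon>)"
          using err by (intro add_left_mono ennreal_leI)
        finally show ?thesis .
      qed
      moreover have "(\<lambda>J. ennreal ((1 - p) * (\<Sum>j\<in>{1..J}. (1 - \<kappa>) * bayes_term \<epsilon> j))) \<longlonglongrightarrow> ennreal ((1 - p) * ((1 - \<kappa>) * bayes_sum \<epsilon>))"
        unfolding sum_distrib_left [symmetric] by (intro tendsto_intros tendsto_ennrealI bayes_sum_tendsto)
      ultimately have "ennreal ((1 - p) * ((1 - \<kappa>) * bayes_sum \<epsilon>)) \<le> R + ennreal (\<kappa> * bayes_sum \<epsilon>)"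
        by (intro LIMSEQ_le_const2 [of _ "ennreal ((1 - p) * ((1 - \<kappa>) * bayes_sum \<epsilon>))"]) auto
      then have "ennreal ((1 - p) * ((1 - \<kappa>) * bayes_sum \<epsilon>) - \<kappa> * bayes_sum \<epsilon>) \<le> R"
        using \<kappa> F0 by (intro ennreal_diff_le_of_le_add) auto
      moreover have "(1 - 3 * \<kappa>) * bayes_sum \<epsilon> \<le> (1 - p) * ((1 - \<kappa>) * bayes_sum \<epsilon>) - \<kappa> * bayes_sum \<epsilon>"
      proof -
        have "(1 - 2 * \<kappa>) \<le> (1 - \<kappa>) * (1 - \<kappa>)" by (simp add: algebra_simps)
        also have "\<dots> \<le> (1 - p) * (1 - \<kappa>)" using p \<kappa> by (intro mult_right_mono) auto
        finally have "(1 - 2 * \<kappa>) * bayes_sum \<epsilon> \<le> (1 - p) * (1 - \<kappa>) * bayes_sum \<epsilon>" using F0 by (intro mult_right_mono) auto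
        then show ?thesis by (simp add: algebra_simps)
      qed
      ultimately show "ennreal ((1 - 3 * \<kappa>) * bayes_sum \<epsilon>) \<le> R" by (meson ennreal_leI order_trans)
    qed
  qed
qed

end

section \<open>Asymptotic minimaxity\<close>

text \<open>
The correction \<open>\<delta>\<close> is the ratio of the real values minus 1, which is meaningful as soon as \<open>g\<close> is
positive and finite.
\<close>

lemma asymp_eq0_squeeze:
  fixes f g :: "real \<Rightarrow> ennreal"
  assumes g: "\<forall>\<^sub>F \<epsilon> in at_right 0. 0 < g \<epsilon> \<and> g \<epsilon> < \<infinity>"
    and upper: "\<And>\<kappa>. 0 < \<kappa> \<Longrightarrow> \<forall>\<^sub>F \<epsilon> in at_right 0. f \<epsilon> \<le> ennreal (1 + \<kappa>) * g \<epsilon>"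
    and lower: "\<And>\<kappa>. 0 < \<kappa> \<Longrightarrow> \<forall>\<^sub>F \<epsilon> in at_right 0. ennreal (1 - \<kappa>) * g \<epsilon> \<le> f \<epsilon>"
  shows "asymp_eq0 f g"
proof -
  define \<delta> where "\<delta> \<epsilon> = enn2real (f \<epsilon>) / enn2real (g \<epsilon>) - 1" for \<epsilon>
  have fin: "\<forall>\<^sub>F \<epsilon> in at_right 0. 0 < g \<epsilon> \<and> g \<epsilon> < \<infinity> \<and> f \<epsilon> < \<infinity>"
    using g upper [of 1, simplified]
    by eventually_elim (auto simp: ennreal_mult_less_top elim!: le_less_trans)
  have real: "f \<epsilon> = ennreal (enn2real (f \<epsilon>))" "g \<epsilon> = ennreal (enn2real (g \<epsilon>))" "enn2real (g \<epsilon>) > 0"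
    if "0 < g \<epsilon> \<and> g \<epsilon> < \<infinity> \<and> f \<epsilon> < \<infinity>" for \<epsilon>
    using that by (auto simp: enn2real_positive_iff)
  have "(\<delta> \<longlongrightarrow> 0) (at_right 0)"
  proof (rule tendstoI)
    fix e :: real assume e: "e > 0"
    define \<kappa> where "\<kappa> = min (e / 2) (1 / 2)"
    have \<kappa>: "0 < \<kappa>" "\<kappa> < 1" "\<kappa> < e" using e by (auto simp: \<kappa>_def)
    show "\<forall>\<^sub>F \<epsilon> in at_right 0. dist (\<delta> \<epsilon>) 0 < e"
      using fin upper [OF \<kappa>(1)] lower [OF \<kappa>(1)]
    proof eventually_elim
      case (elim \<epsilon>)
      define u v where "u = enn2real (f \<epsilon>)" and "v = enn2real (g \<epsilon>)"
      have uv: "f \<epsilon> = ennreal u" "g \<epsilon> = ennreal v" "v > 0" "u \<ge> 0"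
        using real [OF elim(1)] by (auto simp: u_def v_def)
      have "ennreal ((1 + \<kappa>) * v) = ennreal (1 + \<kappa>) * ennreal v"
        using \<kappa> by (intro ennreal_mult') auto
      then have "ennreal u \<le> ennreal ((1 + \<kappa>) * v)"
        using elim(2) by (simp only: uv(1,2))
      then have "u \<le> (1 + \<kappa>) * v"
        using uv(3) \<kappa> by (subst (asm) ennreal_le_iff) auto
      moreover have "(1 - \<kappa>) * v \<le> u"
        using elim(3) uv \<kappa> by (auto simp: ennreal_mult' [symmetric])
      ultimately have "\<bar>u / v - 1\<bar> \<le> \<kappa>" using uv(3) by (simp add: abs_le_iff field_simps)
      then show ?case using \<kappa> by (simp add: \<delta>_def u_def v_def dist_real_def)
    qed
  qed
  moreover have "\<forall>\<^sub>F \<epsilon> in at_right 0. f \<epsilon> = g \<epsilon> * ennreal (1 + \<delta> \<epsilon>)"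
    using fin
  proof eventually_elim
    case (elim \<epsilon>)
    have "g \<epsilon> * ennreal (1 + \<delta> \<epsilon>)
        = ennreal (enn2real (g \<epsilon>)) * ennreal (enn2real (f \<epsilon>) / enn2real (g \<epsilon>))"
      by (simp add: \<delta>_def real(2) [OF elim, symmetric])
    also have "\<dots> = ennreal (enn2real (g \<epsilon>) * (enn2real (f \<epsilon>) / enn2real (g \<epsilon>)))"
      by (rule ennreal_mult' [symmetric]) simp
    also have "enn2real (g \<epsilon>) * (enn2real (f \<epsilon>) / enn2real (g \<epsilon>)) = enn2real (f \<epsilon>)"
      using real(3) [OF elim] by simp
    also have "ennreal (enn2real (f \<epsilon>)) = f \<epsilon>"
      using real(1) [OF elim] by (rule sym)
    finally show ?case ..
  qed
  ultimately show ?thesis unfolding asymp_eq0_def by blast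
qed

theorem theorem2p2:
  fixes \<alpha> P0 :: real and \<sigma> :: "nat \<Rightarrow> real"
    and M :: "'a measure" and \<xi> :: "nat \<Rightarrow> 'a \<Rightarrow> real"
  assumes "\<alpha> > 0" and "P0 > 0"
    and "\<And>j. j \<ge> 1 \<Longrightarrow> \<sigma> j > 0"
    and "prob_space M"
    and "prob_space.indep_vars M (\<lambda>_. borel) \<xi> {1..}"
    and "\<And>j. j \<ge> 1 \<Longrightarrow> distributed M lborel (\<xi> j) (\<lambda>z. ennreal (std_normal_density z))"
    and "\<exists>c>0. \<forall>j\<ge>1. c < (\<sigma> j)\<^sup>2"
    and "\<exists>j0\<ge>1. \<forall>j>j0.
           (\<sigma> j)\<^sup>2 * real j powr (2 * \<alpha> + 1)
             / ((\<sigma> (j - 1))\<^sup>2 * real (j - 1) powr (2 * \<alpha> + 1)) > 1"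
  shows "asymptotically_minimax M \<xi> \<sigma> \<alpha> P0 (\<lambda>\<epsilon>. linear_estimator (weight \<alpha> P0 \<sigma> \<epsilon>))
    \<and> asymp_eq0 (\<lambda>\<epsilon>. sup_risk M \<xi> \<sigma> \<alpha> P0 \<epsilon> (linear_estimator (weight \<alpha> P0 \<sigma> \<epsilon>)))
                (risk_formula \<alpha> P0 \<sigma>)"
proof -
  obtain c where c: "c > 0" "\<And>j. j \<ge> 1 \<Longrightarrow> c < (\<sigma> j)\<^sup>2" using assms(7) by blast
  obtain j0 where j0: "j0 \<ge> 1" "\<And>j. j > j0 \<Longrightarrow> (\<sigma> j)\<^sup>2 * real j powr (2 * \<alpha> + 1)
             / ((\<sigma> (j - 1))\<^sup>2 * real (j - 1) powr (2 * \<alpha> + 1)) > 1" using assms(8) by blast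
  interpret inverse_problem \<alpha> P0 \<sigma> c j0
    using assms(1-3) c j0 by unfold_locales auto
  define lin where "lin = (\<lambda>\<epsilon>. linear_estimator (weight \<alpha> P0 \<sigma> \<epsilon>))"
  define S where "S = (\<lambda>\<epsilon>. sup_risk M \<xi> \<sigma> \<alpha> P0 \<epsilon> (lin \<epsilon>))"
  define X where "X = (\<lambda>\<epsilon>. minimax_risk M \<xi> \<sigma> \<alpha> P0 \<epsilon>)"
  have lin: "lin \<epsilon> \<in> estimators" for \<epsilon>
    unfolding lin_def estimators_def by (rule linear_estimator_measurable)
  have risk: "risk M \<xi> \<sigma> \<epsilon> T x = (\<integral>\<^sup>+z. norm_sq (\<lambda>j. T (observe (\<lambda>j. \<epsilon> * \<sigma> j) x z) j - x j) \<partial>noise)"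
    if "T \<in> estimators" for \<epsilon> T x
    using assms(4-6) that by (rule risk_noise)
  have X_le_S: "X \<epsilon> \<le> S \<epsilon>" for \<epsilon>
    unfolding X_def S_def minimax_risk_def by (rule INF_lower [OF lin])
  have S_le: "S \<epsilon> \<le> ennreal (bayes_sum \<epsilon> + \<epsilon> ^ 4 * low_frequency_bias)" if "\<epsilon> > 0" for \<epsilon>
    unfolding S_def sup_risk_def
    by (rule SUP_least, subst risk [OF lin], unfold lin_def, rule linear_risk_le [OF that])
  have small: "\<forall>\<^sub>F \<epsilon> in at_right 0. 0 < \<epsilon> \<and> \<epsilon> < (1::real)"
    using eventually_at_right_real [of 0 1] by (simp add: eventually_at_filter)
  have F_pos: "bayes_sum \<epsilon> > 0" if "0 < \<epsilon>" "\<epsilon> < 1" for \<epsilon>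
    using bayes_sum_ge_square [of \<epsilon>] bayes_term_one_pos that by (smt (verit) mult_pos_pos zero_less_power)
  have S_upper: "\<forall>\<^sub>F \<epsilon> in at_right 0. S \<epsilon> \<le> ennreal ((1 + \<kappa>) * bayes_sum \<epsilon>)" if \<kappa>: "\<kappa> > 0" for \<kappa>
  proof -
    have "((\<lambda>\<epsilon>. \<epsilon>\<^sup>2 * low_frequency_bias) \<longlongrightarrow> 0\<^sup>2 * low_frequency_bias) (at_right 0)" by (intro tendsto_intros)
    then have "\<forall>\<^sub>F \<epsilon> in at_right 0. \<epsilon>\<^sup>2 * low_frequency_bias < \<kappa> * bayes_term 1 1"
      using \<kappa> bayes_term_one_pos by (intro order_tendstoD(2)) auto
    with small show ?thesis
    proof eventually_elim
      case (elim \<epsilon>)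
      have "\<epsilon> ^ 4 * low_frequency_bias = \<epsilon>\<^sup>2 * (\<epsilon>\<^sup>2 * low_frequency_bias)" by (simp add: power2_eq_square power4_eq_xxxx)
      also have "\<dots> \<le> \<epsilon>\<^sup>2 * (\<kappa> * bayes_term 1 1)" using elim by (intro mult_left_mono) auto
      also have "\<dots> = \<kappa> * (\<epsilon>\<^sup>2 * bayes_term 1 1)" by simp
      also have "\<dots> \<le> \<kappa> * bayes_sum \<epsilon>" using bayes_sum_ge_square [of \<epsilon>] elim \<kappa> by (intro mult_left_mono) auto
      finally have "ennreal (bayes_sum \<epsilon> + \<epsilon> ^ 4 * low_frequency_bias) \<le> ennreal ((1 + \<kappa>) * bayes_sum \<epsilon>)"
        by (intro ennreal_leI) (simp add: algebra_simps)
      then show ?case using S_le [of \<epsilon>] elim by (meson order_trans)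
    qed
  qed
  have X_lower: "\<forall>\<^sub>F \<epsilon> in at_right 0. ennreal ((1 - \<kappa>) * bayes_sum \<epsilon>) \<le> X \<epsilon>" if \<kappa>: "0 < \<kappa>" "\<kappa> < 1" for \<kappa>
  proof -
    have "0 < \<kappa> / 3" "\<kappa> / 3 < 1" using \<kappa> by auto
    from eventually_risk_lower_bound [OF this] show ?thesis
    proof eventually_elim
      case (elim \<epsilon>)
      show ?case
        unfolding X_def minimax_risk_def
      proof (rule INF_greatest)
        fix T assume T: "T \<in> estimators"
        have "risk M \<xi> \<sigma> \<epsilon> T x \<le> sup_risk M \<xi> \<sigma> \<alpha> P0 \<epsilon> T" if "x \<in> B \<alpha> P0" for x
          unfolding sup_risk_def using that by (rule SUP_upper)
        then show "ennreal ((1 - \<kappa>) * bayes_sum \<epsilon>) \<le> sup_risk M \<xi> \<sigma> \<alpha> P0 \<epsilon> T"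
          using elim T by (simp add: risk [OF T] estimators_def)
      qed
    qed
  qed
  have S_lower: "\<forall>\<^sub>F \<epsilon> in at_right 0. ennreal (1 - \<kappa>) * ennreal (bayes_sum \<epsilon>) \<le> S \<epsilon>" if \<kappa>: "0 < \<kappa>" for \<kappa>
  proof (cases "\<kappa> < 1")
    case True
    show ?thesis using X_lower [OF \<kappa> True]
    proof eventually_elim
      case (elim \<epsilon>)
      then show ?case using X_le_S [of \<epsilon>] True by (simp add: ennreal_mult' [symmetric])
    qed
  qed (simp add: ennreal_neg)
  have "asymp_eq0 S (\<lambda>\<epsilon>. ennreal (bayes_sum \<epsilon>))"
  proof (rule asymp_eq0_squeeze)
    show "\<forall>\<^sub>F \<epsilon> in at_right 0. 0 < ennreal (bayes_sum \<epsilon>) \<and> ennreal (bayes_sum \<epsilon>) < \<infinity>"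
      using small by eventually_elim (simp add: F_pos)
    show "\<forall>\<^sub>F \<epsilon> in at_right 0. S \<epsilon> \<le> ennreal (1 + \<kappa>) * ennreal (bayes_sum \<epsilon>)" if "0 < \<kappa>" for \<kappa>
      using S_upper [OF that] that by (simp add: ennreal_mult')
  qed (rule S_lower)
  moreover have "asymp_eq0 S X"
  proof (rule asymp_eq0_squeeze)
    show "\<forall>\<^sub>F \<epsilon> in at_right 0. 0 < X \<epsilon> \<and> X \<epsilon> < \<infinity>"
      using small X_lower [of "1/2", simplified] S_upper [of 1, simplified]
    proof eventually_elim
      case (elim \<epsilon>)
      have "0 < ennreal (bayes_sum \<epsilon> / 2)" using F_pos [of \<epsilon>] elim by simp
      then have "0 < X \<epsilon>" using elim(2) by (rule less_le_trans)
      moreover have "X \<epsilon> < \<infinity>"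
        using order_trans [OF X_le_S elim(3)] by (rule le_less_trans) simp
      ultimately show ?case ..
    qed
    show "\<forall>\<^sub>F \<epsilon> in at_right 0. ennreal (1 - \<kappa>) * X \<epsilon> \<le> S \<epsilon>" if "0 < \<kappa>" for \<kappa>
    proof (rule always_eventually, rule allI)
      fix \<epsilon>
      have "ennreal (1 - \<kappa>) * X \<epsilon> \<le> 1 * S \<epsilon>"
        using that by (intro mult_mono X_le_S) (auto simp flip: ennreal_1)
      then show "ennreal (1 - \<kappa>) * X \<epsilon> \<le> S \<epsilon>" by simp
    qed
    show "\<forall>\<^sub>F \<epsilon> in at_right 0. S \<epsilon> \<le> ennreal (1 + \<kappa>) * X \<epsilon>" if \<kappa>: "0 < \<kappa>" for \<kappa>
    proof -
      define \<mu> where "\<mu> = min (\<kappa> / 4) (1 / 4)"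
      have \<mu>: "0 < \<mu>" "\<mu> < 1" "\<mu> \<le> \<kappa> / 4" "\<mu> \<le> 1 / 4" using \<kappa> by (auto simp: \<mu>_def)
      have k: "1 + \<mu> \<le> (1 + \<kappa>) * (1 - \<mu>)"
      proof -
        have "\<kappa> * \<mu> \<le> \<kappa> * (1 / 4)" using \<kappa> \<mu> by (intro mult_left_mono) auto
        then have "\<kappa> * \<mu> + 2 * \<mu> \<le> \<kappa>" using \<mu> by linarith
        then show ?thesis by (simp add: algebra_simps)
      qed
      show ?thesis
        using small X_lower [OF \<mu>(1,2)] S_upper [OF \<mu>(1)]
      proof eventually_elim
        case (elim \<epsilon>)
        have "S \<epsilon> \<le> ennreal ((1 + \<mu>) * bayes_sum \<epsilon>)" by (rule elim(3))
        also have "\<dots> \<le> ennreal ((1 + \<kappa>) * (1 - \<mu>) * bayes_sum \<epsilon>)"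
          using k F_pos [of \<epsilon>] elim by (intro ennreal_leI mult_right_mono) auto
        also have "\<dots> = ennreal (1 + \<kappa>) * ennreal ((1 - \<mu>) * bayes_sum \<epsilon>)"
          using \<kappa> by (simp add: ennreal_mult' mult.assoc)
        also have "\<dots> \<le> ennreal (1 + \<kappa>) * X \<epsilon>" by (intro mult_left_mono elim(2)) simp
        finally show ?case .
      qed
    qed
  qed
  ultimately show ?thesis
    using lin by (simp add: asymptotically_minimax_def S_def X_def lin_def risk_formula_eq [abs_def])
qed

end
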